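(* There exist absolute constants $C_1,C_2,c>0$ such that the following holds. Let $d,n\ge1$, $0<\epsilon<1/2$, $0<\tau<1$ and $k\ge4$. Let $S$ be a multiset of $n$ i.i.d. samples from a distribution on $\mathbb{R}^d$ with mean $\mu$, covariance $\Sigma=I$, and bounded $k$-th central moment $\sigma_k$. Put $\epsilon'=C_1\left(\frac{\log(1/\tau)}{n}+\epsilon\right)$ and suppose $\epsilon'\le c$. Then, with probability at least $1-\tau$, there exists a subset $S'\subseteq S$ such that $|S'|\ge(1-\epsilon')n$ and $S'$ is $(2\epsilon',\delta)$-stable with respect to $\mu$ and $\sigma^2=1$, where $$\delta=C_2\left(\sqrt{\frac{d\,\max\{1,\log d\}}{n}}+\sigma_k\,\epsilon^{1-\frac1k}+\sigma_4\sqrt{\frac{\log(1/\tau)}{n}}\right).$$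
   Context: $\|\cdot\|$ is the Euclidean norm of a vector and the spectral norm of a matrix. Bounded central moments. A distribution of $X$ on $\mathbb{R}^d$ with mean $\mu$ has bounded $k$-th central moment $\sigma_k$ if $\left(\mathbb{E}|v^T(X-\mu)|^k\right)^{1/k}\le\sigma_k\left(\mathbb{E}(v^T(X-\mu))^2\right)^{1/2}$ for all unit vectors $v$. $\sigma_4$ denotes the corresponding bound for the fourth central moment (for definiteness, the smallest constant valid for exponent $4$). Stability. For a finite multiset $S\subset\mathbb{R}^d$ and a fixed $\mu\in\mathbb{R}^d$, let $\mu_S=\frac1{|S|}\sum_{x\in S}x$ and $\overline{\Sigma}_S=\frac1{|S|}\sum_{x\in S}(x-\mu)(x-\mu)^T$. For $0<\epsilon<1/2$ and $\delta\ge\epsilon$, $S$ is $(\epsilon,\delta)$-stable with respect to $\mu$ and $\sigma^2$ if for every $S'\subseteq S$ with $|S'|\ge(1-\epsilon)|S|$: (i) $\|\mu_{S'}-\mu\|\le\sigma\delta$, and (ii) $\|\overline{\Sigma}_{S'}-\sigma^2 I\|\le\sigma^2\delta^2/\epsilon$. *)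

theory Defs
  imports "HOL-Probability.Probability" "HOL-Library.Multiset"
begin

text \<open>
  The constants of the theorem must not depend on the dimension, so the dimension is a natural
  number and not a type: a vector of \<open>\<real>\<^sup>d\<close> is a function \<open>nat \<Rightarrow> real\<close> of which
  only the values on \<open>{..<d}\<close> matter, and a \<open>d \<times> d\<close> matrix is a function
  \<open>nat \<Rightarrow> nat \<Rightarrow> real\<close>. The Euclidean norm of \<open>v\<close> is \<open>L2_set v {..<d}\<close>.
\<close>

definition inner_vec :: "nat \<Rightarrow> (nat \<Rightarrow> real) \<Rightarrow> (nat \<Rightarrow> real) \<Rightarrow> real" where
  "inner_vec d v w = (\<Sum>i<d. v i * w i)"

definition mat_vec :: "nat \<Rightarrow> (nat \<Rightarrow> nat \<Rightarrow> real) \<Rightarrow> (nat \<Rightarrow> real) \<Rightarrow> nat \<Rightarrow> real" where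
  "mat_vec d A v = (\<lambda>i. \<Sum>j<d. A i j * v j)"

definition id_mat :: "nat \<Rightarrow> nat \<Rightarrow> real" where
  "id_mat i j = (if i = j then 1 else 0)"

text \<open>Same form as \<^const>\<open>onorm\<close>; vectors with zero norm contribute \<open>0 / 0 = 0\<close>.\<close>

definition spectral_norm :: "nat \<Rightarrow> (nat \<Rightarrow> nat \<Rightarrow> real) \<Rightarrow> real" where
  "spectral_norm d A = (SUP v. L2_set (mat_vec d A v) {..<d} / L2_set v {..<d})"

definition distribution_on_Rd :: "nat \<Rightarrow> (nat \<Rightarrow> real) measure \<Rightarrow> bool" where
  "distribution_on_Rd d P \<longleftrightarrow>
     prob_space P \<and> sets P = sets (Pi\<^sub>M {..<d} (\<lambda>_. borel :: real measure))"

definition has_mean :: "nat \<Rightarrow> (nat \<Rightarrow> real) measure \<Rightarrow> (nat \<Rightarrow> real) \<Rightarrow> bool" where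
  "has_mean d P \<mu> \<longleftrightarrow>
     (\<forall>i<d. integrable P (\<lambda>x. x i) \<and> (\<integral>x. x i \<partial>P) = \<mu> i)"

definition has_covariance ::
  "nat \<Rightarrow> (nat \<Rightarrow> real) measure \<Rightarrow> (nat \<Rightarrow> real) \<Rightarrow> (nat \<Rightarrow> nat \<Rightarrow> real) \<Rightarrow> bool" where
  "has_covariance d P \<mu> \<Sigma> \<longleftrightarrow>
     (\<forall>i<d. \<forall>j<d. integrable P (\<lambda>x. (x i - \<mu> i) * (x j - \<mu> j)) \<and>
                  (\<integral>x. (x i - \<mu> i) * (x j - \<mu> j) \<partial>P) = \<Sigma> i j)"

text \<open>
  The Bochner integral of a non-integrable function is \<open>0\<close>, so finiteness of the
  \<open>k\<close>-th moment has to be required explicitly. Finiteness of the second moment then follows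
  for \<open>k \<ge> 2\<close>.
\<close>

definition bounded_central_moment ::
  "nat \<Rightarrow> (nat \<Rightarrow> real) measure \<Rightarrow> (nat \<Rightarrow> real) \<Rightarrow> real \<Rightarrow> real \<Rightarrow> bool" where
  "bounded_central_moment d P \<mu> k s \<longleftrightarrow>
     (\<forall>v. L2_set v {..<d} = 1 \<longrightarrow>
        integrable P (\<lambda>x. \<bar>inner_vec d v (\<lambda>i. x i - \<mu> i)\<bar> powr k) \<and>
        (\<integral>x. \<bar>inner_vec d v (\<lambda>i. x i - \<mu> i)\<bar> powr k \<partial>P) powr (1 / k)
          \<le> s * sqrt (\<integral>x. (inner_vec d v (\<lambda>i. x i - \<mu> i))\<^sup>2 \<partial>P))"

text \<open>
  For \<open>d \<ge> 1\<close> and identity covariance the admissible constants, if there are any, form a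
  closed half-line bounded below, so the least one exists.
\<close>

definition least_central_moment_bound ::
  "nat \<Rightarrow> (nat \<Rightarrow> real) measure \<Rightarrow> (nat \<Rightarrow> real) \<Rightarrow> real \<Rightarrow> real" where
  "least_central_moment_bound d P \<mu> k = (LEAST s. bounded_central_moment d P \<mu> k s)"

definition sample_mean :: "(nat \<Rightarrow> real) multiset \<Rightarrow> nat \<Rightarrow> real" where
  "sample_mean S = (\<lambda>i. (\<Sum>x\<in>#S. x i) / real (size S))"

definition sample_second_moment ::
  "(nat \<Rightarrow> real) \<Rightarrow> (nat \<Rightarrow> real) multiset \<Rightarrow> nat \<Rightarrow> nat \<Rightarrow> real" where
  "sample_second_moment \<mu> S =
     (\<lambda>i j. (\<Sum>x\<in>#S. (x i - \<mu> i) * (x j - \<mu> j)) / real (size S))"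

text \<open>Stability with respect to \<open>\<mu>\<close> and \<open>\<sigma>\<^sup>2\<close>; the last argument is \<open>\<sigma>\<close>.\<close>

definition stable_multiset ::
  "nat \<Rightarrow> real \<Rightarrow> real \<Rightarrow> (nat \<Rightarrow> real) multiset \<Rightarrow> (nat \<Rightarrow> real) \<Rightarrow> real \<Rightarrow> bool" where
  "stable_multiset d \<epsilon> \<delta> S \<mu> \<sigma> \<longleftrightarrow>
     0 < \<epsilon> \<and> \<epsilon> < 1/2 \<and> \<delta> \<ge> \<epsilon> \<and>
     (\<forall>S'. S' \<subseteq># S \<and> real (size S') \<ge> (1 - \<epsilon>) * real (size S) \<longrightarrow>
        L2_set (\<lambda>i. sample_mean S' i - \<mu> i) {..<d} \<le> \<sigma> * \<delta> \<and>
        spectral_norm d (\<lambda>i j. sample_second_moment \<mu> S' i j - \<sigma>\<^sup>2 * id_mat i j)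
          \<le> \<sigma>\<^sup>2 * \<delta>\<^sup>2 / \<epsilon>)"

text \<open>The multiset of the samples \<open>X 0, \<dots>, X (n - 1)\<close>, repetitions counted.\<close>

definition samples :: "nat \<Rightarrow> (nat \<Rightarrow> nat \<Rightarrow> real) \<Rightarrow> (nat \<Rightarrow> real) multiset" where
  "samples n X = image_mset X (mset_set {..<n})"

end

theory Submission
  imports Defs
begin

text \<open>
  Let \<open>L = ln (1/\<tau>)\<close>, \<open>\<alpha> = \<epsilon>'\<close> and let \<open>\<alpha> \<beta>\<close> be of order \<open>\<delta>\<^sup>2\<close>.  It suffices to find \<open>(1 - \<alpha>) n\<close>
  points such that, whichever \<open>2 \<alpha> n\<close> of them are deleted, the empirical second moments stay within
  \<open>O(\<beta>)\<close> of the identity and the sum of the centered points has norm \<open>O(n \<surd>(\<alpha> \<beta>))\<close>.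

  Discard the points of squared norm above \<open>160 d min(\<beta>, 1)/\<alpha>\<close> and split the squared projection to
  each direction of a \<open>1/4\<close>-net at level \<open>\<theta> = \<beta>/\<alpha>\<close> into a clipped part and an excess.  The clipped
  parts concentrate, by a union bound over the net.  The total excess is \<open>O(\<beta> n)\<close> with probability
  \<open>1/2\<close>, by a moment proof of the noncommutative Khinchine inequality for rank-one matrices, which
  costs the factor \<open>log d\<close>.  Talagrand's inequality for control by two points turns this into
  probability \<open>1 - e\<^sup>-\<^sup>L\<close> after the deletion of \<open>O(\<alpha> n)\<close> points.  The sum is compared with that of an
  independent copy: exchanging coordinates at random gives a Rademacher sum, whose moments involve
  the weak variance, and this has just been bounded.  The moment assumptions enter only through
  \<open>E z\<^sup>2 1{z\<^sup>2 > \<theta>} \<le> \<beta>\<close> for one-dimensional projections \<open>z\<close>, where the second moment is enough when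
  \<open>\<beta> \<ge> 1\<close>; this happens in particular when \<open>L/n\<close> dominates \<open>\<epsilon>\<close>.  If \<open>\<alpha> n\<close> is bounded, then
  \<open>\<tau> \<ge> 1/2\<close> and Markov's inequality is enough.
\<close>

section \<open>Rademacher sums of vectors\<close>

text \<open>Both stability conditions live on one scale: if \<alpha> \<beta> is of order \<delta>^2,
  then a second-moment error \<beta> is \<delta>^2/\<alpha>, and by Cauchy-Schwarz \<alpha> n points
  of total energy \<beta> n in every direction move the sum by at most n sqrt(\<alpha> \<beta>). The
  main obstacle is that L has to enter \<delta>^2 next to d log d as a summand. Higher moments in
  the operator inequality would multiply the two, so that inequality is used only at constant
  probability, and confidence is bought with deleted points. Deletion makes the index set depend on
  the sample. In the last symmetrization a single index set is therefore chosen for the pair (X, Y),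
  and it serves all exchanges at once. A second obstacle recurs: the variance of a symmetrized sum
  is of the kind that is being estimated. Totals over X and Y together do not change under exchange,
  and this leads to quadratic inequalities for the unknown deviation that close by
  themselves.\<close>

lemma inner_vec_commute: "inner_vec d v w = inner_vec d w v"
  by (simp add: inner_vec_def mult.commute)

lemma inner_vec_diff: "inner_vec d (\<lambda>i. v i - w i) u = inner_vec d v u - inner_vec d w u"
  by (simp add: inner_vec_def sum_subtractf algebra_simps)

lemma inner_vec_scale: "inner_vec d (\<lambda>i. c * v i) u = c * inner_vec d v u"
  by (simp add: inner_vec_def sum_distrib_left algebra_simps)

lemma inner_vec_sum: "inner_vec d (\<lambda>j. \<Sum>i\<in>I. f i j) u = (\<Sum>i\<in>I. inner_vec d (f i) u)"
  unfolding inner_vec_def by (simp add: sum_distrib_right) (rule sum.swap)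

lemma inner_vec_lincomb:
  "inner_vec d (\<lambda>j. \<Sum>i\<in>I. c i * f i j) u = (\<Sum>i\<in>I. c i * inner_vec d (f i) u)"
  by (simp add: inner_vec_sum inner_vec_scale)

lemma inner_vec_scale_right: "inner_vec d u (\<lambda>i. c * v i) = c * inner_vec d u v"
  by (simp add: inner_vec_def sum_distrib_left algebra_simps)

lemma inner_vec_diff_right: "inner_vec d u (\<lambda>i. v i - w i) = inner_vec d u v - inner_vec d u w"
  by (simp add: inner_vec_def sum_subtractf algebra_simps)

lemma inner_vec_self_nonneg [simp]: "0 \<le> inner_vec d v v"
  by (simp add: inner_vec_def sum_nonneg)

lemma inner_vec_Cauchy_Schwarz: "(inner_vec d v w)\<^sup>2 \<le> inner_vec d v v * inner_vec d w w"
proof -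
  have "(inner_vec d v w)\<^sup>2 \<le> (\<Sum>i<d. (v i)\<^sup>2) * (\<Sum>i<d. (w i)\<^sup>2)"
    unfolding inner_vec_def by (rule Cauchy_Schwarz_ineq_sum)
  then show ?thesis by (simp add: inner_vec_def power2_eq_square)
qed

lemma L2_set_inner_vec: "L2_set v {..<d} = sqrt (inner_vec d v v)"
  by (simp add: L2_set_def inner_vec_def power2_eq_square)

lemma inner_vec_parseval: "inner_vec d v w = (\<Sum>j<d. inner_vec d v (id_mat j) * inner_vec d w (id_mat j))"
proof -
  have "inner_vec d v (id_mat j) = v j" if "j < d" for v j
  proof -
    have "inner_vec d v (id_mat j) = (\<Sum>i<d. if j = i then v i else 0)"
      unfolding inner_vec_def id_mat_def by (rule sum.cong) auto
    then show ?thesis using that by simp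
  qed
  then show ?thesis by (simp add: inner_vec_def)
qed

lemma inner_vec_id_mat: "j < d \<Longrightarrow> inner_vec d (id_mat j) (id_mat j) = 1"
  unfolding inner_vec_def id_mat_def by (simp add: if_distrib if_distribR cong: if_cong)

text \<open>A sign vector is encoded by the set \<open>E\<close> of indices that carry the sign
  \<open>+1\<close>. Rademacher averages become finite sums over \<open>Pow I\<close>, and
  probabilities become cardinalities.\<close>

definition sg :: "'a set \<Rightarrow> 'a \<Rightarrow> real" where
  "sg E i = (if i \<in> E then 1 else -1)"

definition flip :: "'a \<Rightarrow> 'a set \<Rightarrow> 'a set" where
  "flip i E = (if i \<in> E then E - {i} else insert i E)"

lemma flip_flip [simp]: "flip i (flip i E) = E"
  by (auto simp: flip_def)

lemma sg_flip: "sg (flip i E) i = - sg E i" "i \<noteq> j \<Longrightarrow> sg (flip i E) j = sg E j"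
  by (auto simp: sg_def flip_def)

lemma sum_Pow_flip:
  assumes "i \<in> I"
  shows "(\<Sum>E\<in>Pow I. F (flip i E)) = (\<Sum>E\<in>Pow I. F E)"
  by (rule sum.reindex_bij_witness[of _ "flip i" "flip i"]) (use assms in \<open>auto simp: flip_def\<close>)

lemma sum_Pow_flip_half:
  fixes F :: "'a set \<Rightarrow> real"
  assumes "i \<in> I"
  shows "(\<Sum>E\<in>Pow I. F E) = (\<Sum>E\<in>Pow I. (F E + F (flip i E)) / 2)"
  using sum_Pow_flip[OF assms, of F] by (simp add: sum.distrib flip: sum_divide_distrib)

text \<open>Discrete integration by parts: pairing \<open>E\<close> with \<open>flip i E\<close>
  cancels whatever in \<open>h\<close> does not depend on the sign of \<open>i\<close>. What remains
  is the discrete derivative of \<open>h\<close> in that coordinate, and by symmetry it is enough to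
  look at sets containing \<open>i\<close>.\<close>

lemma sum_signed_le:
  fixes h g :: "'a set \<Rightarrow> real"
  assumes "finite I" "i \<in> I"
    and "\<And>E. E \<subseteq> I \<Longrightarrow> i \<in> E \<Longrightarrow> h E - h (flip i E) \<le> g E + g (flip i E)"
  shows "(\<Sum>E\<in>Pow I. sg E i * h E) \<le> (\<Sum>E\<in>Pow I. g E)"
proof -
  have "sg E i * h E + sg (flip i E) i * h (flip i E) \<le> g E + g (flip i E)" if "E \<in> Pow I" for E
  proof (cases "i \<in> E")
    case True
    then show ?thesis using assms(3)[of E] that by (simp add: sg_flip) (simp add: sg_def)
  next
    case False
    then have "h (flip i E) - h (flip i (flip i E)) \<le> g (flip i E) + g (flip i (flip i E))"
      using that \<open>i \<in> I\<close> by (intro assms(3)) (auto simp: flip_def)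
    then show ?thesis using False by (simp add: sg_flip) (simp add: sg_def)
  qed
  then show ?thesis
    unfolding sum_Pow_flip_half[OF assms(2), of "\<lambda>E. sg E i * h E"] sum_Pow_flip_half[OF assms(2), of g]
    by (intro sum_mono divide_right_mono) auto
qed

text \<open>With \<open>P = |s\<^sub>+|\<^sup>2\<close>, \<open>M = |s\<^sub>-|\<^sup>2\<close>, \<open>x = \<langle>a, s\<^sub>+\<rangle>\<close>,
  \<open>y = \<langle>a, s\<^sub>-\<rangle>\<close> for \<open>s\<^sub>\<plusminus> = s \<plusminus> a\<close> and \<open>r = |a|\<^sup>2\<close>.\<close>

lemma moment_increment_bound:
  fixes x y P M r :: real
  assumes "0 \<le> P" "0 \<le> M" "x - y = 2 * r" "P - M = 2 * (x + y)" "0 \<le> r"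
  shows "x * P ^ p - y * M ^ p \<le> r * (P ^ p + M ^ p) + 4 * real p * (x\<^sup>2 * P ^ (p - 1) + y\<^sup>2 * M ^ (p - 1))"
proof (cases p)
  case 0
  then show ?thesis using assms by simp
next
  case (Suc q)
  define Z where "Z = (\<Sum>i<p. M ^ (p - Suc i) * P ^ i)"
  have PM: "P ^ p - M ^ p = (P - M) * Z"
    unfolding Z_def by (rule power_diff_sumr2)
  have "2 * (x * P ^ p - y * M ^ p) = (x - y) * (P ^ p + M ^ p) + (x + y) * (P ^ p - M ^ p)"
    by (simp add: algebra_simps)
  also have "\<dots> = 2 * r * (P ^ p + M ^ p) + 2 * (x + y)\<^sup>2 * Z"
    unfolding PM assms(3) assms(4) by (simp add: power2_eq_square algebra_simps)
  finally have eq: "x * P ^ p - y * M ^ p = r * (P ^ p + M ^ p) + (x + y)\<^sup>2 * Z" by simp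
  \<comment> \<open>This identity orders \<open>x\<^sup>2\<close>, \<open>y\<^sup>2\<close> in the
    same way as \<open>P\<close>, \<open>M\<close>, so that the cross term can be charged entirely
    to the endpoint where both are larger.\<close>
  have "x\<^sup>2 - y\<^sup>2 = (x - y) * (x + y)" by (simp add: power2_eq_square algebra_simps)
  then have sq: "x\<^sup>2 - y\<^sup>2 = r * (P - M)" using assms by simp
  have Zle: "Z \<le> real p * m ^ (p - 1)" if "P \<le> m" "M \<le> m" for m
  proof -
    have "Z \<le> (\<Sum>i<p. m ^ (p - 1))"
      unfolding Z_def
    proof (rule sum_mono)
      fix i assume i: "i \<in> {..<p}"
      have "M ^ (p - Suc i) * P ^ i \<le> m ^ (p - Suc i) * m ^ i"
        using assms that by (intro mult_mono power_mono) auto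
      also have "\<dots> = m ^ (p - 1)" using i by (simp flip: power_add)
      finally show "M ^ (p - Suc i) * P ^ i \<le> m ^ (p - 1)" .
    qed
    then show ?thesis by simp
  qed
  have *: "(u + w)\<^sup>2 \<le> 4 * u\<^sup>2" if "w\<^sup>2 \<le> u\<^sup>2" for u w :: real
  proof -
    have "(u + w)\<^sup>2 + (u - w)\<^sup>2 = 2 * u\<^sup>2 + 2 * w\<^sup>2" by (simp add: power2_eq_square algebra_simps)
    then show ?thesis using that zero_le_power2[of "u - w"] by linarith
  qed
  have Z0: "0 \<le> Z" unfolding Z_def using assms by (intro sum_nonneg) auto
  have "(x + y)\<^sup>2 * Z \<le> 4 * real p * (x\<^sup>2 * P ^ (p - 1) + y\<^sup>2 * M ^ (p - 1))"
  proof (cases "M \<le> P")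
    case True
    then have "y\<^sup>2 \<le> x\<^sup>2" using sq assms(5) by (smt (verit) mult_nonneg_nonneg)
    then have "(x + y)\<^sup>2 * Z \<le> 4 * x\<^sup>2 * (real p * P ^ (p - 1))"
      using * Zle[of P] True Z0 by (intro mult_mono) auto
    also have "\<dots> = 4 * real p * (x\<^sup>2 * P ^ (p - 1))" by simp
    also have "\<dots> \<le> 4 * real p * (x\<^sup>2 * P ^ (p - 1) + y\<^sup>2 * M ^ (p - 1))"
      using assms by (intro mult_left_mono) auto
    finally show ?thesis .
  next
    case False
    then have "x\<^sup>2 \<le> y\<^sup>2" using sq assms(5) by (smt (verit) mult_nonneg_nonpos)
    then have "(x + y)\<^sup>2 * Z \<le> 4 * y\<^sup>2 * (real p * M ^ (p - 1))"
      using *[of x y] Zle[of M] False Z0 by (intro mult_mono) (auto simp: add.commute)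
    also have "\<dots> = 4 * real p * (y\<^sup>2 * M ^ (p - 1))" by simp
    also have "\<dots> \<le> 4 * real p * (x\<^sup>2 * P ^ (p - 1) + y\<^sup>2 * M ^ (p - 1))"
      using assms by (intro mult_left_mono) auto
    finally show ?thesis .
  qed
  then show ?thesis using eq by linarith
qed

definition rsum :: "'a set \<Rightarrow> ('a \<Rightarrow> nat \<Rightarrow> real) \<Rightarrow> 'a set \<Rightarrow> nat \<Rightarrow> real" where
  "rsum I a E = (\<lambda>j. \<Sum>i\<in>I. sg E i * a i j)"

lemma rsum_flip:
  assumes "finite I" "i \<in> I" "i \<in> E"
  shows "rsum I a (flip i E) = (\<lambda>j. rsum I a E j - 2 * a i j)"
proof
  fix j
  have "(\<Sum>k\<in>I - {i}. sg (flip i E) k * a k j) = (\<Sum>k\<in>I - {i}. sg E k * a k j)"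
    by (rule sum.cong) (auto simp: sg_flip)
  then show "rsum I a (flip i E) j = rsum I a E j - 2 * a i j"
    unfolding rsum_def using assms by (simp add: sum.remove[of I i] sg_flip) (simp add: sg_def)
qed

text \<open>The recursion in \<open>p\<close> expands one factor of \<open>|s|\<^sup>2 = \<Sum>\<^sub>i \<epsilon>\<^sub>i \<langle>a\<^sub>i, s\<rangle>\<close> and averages over
  the sign \<open>\<epsilon>\<^sub>i\<close> alone; this keeps the weak variance \<open>lam\<close> apart from the trace \<open>T\<close>.\<close>

lemma rademacher_vector_moment:
  fixes a :: "'a \<Rightarrow> nat \<Rightarrow> real"
  assumes fin: "finite I" and lamb: "\<And>v. (\<Sum>i\<in>I. (inner_vec d (a i) v)\<^sup>2) \<le> lam * inner_vec d v v"
    and T: "(\<Sum>i\<in>I. inner_vec d (a i) (a i)) \<le> T" and lam0: "0 \<le> lam"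
  shows "(\<Sum>E\<in>Pow I. (inner_vec d (rsum I a E) (rsum I a E)) ^ p) \<le> 2 ^ card I * (T + 4 * real p * lam) ^ p"
proof (induction p)
  case 0
  then show ?case using fin by (simp add: card_Pow)
next
  case (Suc p)
  let ?S = "rsum I a"
  let ?N = "\<lambda>E. inner_vec d (?S E) (?S E)"
  have T0: "0 \<le> T" using T sum_nonneg[of I "\<lambda>i. inner_vec d (a i) (a i)"] by force
  have "(\<Sum>E\<in>Pow I. ?N E ^ Suc p) = (\<Sum>E\<in>Pow I. \<Sum>i\<in>I. sg E i * (inner_vec d (a i) (?S E) * ?N E ^ p))"
  proof (rule sum.cong[OF refl])
    fix E
    have "?N E = (\<Sum>i\<in>I. sg E i * inner_vec d (a i) (?S E))"
      by (subst (1) rsum_def) (rule inner_vec_lincomb)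
    then show "?N E ^ Suc p = (\<Sum>i\<in>I. sg E i * (inner_vec d (a i) (?S E) * ?N E ^ p))"
      by (simp add: sum_distrib_right mult.assoc)
  qed
  also have "\<dots> = (\<Sum>i\<in>I. \<Sum>E\<in>Pow I. sg E i * (inner_vec d (a i) (?S E) * ?N E ^ p))"
    by (rule sum.swap)
  also have "\<dots> \<le> (\<Sum>i\<in>I. \<Sum>E\<in>Pow I. inner_vec d (a i) (a i) * ?N E ^ p
                    + 4 * real p * ((inner_vec d (a i) (?S E))\<^sup>2 * ?N E ^ (p - 1)))"
  proof (rule sum_mono, rule sum_signed_le[OF fin], assumption)
    fix i E assume i: "i \<in> I" and E: "E \<subseteq> I" "i \<in> E"
    let ?a = "inner_vec d (a i)"
    have S: "?S (flip i E) = (\<lambda>j. ?S E j - 2 * a i j)" using rsum_flip[OF fin i E(2)] .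
    have y: "?a (?S (flip i E)) = ?a (?S E) - 2 * ?a (a i)"
      unfolding S inner_vec_diff_right by (simp add: inner_vec_scale_right)
    have N: "?N (flip i E) = ?N E - 4 * ?a (?S E) + 4 * ?a (a i)"
      unfolding S inner_vec_diff_right inner_vec_diff inner_vec_scale inner_vec_scale_right
        inner_vec_commute[of d "?S E" "a i"] by simp
    show "?a (?S E) * ?N E ^ p - ?a (?S (flip i E)) * ?N (flip i E) ^ p
      \<le> (?a (a i) * ?N E ^ p + 4 * real p * ((?a (?S E))\<^sup>2 * ?N E ^ (p - 1)))
        + (?a (a i) * ?N (flip i E) ^ p + 4 * real p * ((?a (?S (flip i E)))\<^sup>2 * ?N (flip i E) ^ (p - 1)))"
    proof -
      have regroup: "A \<le> (r * u + k * w) + (r * u' + k * w')"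
        if "A \<le> r * (u + u') + k * (w + w')" for A r u u' k w w' :: real
        using that by (simp add: algebra_simps)
      have p1: "?a (?S E) - ?a (?S (flip i E)) = 2 * ?a (a i)" unfolding y by simp
      have p2: "?N E - ?N (flip i E) = 2 * (?a (?S E) + ?a (?S (flip i E)))" unfolding y N by (simp add: algebra_simps)
      show ?thesis
        by (rule regroup, rule moment_increment_bound[OF inner_vec_self_nonneg inner_vec_self_nonneg p1 p2 inner_vec_self_nonneg])
    qed
  qed
  also have "\<dots> = (\<Sum>E\<in>Pow I. (\<Sum>i\<in>I. inner_vec d (a i) (a i)) * ?N E ^ p
                    + 4 * real p * ((\<Sum>i\<in>I. (inner_vec d (a i) (?S E))\<^sup>2) * ?N E ^ (p - 1)))"
    by (subst sum.swap) (simp add: sum.distrib sum_distrib_left sum_distrib_right)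
  also have "\<dots> \<le> (\<Sum>E\<in>Pow I. (T + 4 * real p * lam) * ?N E ^ p)"
  proof (rule sum_mono)
    fix E
    have 1: "(\<Sum>i\<in>I. inner_vec d (a i) (a i)) * ?N E ^ p \<le> T * ?N E ^ p"
      using T by (intro mult_right_mono) auto
    have "4 * real p * ((\<Sum>i\<in>I. (inner_vec d (a i) (?S E))\<^sup>2) * ?N E ^ (p - 1))
       \<le> 4 * real p * ((lam * ?N E) * ?N E ^ (p - 1))"
      using lamb by (intro mult_left_mono mult_right_mono) auto
    also have "\<dots> = 4 * real p * lam * ?N E ^ p" by (cases p) auto
    finally show "(\<Sum>i\<in>I. inner_vec d (a i) (a i)) * ?N E ^ p
        + 4 * real p * ((\<Sum>i\<in>I. (inner_vec d (a i) (?S E))\<^sup>2) * ?N E ^ (p - 1))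
        \<le> (T + 4 * real p * lam) * ?N E ^ p"
      using 1 by (simp add: algebra_simps)
  qed
  also have "\<dots> \<le> (T + 4 * real p * lam) * (2 ^ card I * (T + 4 * real p * lam) ^ p)"
    unfolding sum_distrib_left[symmetric] using Suc T0 lam0 by (intro mult_left_mono) auto
  also have "\<dots> = 2 ^ card I * (T + 4 * real p * lam) ^ Suc p" by simp
  also have "\<dots> \<le> 2 ^ card I * (T + 4 * real (Suc p) * lam) ^ Suc p"
    using T0 lam0 by (intro mult_left_mono power_mono) (auto simp: algebra_simps)
  finally show ?case .
qed

section \<open>Rademacher sums of rank-one operators\<close>

text \<open>Log-convexity makes the ratios \<open>c (Suc j) / c j\<close> nondecreasing. At the
  first index where \<open>c\<close> exceeds the geometric bound the ratio exceeds \<kappa>, hence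
  it does so ever after, and the bound would fail at \<open>r\<close> too.\<close>

lemma log_convex_le:
  fixes c :: "nat \<Rightarrow> real"
  assumes nn: "\<And>j. 0 \<le> c j" and lc: "\<And>j. (c (Suc j))\<^sup>2 \<le> c j * c (Suc (Suc j))"
    and c0: "c 0 \<le> \<rho>" and cr: "c r \<le> \<rho> * \<kappa> ^ r" and \<kappa>: "0 \<le> \<kappa>" and "j \<le> r"
  shows "c j \<le> \<rho> * \<kappa> ^ j"
proof (rule ccontr)
  assume "\<not> ?thesis"
  then have ex: "\<exists>j. j \<le> r \<and> c j > \<rho> * \<kappa> ^ j" using \<open>j \<le> r\<close> by auto
  define m where "m = (LEAST j. j \<le> r \<and> c j > \<rho> * \<kappa> ^ j)"
  have m: "m \<le> r" "c m > \<rho> * \<kappa> ^ m" using LeastI_ex[OF ex] unfolding m_def by auto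
  have least: "c j \<le> \<rho> * \<kappa> ^ j" if "j < m" for j
    using not_less_Least[of j] that m(1) unfolding m_def by fastforce
  have \<rho>: "0 \<le> \<rho>" using nn[of 0] c0 by linarith
  obtain q where q: "m = Suc q" using m(2) c0 by (cases m) auto
  have *: "c (Suc (q + i)) > \<rho> * \<kappa> ^ Suc (q + i) \<and> c (Suc (q + i)) > \<kappa> * c (q + i)" for i
  proof (induction i)
    case 0
    have "\<kappa> * c q \<le> \<kappa> * (\<rho> * \<kappa> ^ q)" using least[of q] q \<kappa> by (intro mult_left_mono) auto
    then show ?case using m(2) q by (simp add: mult_ac)
  next
    case (Suc i)
    let ?a = "c (q + i)" and ?b = "c (Suc (q + i))" and ?e = "c (Suc (Suc (q + i)))"
    have b: "?b > \<rho> * \<kappa> ^ Suc (q + i)" "?b > \<kappa> * ?a" using Suc by auto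
    have bpos: "?b > 0" using b(1) \<rho> \<kappa> by (smt (verit) mult_nonneg_nonneg zero_le_power)
    have apos: "?a > 0" using lc[of "q + i"] bpos nn[of "q + i"]
      by (metis less_eq_real_def mult_zero_left not_le zero_less_power)
    have "?a * (\<kappa> * ?b) < ?b * ?b" using b(2) bpos by (simp add: mult.assoc[symmetric] mult.commute[of ?a])
    also have "\<dots> \<le> ?a * ?e" using lc[of "q + i"] by (simp add: power2_eq_square)
    finally have 1: "\<kappa> * ?b < ?e" using apos by simp
    have "\<rho> * \<kappa> ^ Suc (Suc (q + i)) = \<kappa> * (\<rho> * \<kappa> ^ Suc (q + i))" by (simp add: mult_ac)
    also have "\<dots> \<le> \<kappa> * ?b" using b(1) \<kappa> by (intro mult_left_mono) auto
    finally show ?case using 1 by simp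
  qed
  from *[of "r - m"] m q cr show False by simp
qed

lemma selfadjoint_funpow:
  assumes "\<And>v w. inner_vec d (f v) w = inner_vec d v (f w)"
  shows "inner_vec d ((f ^^ i) v) w = inner_vec d v ((f ^^ i) w)"
proof (induction i arbitrary: w)
  case (Suc i)
  have "inner_vec d ((f ^^ Suc i) v) w = inner_vec d ((f ^^ i) v) (f w)" by (simp add: assms)
  also have "\<dots> = inner_vec d v ((f ^^ i) (f w))" by (rule Suc)
  also have "(f ^^ i) (f w) = (f ^^ Suc i) w" by (simp add: funpow_swap1)
  finally show ?case .
qed simp

text \<open>The squared norms of the iterates \<open>(f ^^ j) a\<close> are log-convex in
  \<open>j\<close>, by Cauchy-Schwarz and self-adjointness, so the bound at \<open>r\<close>
  interpolates down to all smaller exponents.\<close>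

lemma selfadjoint_moment_bound:
  assumes sa: "\<And>v w. inner_vec d (f v) w = inner_vec d v (f w)"
    and \<kappa>: "0 \<le> \<kappa>" and top: "inner_vec d ((f ^^ r) a) ((f ^^ r) a) \<le> inner_vec d a a * \<kappa> ^ r"
    and q: "q \<le> 2 * r"
  shows "(inner_vec d a ((f ^^ q) a))\<^sup>2 \<le> (inner_vec d a a)\<^sup>2 * \<kappa> ^ q"
proof -
  define c where "c j = inner_vec d ((f ^^ j) a) ((f ^^ j) a)" for j
  have sh: "inner_vec d ((f ^^ i) a) ((f ^^ j) a) = inner_vec d a ((f ^^ (i + j)) a)" for i j
    by (simp add: selfadjoint_funpow[of d f, OF sa] funpow_add)
  have lc: "(c (Suc j))\<^sup>2 \<le> c j * c (Suc (Suc j))" for j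
  proof -
    have "c (Suc j) = inner_vec d ((f ^^ j) a) ((f ^^ Suc (Suc j)) a)"
      unfolding c_def sh by simp
    then show ?thesis unfolding c_def using inner_vec_Cauchy_Schwarz by metis
  qed
  have le: "c j \<le> inner_vec d a a * \<kappa> ^ j" if "j \<le> r" for j
    using log_convex_le[of c "inner_vec d a a" r \<kappa> j] lc top \<kappa> that by (simp add: c_def)
  \<comment> \<open>Splitting \<open>q\<close> into two nearly equal halves keeps both exponents at
    most \<open>r\<close>, for odd \<open>q\<close> as well.\<close>
  define i where "i = q div 2"
  define j where "j = q - i"
  have ij: "i + j = q" "i \<le> r" "j \<le> r" using q unfolding i_def j_def by auto
  have "(inner_vec d a ((f ^^ q) a))\<^sup>2 \<le> c i * c j"
    using inner_vec_Cauchy_Schwarz[of d "(f ^^ i) a" "(f ^^ j) a"] unfolding sh c_def ij .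
  also have "\<dots> \<le> (inner_vec d a a * \<kappa> ^ i) * (inner_vec d a a * \<kappa> ^ j)"
    using le ij \<kappa> by (intro mult_mono) (auto simp: c_def)
  also have "\<dots> = (inner_vec d a a)\<^sup>2 * \<kappa> ^ q"
    by (simp add: power2_eq_square ij(1)[symmetric] power_add mult_ac)
  finally show ?thesis .
qed

text \<open>With \<open>H = a a^T\<close> the left side is the trace of
  \<open>H f^q H g^(2r-q)\<close>, and the bound is the rank-one case of the geometric-arithmetic
  mean trace inequality. Interpolating both moments along one common geometric rate makes the
  exponents \<open>q\<close> and \<open>2r-q\<close> add up to \<open>2r\<close>.\<close>

lemma selfadjoint_moment_product:
  fixes f g :: "(nat \<Rightarrow> real) \<Rightarrow> nat \<Rightarrow> real" and a :: "nat \<Rightarrow> real"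
  assumes f: "\<And>v w. inner_vec d (f v) w = inner_vec d v (f w)"
    and g: "\<And>v w. inner_vec d (g v) w = inner_vec d v (g w)" and q: "q \<le> 2 * r"
  defines "F \<equiv> inner_vec d ((f ^^ r) a) ((f ^^ r) a)" and "G \<equiv> inner_vec d ((g ^^ r) a) ((g ^^ r) a)"
  shows "inner_vec d a ((f ^^ q) a) * inner_vec d a ((g ^^ (2 * r - q)) a) \<le> inner_vec d a a * (F + G)"
proof -
  let ?\<rho> = "inner_vec d a a"
  have FG: "0 \<le> F" "0 \<le> G" by (auto simp: F_def G_def)
  consider "?\<rho> = 0" | "r = 0" | "?\<rho> > 0" "r > 0" using inner_vec_self_nonneg[of d a] by linarith
  then show ?thesis
  proof cases
    case 1
    then have "inner_vec d a w = 0" for w using inner_vec_Cauchy_Schwarz[of d a w] by simp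
    then show ?thesis using 1 by simp
  next
    case 2
    then show ?thesis using q by (simp add: F_def G_def)
  next
    case 3
    define \<kappa> where "\<kappa> = root r (max F G / ?\<rho>)"
    have k: "\<kappa> ^ r = max F G / ?\<rho>" unfolding \<kappa>_def using 3 FG by (simp add: real_root_pow_pos2)
    have k0: "0 \<le> \<kappa>" unfolding \<kappa>_def using FG 3 by simp
    have mx: "?\<rho> * \<kappa> ^ r = max F G" using k 3 by simp
    have 1: "(inner_vec d a ((f ^^ q) a))\<^sup>2 \<le> ?\<rho>\<^sup>2 * \<kappa> ^ q"
      by (rule selfadjoint_moment_bound[where r = r]) (use f k0 q mx in \<open>auto simp: F_def[symmetric]\<close>)
    have 2: "(inner_vec d a ((g ^^ (2 * r - q)) a))\<^sup>2 \<le> ?\<rho>\<^sup>2 * \<kappa> ^ (2 * r - q)"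
      by (rule selfadjoint_moment_bound[where r = r]) (use g k0 q mx in \<open>auto simp: G_def[symmetric]\<close>)
    have "(inner_vec d a ((f ^^ q) a) * inner_vec d a ((g ^^ (2 * r - q)) a))\<^sup>2
        \<le> (?\<rho>\<^sup>2 * \<kappa> ^ q) * (?\<rho>\<^sup>2 * \<kappa> ^ (2 * r - q))"
      unfolding power_mult_distrib using 1 2 k0 by (intro mult_mono) auto
    also have "\<dots> = ?\<rho>\<^sup>2 * ?\<rho>\<^sup>2 * \<kappa> ^ (q + (2 * r - q))" unfolding power_add by simp
    also have "q + (2 * r - q) = r + r" using q by simp
    also have "?\<rho>\<^sup>2 * ?\<rho>\<^sup>2 * \<kappa> ^ (r + r) = (?\<rho> * (?\<rho> * \<kappa> ^ r))\<^sup>2"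
      by (simp add: power2_eq_square power_add mult_ac)
    also have "\<dots> = (?\<rho> * max F G)\<^sup>2" by (simp only: mx)
    also have "\<dots> \<le> (?\<rho> * (F + G))\<^sup>2" using FG by (intro power_mono mult_left_mono mult_nonneg_nonneg) auto
    finally show ?thesis by (rule power2_le_imp_le) (use FG in auto)
  qed
qed

text \<open>The expansion of \<open>f^m - g^m\<close> into the terms
  \<open>f^q (f - g) g^(m-1-q)\<close>, where \<open>f - g\<close> is twice the rank-one operator
  \<open>a a^T\<close>; each term therefore splits into a product of two scalars.\<close>

lemma rank_one_telescope:
  assumes f: "\<And>v w. inner_vec d (f v) w = inner_vec d v (f w)"
    and fg: "\<And>b w. inner_vec d b (f w) - inner_vec d b (g w) = 2 * inner_vec d b a * inner_vec d a w"
  shows "inner_vec d b ((f ^^ m) a) - inner_vec d b ((g ^^ m) a)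
    = 2 * (\<Sum>q<m. inner_vec d ((f ^^ q) b) a * inner_vec d a ((g ^^ (m - Suc q)) a))"
proof (induction m arbitrary: b)
  case (Suc m)
  let ?w = "(g ^^ m) a"
  have "inner_vec d b ((f ^^ Suc m) a) - inner_vec d b ((g ^^ Suc m) a)
    = (inner_vec d (f b) ((f ^^ m) a) - inner_vec d (f b) ?w) + (inner_vec d b (f ?w) - inner_vec d b (g ?w))"
    by (simp add: f)
  also have "\<dots> = 2 * (\<Sum>q<m. inner_vec d ((f ^^ Suc q) b) a * inner_vec d a ((g ^^ (m - Suc q)) a))
      + 2 * inner_vec d b a * inner_vec d a ?w"
    unfolding Suc fg by (simp add: funpow_swap1)
  also have "\<dots> = 2 * (\<Sum>q<Suc m. inner_vec d ((f ^^ q) b) a * inner_vec d a ((g ^^ (Suc m - Suc q)) a))"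
    by (subst sum.lessThan_Suc_shift) simp
  finally show ?case .
qed simp

text \<open>The matrix \<open>sum_i eps_i a_i a_i^T\<close> as a map on vectors, so that its powers
  are iterates \<open>^^\<close> and traces are sums over the unit vectors
  \<open>id_mat j\<close>.\<close>

definition rop :: "nat \<Rightarrow> 'a set \<Rightarrow> ('a \<Rightarrow> nat \<Rightarrow> real) \<Rightarrow> 'a set \<Rightarrow> (nat \<Rightarrow> real) \<Rightarrow> nat \<Rightarrow> real" where
  "rop d I a E v = (\<lambda>j. \<Sum>i\<in>I. (sg E i * inner_vec d (a i) v) * a i j)"

lemma inner_rop: "inner_vec d (rop d I a E v) w = (\<Sum>i\<in>I. sg E i * (inner_vec d (a i) v * inner_vec d (a i) w))"
  unfolding rop_def by (subst inner_vec_lincomb) (simp add: mult.assoc)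

lemma rop_selfadjoint: "inner_vec d (rop d I a E v) w = inner_vec d v (rop d I a E w)"
  by (simp add: inner_rop inner_vec_commute[of d v] mult_ac)

lemma rop_flip:
  assumes "finite I" "i \<in> I" "i \<in> E"
  shows "inner_vec d b (rop d I a E w) - inner_vec d b (rop d I a (flip i E) w)
    = 2 * inner_vec d b (a i) * inner_vec d (a i) w"
proof -
  have "(\<Sum>k\<in>I - {i}. sg (flip i E) k * (inner_vec d (a k) w * inner_vec d (a k) b))
     = (\<Sum>k\<in>I - {i}. sg E k * (inner_vec d (a k) w * inner_vec d (a k) b))"
    by (rule sum.cong) (auto simp: sg_flip)
  then show ?thesis
    unfolding inner_vec_commute[of d b] inner_rop using assms
    by (simp add: sum.remove[of I i] sg_flip) (simp add: sg_def mult_ac inner_vec_commute)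
qed

text \<open>Rank-one case of the noncommutative Khinchine inequality.  The sum over \<open>j\<close> is the trace of
  the \<open>2p\<close>-th power of the random operator; as for vectors, one factor is expanded and only its own
  sign is averaged.\<close>

lemma rademacher_operator_moment:
  fixes a :: "'a \<Rightarrow> nat \<Rightarrow> real"
  assumes fin: "finite I" and lamb: "\<And>v. (\<Sum>i\<in>I. (inner_vec d (a i) v)\<^sup>2) \<le> lam * inner_vec d v v"
    and R: "\<And>i. i \<in> I \<Longrightarrow> inner_vec d (a i) (a i) \<le> R" and lam0: "0 \<le> lam" and R0: "0 \<le> R"
  shows "(\<Sum>E\<in>Pow I. \<Sum>j<d. inner_vec d ((rop d I a E ^^ p) (id_mat j)) ((rop d I a E ^^ p) (id_mat j)))
     \<le> 2 ^ card I * real d * (4 * real p * R * lam) ^ p"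
proof (induction p)
  case 0
  then show ?case using fin by (simp add: card_Pow inner_vec_id_mat)
next
  case (Suc p)
  let ?T = "rop d I a"
  let ?tr = "\<lambda>E q. \<Sum>j<d. inner_vec d ((?T E ^^ q) (id_mat j)) ((?T E ^^ q) (id_mat j))"
  have shift: "inner_vec d ((?T E ^^ i) v) ((?T E ^^ j) w) = inner_vec d v ((?T E ^^ (i + j)) w)" for E i j v w
    by (simp add: selfadjoint_funpow[of d "?T E", OF rop_selfadjoint] funpow_add)
  \<comment> \<open>One factor of the trace of the power \<open>2p + 2\<close> is expanded: the
    trace is the sum of \<open>eps_i <a_i, T^(2p+1) a_i>\<close>, in the form that
    \<open>sum_signed_le\<close> takes.\<close>
  have A: "?tr E (Suc p) = (\<Sum>i\<in>I. sg E i * inner_vec d (a i) ((?T E ^^ (2 * p + 1)) (a i)))" for E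
  proof -
    have "inner_vec d ((?T E ^^ Suc p) (id_mat j)) ((?T E ^^ Suc p) (id_mat j))
      = (\<Sum>i\<in>I. sg E i * (inner_vec d ((?T E ^^ (2 * p + 1)) (a i)) (id_mat j) * inner_vec d (a i) (id_mat j)))" for j
    proof -
      have "inner_vec d ((?T E ^^ Suc p) (id_mat j)) ((?T E ^^ Suc p) (id_mat j))
         = inner_vec d (?T E ((?T E ^^ (2 * p + 1)) (id_mat j))) (id_mat j)"
        by (subst shift) (simp add: inner_vec_commute mult_2)
      also have "\<dots> = (\<Sum>i\<in>I. sg E i * (inner_vec d (a i) ((?T E ^^ (2 * p + 1)) (id_mat j)) * inner_vec d (a i) (id_mat j)))"
        by (rule inner_rop)
      finally show ?thesis by (simp only: selfadjoint_funpow[of d "?T E", OF rop_selfadjoint])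
    qed
    then have "?tr E (Suc p) = (\<Sum>j<d. \<Sum>i\<in>I. sg E i * (inner_vec d ((?T E ^^ (2 * p + 1)) (a i)) (id_mat j) * inner_vec d (a i) (id_mat j)))"
      by (intro sum.cong) auto
    also have "\<dots> = (\<Sum>i\<in>I. sg E i * (\<Sum>j<d. inner_vec d ((?T E ^^ (2 * p + 1)) (a i)) (id_mat j) * inner_vec d (a i) (id_mat j)))"
      by (subst sum.swap) (simp only: sum_distrib_left)
    finally show ?thesis by (simp only: inner_vec_parseval[symmetric] inner_vec_commute[of d _ "a _"])
  qed
  define h where "h i E = inner_vec d ((?T E ^^ p) (a i)) ((?T E ^^ p) (a i))" for i E
  have "(\<Sum>E\<in>Pow I. ?tr E (Suc p)) = (\<Sum>i\<in>I. \<Sum>E\<in>Pow I. sg E i * inner_vec d (a i) ((?T E ^^ (2 * p + 1)) (a i)))"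
    unfolding A by (rule sum.swap)
  also have "\<dots> \<le> (\<Sum>i\<in>I. \<Sum>E\<in>Pow I. 2 * real (2 * p + 1) * (R * h i E))"
  proof (rule sum_mono, rule sum_signed_le[OF fin], assumption)
    fix i E assume i: "i \<in> I" and E: "E \<subseteq> I" "i \<in> E"
    let ?F = "?T E" and ?G = "?T (flip i E)"
    have "inner_vec d (a i) ((?F ^^ (2 * p + 1)) (a i)) - inner_vec d (a i) ((?G ^^ (2 * p + 1)) (a i))
      = 2 * (\<Sum>q<2 * p + 1. inner_vec d ((?F ^^ q) (a i)) (a i) * inner_vec d (a i) ((?G ^^ (2 * p + 1 - Suc q)) (a i)))"
      by (rule rank_one_telescope[OF rop_selfadjoint]) (rule rop_flip[OF fin i E(2)])
    also have "\<dots> \<le> 2 * (\<Sum>q<2 * p + 1. R * (h i E + h i (flip i E)))"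
    proof (intro mult_left_mono sum_mono)
      fix q assume "q \<in> {..<2 * p + 1}"
      then have "inner_vec d (a i) ((?F ^^ q) (a i)) * inner_vec d (a i) ((?G ^^ (2 * p - q)) (a i))
         \<le> inner_vec d (a i) (a i) * (h i E + h i (flip i E))"
        unfolding h_def by (intro selfadjoint_moment_product rop_selfadjoint) auto
      also have "\<dots> \<le> R * (h i E + h i (flip i E))"
        using R[OF i] by (intro mult_right_mono) (auto simp: h_def)
      finally show "inner_vec d ((?F ^^ q) (a i)) (a i) * inner_vec d (a i) ((?G ^^ (2 * p + 1 - Suc q)) (a i))
        \<le> R * (h i E + h i (flip i E))"
        by (simp add: inner_vec_commute)
    qed auto
    finally show "inner_vec d (a i) ((?F ^^ (2 * p + 1)) (a i)) - inner_vec d (a i) ((?G ^^ (2 * p + 1)) (a i))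
       \<le> 2 * real (2 * p + 1) * (R * h i E) + 2 * real (2 * p + 1) * (R * h i (flip i E))"
      by (simp add: algebra_simps)
  qed
  also have "\<dots> = (\<Sum>E\<in>Pow I. 2 * real (2 * p + 1) * R * (\<Sum>i\<in>I. h i E))"
    by (subst sum.swap) (simp add: sum_distrib_left mult.assoc)
  also have "\<dots> \<le> (\<Sum>E\<in>Pow I. 2 * real (2 * p + 1) * R * (lam * ?tr E p))"
  proof (rule sum_mono)
    fix E
    \<comment> \<open>Parseval trades the vectors \<open>a i\<close> for the basis: the sum of the
      \<open>|T^p a_i|^2\<close> becomes a sum over \<open>j\<close> of the forms
      \<open>sum_i <a_i, w>^2\<close> at \<open>w = T^p e_j\<close>, where \<open>lamb\<close>
      applies.\<close>
    have "(\<Sum>i\<in>I. h i E) = (\<Sum>i\<in>I. \<Sum>j<d. (inner_vec d (a i) ((?T E ^^ p) (id_mat j)))\<^sup>2)"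
      unfolding h_def by (subst inner_vec_parseval)
        (simp add: power2_eq_square selfadjoint_funpow[of d "?T E", OF rop_selfadjoint])
    also have "\<dots> = (\<Sum>j<d. \<Sum>i\<in>I. (inner_vec d (a i) ((?T E ^^ p) (id_mat j)))\<^sup>2)" by (rule sum.swap)
    also have "\<dots> \<le> (\<Sum>j<d. lam * inner_vec d ((?T E ^^ p) (id_mat j)) ((?T E ^^ p) (id_mat j)))"
      by (intro sum_mono lamb)
    finally show "2 * real (2 * p + 1) * R * (\<Sum>i\<in>I. h i E) \<le> 2 * real (2 * p + 1) * R * (lam * ?tr E p)"
      using R0 by (intro mult_left_mono) (auto simp: sum_distrib_left)
  qed
  also have "\<dots> = 2 * real (2 * p + 1) * R * lam * (\<Sum>E\<in>Pow I. ?tr E p)"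
    by (simp add: sum_distrib_left mult_ac)
  also have "\<dots> \<le> (4 * real (Suc p) * R * lam) * (2 ^ card I * real d * (4 * real (Suc p) * R * lam) ^ p)"
  proof (rule mult_mono)
    show "2 * real (2 * p + 1) * R * lam \<le> 4 * real (Suc p) * R * lam"
      using R0 lam0 by (intro mult_right_mono) auto
    have "(4 * real p * R * lam) ^ p \<le> (4 * real (Suc p) * R * lam) ^ p"
      using R0 lam0 by (intro power_mono mult_right_mono) auto
    then have "2 ^ card I * real d * (4 * real p * R * lam) ^ p \<le> 2 ^ card I * real d * (4 * real (Suc p) * R * lam) ^ p"
      by (intro mult_left_mono) auto
    then show "(\<Sum>E\<in>Pow I. ?tr E p) \<le> 2 ^ card I * real d * (4 * real (Suc p) * R * lam) ^ p"
      using Suc by linarith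
  qed (use R0 lam0 in \<open>auto intro!: sum_nonneg\<close>)
  finally show ?case by (simp add: mult_ac)
qed

text \<open>The norm of \<open>T^p v\<close> is at most \<open>|v|\<close> times the Hilbert-Schmidt
  norm of \<open>T^p\<close>; \<open>selfadjoint_moment_bound\<close> then descends to the first
  power of \<open>T\<close>, uniformly in \<open>v\<close>.\<close>

lemma rop_form_le_trace:
  assumes tr: "(\<Sum>j<d. inner_vec d ((rop d I a E ^^ p) (id_mat j)) ((rop d I a E ^^ p) (id_mat j))) \<le> \<kappa> ^ p"
    and \<kappa>: "0 \<le> \<kappa>" and p: "p \<ge> 1"
  shows "(\<Sum>i\<in>I. sg E i * (inner_vec d (a i) v)\<^sup>2)\<^sup>2 \<le> (inner_vec d v v)\<^sup>2 * \<kappa>"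
proof -
  let ?f = "rop d I a E"
  have "inner_vec d ((?f ^^ p) v) ((?f ^^ p) v) = (\<Sum>j<d. (inner_vec d v ((?f ^^ p) (id_mat j)))\<^sup>2)"
    by (subst inner_vec_parseval) (simp add: power2_eq_square selfadjoint_funpow[of d ?f, OF rop_selfadjoint])
  also have "\<dots> \<le> (\<Sum>j<d. inner_vec d v v * inner_vec d ((?f ^^ p) (id_mat j)) ((?f ^^ p) (id_mat j)))"
    by (intro sum_mono inner_vec_Cauchy_Schwarz)
  also have "\<dots> \<le> inner_vec d v v * \<kappa> ^ p"
    unfolding sum_distrib_left[symmetric] using tr by (intro mult_left_mono) auto
  finally have "(inner_vec d v ((?f ^^ 1) v))\<^sup>2 \<le> (inner_vec d v v)\<^sup>2 * \<kappa> ^ 1"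
    by (intro selfadjoint_moment_bound[where r = p]) (use \<kappa> p rop_selfadjoint in auto)
  then show ?thesis
    by (simp add: rop_selfadjoint[symmetric] inner_rop power2_eq_square)
qed


section \<open>Tail bounds for Rademacher sums, as counts of sign patterns\<close>

lemma card_markov:
  fixes h :: "'b \<Rightarrow> real"
  assumes "finite A" "\<And>E. E \<in> A \<Longrightarrow> 0 \<le> h E" "(\<Sum>E\<in>A. h E) \<le> B"
  shows "s * real (card {E \<in> A. h E > s}) \<le> B"
proof -
  have "s * real (card {E \<in> A. h E > s}) = (\<Sum>E\<in>{E \<in> A. h E > s}. s)" by simp
  also have "\<dots> \<le> (\<Sum>E\<in>{E \<in> A. h E > s}. h E)" by (intro sum_mono) auto
  also have "\<dots> \<le> (\<Sum>E\<in>A. h E)" by (intro sum_mono2) (use assms in auto)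
  finally show ?thesis using assms by linarith
qed

text \<open>The constant 8 only has to exceed \<open>e\<^sup>2\<close>.\<close>

lemma rademacher_vector_tail:
  fixes a :: "'a \<Rightarrow> nat \<Rightarrow> real"
  assumes fin: "finite I" and lamb: "\<And>v. (\<Sum>i\<in>I. (inner_vec d (a i) v)\<^sup>2) \<le> lam * inner_vec d v v"
    and T: "(\<Sum>i\<in>I. inner_vec d (a i) (a i)) \<le> T" and lam0: "0 \<le> lam"
  shows "real (card {E \<in> Pow I. inner_vec d (rsum I a E) (rsum I a E) > 8 * (T + 4 * real p * lam)})
     \<le> 2 ^ card I * exp (- 2 * real p)"
proof -
  let ?N = "\<lambda>E. inner_vec d (rsum I a E) (rsum I a E)"
  define B where "B = T + 4 * real p * lam"
  have T0: "0 \<le> T" using T sum_nonneg[of I "\<lambda>i. inner_vec d (a i) (a i)"] by force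
  have B0: "0 \<le> B" using T0 lam0 by (simp add: B_def)
  let ?C = "{E \<in> Pow I. ?N E > 8 * B}"
  have sub: "?C \<subseteq> {E \<in> Pow I. ?N E ^ p > (8 * B) ^ p}" if "p > 0"
  proof -
    have "(8 * B) ^ p < x ^ p" if "8 * B < x" for x
      using B0 that \<open>p > 0\<close> by (intro power_strict_mono) auto
    then show ?thesis by blast
  qed
  have e2: "exp (2 * real p) \<le> 8 ^ p"
  proof -
    have "exp (2::real) = exp 1 ^ 2" by (simp flip: exp_of_nat_mult)
    also have "\<dots> \<le> (272/100) ^ 2" using e_less_272 by (intro power_mono) auto
    finally have "exp (2::real) \<le> 8" by (simp add: power2_eq_square)
    then have "exp 2 ^ p \<le> (8::real) ^ p" by (intro power_mono) auto
    then show ?thesis by (simp flip: exp_of_nat_mult add: mult.commute)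
  qed
  consider "p = 0" | "p > 0" "B = 0" | "p > 0" "B > 0" using B0 by fastforce
  then have "real (card ?C) \<le> 2 ^ card I * exp (- 2 * real p)"
  proof cases
    case 1
    have "card ?C \<le> card (Pow I)" by (rule card_mono) (use fin in auto)
    also have "\<dots> = 2 ^ card I" using fin by (rule card_Pow)
    finally have "real (card ?C) \<le> real (2 ^ card I)" by (simp only: of_nat_le_iff)
    then show ?thesis using 1 by simp
  next
    case 2
    \<comment> \<open>For \<open>B = 0\<close> Markov's inequality has no positive threshold; the
      vanishing moment forces every sum to be zero.\<close>
    have "(\<Sum>E\<in>Pow I. ?N E ^ p) \<le> 0"
      using rademacher_vector_moment[OF fin lamb T lam0, of p] 2 by (simp add: B_def zero_power)
    then have "\<forall>E\<in>Pow I. ?N E ^ p = 0"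
      using sum_nonneg_eq_0_iff[of "Pow I" "\<lambda>E. ?N E ^ p"] fin
      by (metis (no_types, lifting) finite_Pow_iff inner_vec_self_nonneg nle_le sum_nonneg zero_le_power)
    then have e: "?C = {}" using 2 by auto
    show ?thesis unfolding e by simp
  next
    case 3
    have "(8 * B) ^ p * real (card {E \<in> Pow I. ?N E ^ p > (8 * B) ^ p}) \<le> 2 ^ card I * B ^ p"
      unfolding B_def by (rule card_markov) (use fin rademacher_vector_moment[OF fin lamb T lam0, of p] in auto)
    moreover have "card ?C \<le> card {E \<in> Pow I. ?N E ^ p > (8 * B) ^ p}"
      using sub 3 fin by (intro card_mono) auto
    ultimately have "(8 * B) ^ p * real (card ?C) \<le> 2 ^ card I * B ^ p"
      using 3 by (smt (verit) mult_left_mono of_nat_le_iff zero_le_power)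
    then have "B ^ p * (8 ^ p * real (card ?C)) \<le> B ^ p * 2 ^ card I"
      by (simp add: power_mult_distrib mult_ac)
    then have "8 ^ p * real (card ?C) \<le> 2 ^ card I" using 3 by simp
    then have "exp (2 * real p) * real (card ?C) \<le> 2 ^ card I"
      using e2 by (smt (verit) mult_right_mono of_nat_0_le_iff)
    then show ?thesis by (simp add: exp_minus field_simps)
  qed
  then show ?thesis by (simp add: B_def)
qed

text \<open>The one-dimensional case of the vector bound: trace and weak variance are both
  \<open>V\<close>, and \<open>8 (1 + 4p) \<le> 40 p\<close> because
  \<open>p \<ge> 1\<close>.\<close>

lemma rademacher_scalar_tail:
  fixes a :: "'a \<Rightarrow> real"
  assumes fin: "finite I" and V: "(\<Sum>i\<in>I. (a i)\<^sup>2) \<le> V" and p: "p \<ge> 1"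
  shows "real (card {E \<in> Pow I. (\<Sum>i\<in>I. sg E i * a i)\<^sup>2 > 40 * real p * V}) \<le> 2 ^ card I * exp (- 2 * real p)"
proof -
  have V0: "0 \<le> V" using V sum_nonneg[of I "\<lambda>i. (a i)\<^sup>2"] by force
  have "real (card {E \<in> Pow I. inner_vec 1 (rsum I (\<lambda>i j. a i) E) (rsum I (\<lambda>i j. a i) E) > 8 * (V + 4 * real p * V)})
     \<le> 2 ^ card I * exp (- 2 * real p)"
  proof (rule rademacher_vector_tail[OF fin])
    show "(\<Sum>i\<in>I. (inner_vec 1 (\<lambda>j. a i) v)\<^sup>2) \<le> V * inner_vec 1 v v" for v
    proof -
      have "(\<Sum>i\<in>I. (inner_vec 1 (\<lambda>j. a i) v)\<^sup>2) = (\<Sum>i\<in>I. (a i)\<^sup>2) * (v 0)\<^sup>2"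
        by (simp add: inner_vec_def power_mult_distrib sum_distrib_right)
      also have "\<dots> \<le> V * (v 0)\<^sup>2" using V by (intro mult_right_mono) auto
      finally show ?thesis by (simp add: inner_vec_def power2_eq_square[of "v 0"])
    qed
  qed (use V V0 in \<open>auto simp: inner_vec_def power2_eq_square\<close>)
  moreover have sub: "{E \<in> Pow I. (\<Sum>i\<in>I. sg E i * a i)\<^sup>2 > 40 * real p * V}
     \<subseteq> {E \<in> Pow I. inner_vec 1 (rsum I (\<lambda>i j. a i) E) (rsum I (\<lambda>i j. a i) E) > 8 * (V + 4 * real p * V)}"
  proof -
    have "V \<le> real p * V" using mult_right_mono[of 1 "real p" V] p V0 by simp
    then have le: "8 * (V + 4 * real p * V) \<le> 40 * real p * V" by (simp add: algebra_simps)
    have eq: "inner_vec 1 (rsum I (\<lambda>i j. a i) E) (rsum I (\<lambda>i j. a i) E) = (\<Sum>i\<in>I. sg E i * a i)\<^sup>2" for E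
      by (simp add: inner_vec_def rsum_def power2_eq_square)
    show ?thesis unfolding eq using le_less_trans[OF le] by blast
  qed
  then have "card {E \<in> Pow I. (\<Sum>i\<in>I. sg E i * a i)\<^sup>2 > 40 * real p * V}
     \<le> card {E \<in> Pow I. inner_vec 1 (rsum I (\<lambda>i j. a i) E) (rsum I (\<lambda>i j. a i) E) > 8 * (V + 4 * real p * V)}"
    by (rule card_mono[rotated]) (use fin in simp)
  ultimately show ?thesis by (meson of_nat_mono order_trans)
qed

text \<open>With \<open>p\<close> at least \<open>ln d\<close> the factor \<open>d\<close> of the
  trace moment is at most \<open>3^p\<close>. It is absorbed, together with the 16 of the
  conclusion, by the base 50, which exceeds 3 * 16; and 200 = 4 * 50.\<close>

lemma rademacher_operator_tail:
  fixes a :: "'a \<Rightarrow> nat \<Rightarrow> real"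
  assumes fin: "finite I" and lamb: "\<And>v. (\<Sum>i\<in>I. (inner_vec d (a i) v)\<^sup>2) \<le> lam * inner_vec d v v"
    and R: "\<And>i. i \<in> I \<Longrightarrow> inner_vec d (a i) (a i) \<le> R" and lam0: "0 \<le> lam" and R0: "0 \<le> R"
    and p: "p \<ge> 1" "ln (real d) \<le> real p" and d: "d \<ge> 1"
  shows "real (card {E \<in> Pow I. \<exists>v. (\<Sum>i\<in>I. sg E i * (inner_vec d (a i) v)\<^sup>2)\<^sup>2
            > (inner_vec d v v)\<^sup>2 * (200 * real p * R * lam)}) \<le> 2 ^ card I / 16"
proof -
  let ?tr = "\<lambda>E. \<Sum>j<d. inner_vec d ((rop d I a E ^^ p) (id_mat j)) ((rop d I a E ^^ p) (id_mat j))"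
  define B where "B = 4 * real p * R * lam"
  have B0: "0 \<le> B" using R0 lam0 by (simp add: B_def)
  let ?C = "{E \<in> Pow I. ?tr E > (50 * B) ^ p}"
  let ?D = "{E \<in> Pow I. \<exists>v. (\<Sum>i\<in>I. sg E i * (inner_vec d (a i) v)\<^sup>2)\<^sup>2
            > (inner_vec d v v)\<^sup>2 * (200 * real p * R * lam)}"
  have "?D \<subseteq> ?C"
  proof (rule subsetI, rule ccontr)
    fix E assume E: "E \<in> ?D" "E \<notin> ?C"
    then have "?tr E \<le> (50 * B) ^ p" by auto
    then have le: "(\<Sum>i\<in>I. sg E i * (inner_vec d (a i) v)\<^sup>2)\<^sup>2 \<le> (inner_vec d v v)\<^sup>2 * (50 * B)" for v
      using B0 p by (intro rop_form_le_trace) auto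
    moreover obtain v where "(\<Sum>i\<in>I. sg E i * (inner_vec d (a i) v)\<^sup>2)\<^sup>2
        > (inner_vec d v v)\<^sup>2 * (200 * real p * R * lam)" using E by auto
    moreover have "200 * real p * R * lam = 50 * B" by (simp add: B_def)
    ultimately show False using le[of v] by simp
  qed
  then have DC: "card ?D \<le> card ?C" using fin by (intro card_mono) auto
  have mom: "(\<Sum>E\<in>Pow I. ?tr E) \<le> 2 ^ card I * real d * B ^ p"
    unfolding B_def by (rule rademacher_operator_moment) (use assms in auto)
  have dp: "real d * 16 \<le> 50 ^ p"
  proof -
    have "real d = exp (ln (real d))" using d by simp
    also have "\<dots> \<le> exp (real p)" using p by simp
    also have "\<dots> = exp 1 ^ p" by (simp flip: exp_of_nat_mult)
    also have "\<dots> \<le> 3 ^ p" using e_less_272 by (intro power_mono) auto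
    finally have 1: "real d \<le> 3 ^ p" .
    have "(16::real) ^ 1 \<le> 16 ^ p" using p by (intro power_increasing) auto
    then have "real d * 16 \<le> 3 ^ p * 16 ^ p" using 1 by (intro mult_mono) auto
    also have "\<dots> = (48::real) ^ p" by (simp flip: power_mult_distrib)
    also have "\<dots> \<le> 50 ^ p" by (intro power_mono) auto
    finally show ?thesis .
  qed
  have "real (card ?C) \<le> 2 ^ card I / 16"
  proof (cases "B = 0")
    case True
    have nn: "0 \<le> ?tr E" for E by (intro sum_nonneg) auto
    have "(\<Sum>E\<in>Pow I. ?tr E) \<le> 0" using mom True p by (simp add: zero_power)
    then have "(\<Sum>E\<in>Pow I. ?tr E) = 0" using sum_nonneg[of "Pow I" ?tr] nn by force
    then have "\<forall>E\<in>Pow I. ?tr E = 0"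
      using sum_nonneg_eq_0_iff[of "Pow I" ?tr] nn fin by simp
    then have e: "?C = {}" using True p by auto
    show ?thesis unfolding e by simp
  next
    case False
    then have Bp: "B ^ p > 0" using B0 by simp
    have "(50 * B) ^ p * real (card ?C) \<le> 2 ^ card I * real d * B ^ p"
      by (rule card_markov) (use fin mom in \<open>auto intro!: sum_nonneg\<close>)
    then have "B ^ p * (50 ^ p * real (card ?C)) \<le> B ^ p * (2 ^ card I * real d)"
      by (simp add: power_mult_distrib mult_ac)
    then have 1: "50 ^ p * real (card ?C) \<le> 2 ^ card I * real d" using Bp by simp
    have "(real d * 16) * real (card ?C) \<le> 50 ^ p * real (card ?C)"
      using dp by (intro mult_right_mono) auto
    then have "real d * (16 * real (card ?C)) \<le> real d * 2 ^ card I" using 1 by (simp add: mult_ac)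
    then show ?thesis using d by simp
  qed
  then show ?thesis using DC by (smt (verit) of_nat_mono)
qed

section \<open>Talagrand's two-point inequality\<close>

definition uncovered :: "'a set \<Rightarrow> 'a set \<Rightarrow> 'a set \<Rightarrow> 'a set \<Rightarrow> 'a set" where
  "uncovered U x y z = {i \<in> U. (i \<in> x) \<noteq> (i \<in> y) \<and> (i \<in> x) \<noteq> (i \<in> z)}"

text \<open>The one-coordinate inequality behind Talagrand's induction. There \<open>g\<close> and
  \<open>h\<close> are the shares of a projection that are filled by a section, and
  \<open>1 / g\<close> is the price for drawing a point from the section instead of the
  projection.\<close>

lemma two_point_weight:
  fixes g h :: real
  assumes "g \<ge> h" "1/2 \<le> g" "g \<le> 1"
  shows "1 / g \<le> 3 - g - h"
proof -
  have "0 \<le> (2 * g - 1) * (1 - g)" using assms by simp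
  then have "1 \<le> g * (3 - 2 * g)" by (simp add: algebra_simps)
  also have "\<dots> \<le> g * (3 - g - h)" using assms by (intro mult_left_mono) auto
  finally show ?thesis using assms by (simp add: field_simps)
qed

text \<open>Arithmetic-geometric mean for \<open>s\<close>, \<open>t\<close>,
  \<open>6 - s - t\<close>, whose sum is 6; the value \<open>8 = 2^3\<close> becomes the factor per
  coordinate in \<open>talagrand_two_points\<close>.\<close>

lemma amgm_eight:
  fixes s t :: real
  assumes "0 \<le> s" "0 \<le> t" "s + t \<le> 6"
  shows "s * t * (6 - s - t) \<le> 8"
proof -
  define p where "p = (s + t) / 2"
  have "s * t \<le> p\<^sup>2"
    using zero_le_power2[of "s - t"] by (simp add: p_def power2_eq_square field_simps)
  then have "s * t * (6 - 2 * p) \<le> p\<^sup>2 * (6 - 2 * p)"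
    using assms by (intro mult_right_mono) (auto simp: p_def)
  also have "\<dots> = 8 - 2 * ((p - 2)\<^sup>2 * (p + 1))" by (simp add: power2_eq_square algebra_simps)
  also have "\<dots> \<le> 8" using assms by (simp add: p_def)
  finally have "s * t * (6 - 2 * p) \<le> 8" .
  moreover have "6 - 2 * p = 6 - s - t" by (simp add: p_def field_simps)
  ultimately show ?thesis by simp
qed

text \<open>Talagrand's inequality for control by two points, on the discrete cube.  Keeping two different
  sets \<open>A\<close>, \<open>B\<close> makes the induction on \<open>U\<close> work.\<close>

lemma talagrand_two_points:
  assumes "finite U" "A \<subseteq> Pow U" "B \<subseteq> Pow U" "A \<noteq> {}" "B \<noteq> {}"
  shows "\<exists>f. (\<forall>x\<in>Pow U. \<exists>y\<in>A. \<exists>z\<in>B. card (uncovered U x y z) \<le> f x) \<and>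
     real (card A) * real (card B) * (\<Sum>x\<in>Pow U. 2 ^ f x) \<le> 8 ^ card U"
  using assms
proof (induction U arbitrary: A B rule: finite_induct)
  case empty
  then have "A = {{}}" "B = {{}}" by auto
  then show ?case by (intro exI[of _ "\<lambda>_. 0"]) (auto simp: uncovered_def)
next
  case (insert u U)
  \<comment> \<open>\<open>sec w C\<close> is the section of \<open>C\<close> at which membership of
    \<open>u\<close> has the value \<open>w\<close>, and \<open>pr C\<close> is the projection that
    forgets \<open>u\<close>. The induction hypothesis is applied to pairs of such sets.\<close>
  define sec where "sec w C = {y \<in> Pow U. (if w then insert u y else y) \<in> C}" for w and C :: "'a set set"
  define pr where "pr C = sec False C \<union> sec True C" for C
  have secsub: "sec w C \<subseteq> Pow U" "sec w C \<subseteq> pr C" for w C by (cases w) (auto simp: sec_def pr_def)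
  have prsub: "pr C \<subseteq> Pow U" for C using secsub by (auto simp: pr_def)
  have fin: "finite (sec w C)" "finite (pr C)" for w C
    using insert.hyps secsub prsub by (meson finite_Pow_iff finite_subset)+
  have cardC: "card C = card (sec False C) + card (sec True C)" if C: "C \<subseteq> Pow (insert u U)" for C
  proof -
    have C': "C = sec False C \<union> insert u ` sec True C"
    proof (intro equalityI subsetI)
      fix y assume y: "y \<in> C"
      show "y \<in> sec False C \<union> insert u ` sec True C"
      proof (cases "u \<in> y")
        case True
        then have "insert u (y - {u}) = y" by auto
        moreover have "y - {u} \<in> sec True C" using C y True \<open>insert u (y - {u}) = y\<close> by (auto simp: sec_def)
        ultimately show ?thesis by (metis UnI2 imageI)
      next
        case False
        then show ?thesis using C y by (auto simp: sec_def)
      qed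
    qed (auto simp: sec_def)
    have "inj_on (insert u) (sec True C)"
      by (rule inj_onI) (use insert.hyps in \<open>auto simp: sec_def\<close>)
    moreover have "sec False C \<inter> insert u ` sec True C = {}" using insert.hyps by (auto simp: sec_def)
    ultimately show ?thesis using fin
      by (subst C') (simp add: card_Un_disjoint card_image)
  qed
  have prne: "pr C \<noteq> {}" if "C \<subseteq> Pow (insert u U)" "C \<noteq> {}" for C
    using cardC[OF that(1)] that insert.hyps
    by (metis Un_empty add_0 card.empty card_0_eq finite_Pow_iff finite_insert finite_subset pr_def)
  let ?a = "real (card (pr A))" and ?b = "real (card (pr B))"
  have ab: "?a > 0" "?b > 0" using prne insert.prems fin by (simp_all add: card_gt_0_iff)
  let ?g = "\<lambda>w. real (card (sec w A)) / ?a" and ?h = "\<lambda>w. real (card (sec w B)) / ?b"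
  have gh1: "?g w \<le> 1" "?h w \<le> 1" for w
    using ab card_mono[OF fin(2) secsub(2)] by (auto simp: divide_le_eq)
  have step: "\<exists>f. (\<forall>x\<in>Pow U. \<exists>y\<in>A. \<exists>z\<in>B. card (uncovered (insert u U) (if w then insert u x else x) y z) \<le> f x) \<and>
      (\<Sum>x\<in>Pow U. 2 ^ f x) \<le> 8 ^ card U / (?a * ?b) * (3 - ?g w - ?h w)" for w
  proof -
    let ?x = "\<lambda>x. if w then insert u x else x"
    have lift: "\<exists>w'. (if w' then insert u y else y) \<in> C" if "y \<in> pr C" for y C
      using that by (auto simp: pr_def sec_def split: if_splits)
    have unc: "uncovered (insert u U) (?x x) (if w1 then insert u y else y) (if w2 then insert u z else z)
        \<subseteq> (if w1 = w \<or> w2 = w then uncovered U x y z else insert u (uncovered U x y z))"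
      if "x \<in> Pow U" "y \<in> Pow U" "z \<in> Pow U" for x y z w1 w2
      using that insert.hyps by (auto simp: uncovered_def)
    have fu: "finite (uncovered U x y z)" for x y z using insert.hyps by (simp add: uncovered_def)
    have good: "\<exists>y\<in>A. \<exists>z\<in>B. card (uncovered (insert u U) (?x x) y z) \<le> (if e then k else Suc k)"
      if x: "x \<in> Pow U" and y: "y \<in> pr A" and z: "z \<in> pr B" and k: "card (uncovered U x y z) \<le> k"
        and e: "e \<Longrightarrow> y \<in> sec w A \<or> z \<in> sec w B" for x y z k e
    proof -
      obtain w1 where w1: "(if w1 then insert u y else y) \<in> A" "e \<Longrightarrow> y \<in> sec w A \<Longrightarrow> w1 = w"
        using lift[OF y] by (auto simp: sec_def)
      obtain w2 where w2: "(if w2 then insert u z else z) \<in> B" "e \<Longrightarrow> z \<in> sec w B \<Longrightarrow> w2 = w"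
        using lift[OF z] by (auto simp: sec_def)
      have yz: "y \<in> Pow U" "z \<in> Pow U" using y z prsub by auto
      have "card (uncovered (insert u U) (?x x) (if w1 then insert u y else y) (if w2 then insert u z else z))
         \<le> (if e then k else Suc k)"
      proof (cases "w1 = w \<or> w2 = w")
        case True
        then have "card (uncovered (insert u U) (?x x) (if w1 then insert u y else y) (if w2 then insert u z else z))
          \<le> card (uncovered U x y z)"
          using unc[OF x yz, of w1 w2] fu by (intro card_mono) auto
        then show ?thesis using k by auto
      next
        case False
        then have ne: "\<not> e" using w1(2) w2(2) e by blast
        have "card (uncovered (insert u U) (?x x) (if w1 then insert u y else y) (if w2 then insert u z else z))
          \<le> card (insert u (uncovered U x y z))"
          using unc[OF x yz, of w1 w2] fu False by (intro card_mono) auto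
        also have "\<dots> \<le> Suc (card (uncovered U x y z))" by (rule card_insert_le_m1) auto
        finally show ?thesis using k ne by auto
      qed
      then show ?thesis using w1(1) w2(1) by blast
    qed
    \<comment> \<open>If one section fills at least half of its projection, the larger share
      supplies a point that agrees with \<open>x\<close> at \<open>u\<close>, and \<open>u\<close>
      is covered at no cost. Otherwise both points come from the projections, and
      \<open>Suc (f x)\<close> pays for \<open>u\<close> with a factor 2, which is then at most
      \<open>3 - ?g w - ?h w\<close>.\<close>
    consider "?h w \<le> ?g w" "1/2 \<le> ?g w" | "?g w \<le> ?h w" "1/2 \<le> ?h w" | "?g w < 1/2" "?h w < 1/2" by linarith
    then show ?thesis
    proof cases
      case 1
      then have ne: "sec w A \<noteq> {}" by auto
      obtain f where f: "\<forall>x\<in>Pow U. \<exists>y\<in>sec w A. \<exists>z\<in>pr B. card (uncovered U x y z) \<le> f x"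
        "real (card (sec w A)) * ?b * (\<Sum>x\<in>Pow U. 2 ^ f x) \<le> 8 ^ card U"
        using insert.IH[of "sec w A" "pr B"] secsub prsub ne prne[of B] insert.prems by metis
      have pos: "real (card (sec w A)) > 0" using ne fin by (simp add: card_gt_0_iff)
      have "(\<Sum>x\<in>Pow U. 2 ^ f x) \<le> 8 ^ card U / (real (card (sec w A)) * ?b)"
        using f(2) pos ab by (simp add: field_simps)
      also have "\<dots> = 8 ^ card U / (?a * ?b) * (1 / ?g w)" using pos ab by simp
      also have "\<dots> \<le> 8 ^ card U / (?a * ?b) * (3 - ?g w - ?h w)"
        using two_point_weight[of "?h w" "?g w"] 1 gh1[of w] ab by (intro mult_left_mono) auto
      finally have s: "(\<Sum>x\<in>Pow U. 2 ^ f x) \<le> 8 ^ card U / (?a * ?b) * (3 - ?g w - ?h w)" .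
      have "\<exists>y\<in>A. \<exists>z\<in>B. card (uncovered (insert u U) (?x x) y z) \<le> f x" if x: "x \<in> Pow U" for x
      proof -
        obtain y z where yz: "y \<in> sec w A" "z \<in> pr B" "card (uncovered U x y z) \<le> f x" using f(1) x by blast
        moreover have "y \<in> pr A" using yz(1) secsub(2) by blast
        ultimately show ?thesis using good[OF x, of y z "f x" True] by simp
      qed
      then show ?thesis using s by blast
    next
      case 2
      then have ne: "sec w B \<noteq> {}" by auto
      obtain f where f: "\<forall>x\<in>Pow U. \<exists>y\<in>pr A. \<exists>z\<in>sec w B. card (uncovered U x y z) \<le> f x"
        "?a * real (card (sec w B)) * (\<Sum>x\<in>Pow U. 2 ^ f x) \<le> 8 ^ card U"
        using insert.IH[of "pr A" "sec w B"] secsub prsub ne prne[of A] insert.prems by metis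
      have pos: "real (card (sec w B)) > 0" using ne fin by (simp add: card_gt_0_iff)
      have "(\<Sum>x\<in>Pow U. 2 ^ f x) \<le> 8 ^ card U / (?a * real (card (sec w B)))"
        using f(2) pos ab by (simp add: field_simps)
      also have "\<dots> = 8 ^ card U / (?a * ?b) * (1 / ?h w)" using pos ab by simp
      also have "\<dots> \<le> 8 ^ card U / (?a * ?b) * (3 - ?g w - ?h w)"
        using two_point_weight[of "?g w" "?h w"] 2 gh1[of w] ab by (intro mult_left_mono) auto
      finally have s: "(\<Sum>x\<in>Pow U. 2 ^ f x) \<le> 8 ^ card U / (?a * ?b) * (3 - ?g w - ?h w)" .
      have "\<exists>y\<in>A. \<exists>z\<in>B. card (uncovered (insert u U) (?x x) y z) \<le> f x" if x: "x \<in> Pow U" for x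
      proof -
        obtain y z where yz: "y \<in> pr A" "z \<in> sec w B" "card (uncovered U x y z) \<le> f x" using f(1) x by blast
        moreover have "z \<in> pr B" using yz(2) secsub(2) by blast
        ultimately show ?thesis using good[OF x, of y z "f x" True] by simp
      qed
      then show ?thesis using s by blast
    next
      case 3
      obtain f where f: "\<forall>x\<in>Pow U. \<exists>y\<in>pr A. \<exists>z\<in>pr B. card (uncovered U x y z) \<le> f x"
        "?a * ?b * (\<Sum>x\<in>Pow U. 2 ^ f x) \<le> 8 ^ card U"
        using insert.IH[of "pr A" "pr B"] prsub prne insert.prems by metis
      have "(\<Sum>x\<in>Pow U. (2::real) ^ Suc (f x)) = 2 * (\<Sum>x\<in>Pow U. 2 ^ f x)" by (simp add: sum_distrib_left)
      also have "\<dots> \<le> 8 ^ card U / (?a * ?b) * 2" using f(2) ab by (simp add: field_simps)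
      also have "\<dots> \<le> 8 ^ card U / (?a * ?b) * (3 - ?g w - ?h w)"
      proof (rule mult_left_mono)
        show "2 \<le> 3 - ?g w - ?h w" using 3 by linarith
      qed (use ab in simp)
      finally have s: "(\<Sum>x\<in>Pow U. (2::real) ^ Suc (f x)) \<le> 8 ^ card U / (?a * ?b) * (3 - ?g w - ?h w)" .
      have "\<exists>y\<in>A. \<exists>z\<in>B. card (uncovered (insert u U) (?x x) y z) \<le> Suc (f x)" if x: "x \<in> Pow U" for x
      proof -
        obtain y z where "y \<in> pr A" "z \<in> pr B" "card (uncovered U x y z) \<le> f x" using f(1) x by blast
        then show ?thesis using good[OF x, of y z "f x" False] by simp
      qed
      then show ?thesis using s by (intro exI[of _ "\<lambda>x. Suc (f x)"]) blast
    qed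
  qed
  obtain f where f: "\<And>w x. x \<in> Pow U \<Longrightarrow>
      \<exists>y\<in>A. \<exists>z\<in>B. card (uncovered (insert u U) (if w then insert u x else x) y z) \<le> f w x"
    "\<And>w. (\<Sum>x\<in>Pow U. 2 ^ f w x) \<le> 8 ^ card U / (?a * ?b) * (3 - ?g w - ?h w)"
    using step by metis
  define F where "F x = f (u \<in> x) (x - {u})" for x
  have "\<exists>y\<in>A. \<exists>z\<in>B. card (uncovered (insert u U) x y z) \<le> F x" if x: "x \<in> Pow (insert u U)" for x
  proof -
    have "(if u \<in> x then insert u (x - {u}) else x - {u}) = x" by auto
    then show ?thesis using f(1)[of "x - {u}" "u \<in> x"] x unfolding F_def by auto
  qed
  moreover have "real (card A) * real (card B) * (\<Sum>x\<in>Pow (insert u U). 2 ^ F x) \<le> 8 ^ card (insert u U)"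
  proof -
    have "(\<Sum>x\<in>Pow (insert u U). (2::real) ^ F x) = (\<Sum>x\<in>Pow U. 2 ^ F x) + (\<Sum>x\<in>insert u ` Pow U. 2 ^ F x)"
      unfolding Pow_insert using insert.hyps by (intro sum.union_disjoint) auto
    also have "(\<Sum>x\<in>insert u ` Pow U. (2::real) ^ F x) = (\<Sum>x\<in>Pow U. 2 ^ F (insert u x))"
      by (subst sum.reindex) (use insert.hyps in \<open>auto intro!: inj_onI\<close>)
    also have "(\<Sum>x\<in>Pow U. (2::real) ^ F x) + (\<Sum>x\<in>Pow U. 2 ^ F (insert u x))
        = (\<Sum>x\<in>Pow U. 2 ^ f False x) + (\<Sum>x\<in>Pow U. 2 ^ f True x)"
    proof -
      have "F x = f False x" "F (insert u x) = f True x" if "x \<in> Pow U" for x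
      proof -
        have "u \<notin> x" using that insert.hyps by auto
        then show "F x = f False x" "F (insert u x) = f True x" by (simp_all add: F_def)
      qed
      then show ?thesis by simp
    qed
    \<comment> \<open>When the bounds for both values of \<open>w\<close> are added, the shares of
      the two sections sum to \<open>card A / card (pr A)\<close>, and likewise for
      \<open>B\<close>; this is the form that \<open>amgm_eight\<close> requires.\<close>
    also have "\<dots> \<le> 8 ^ card U / (?a * ?b) * (3 - ?g False - ?h False) + 8 ^ card U / (?a * ?b) * (3 - ?g True - ?h True)"
      using f(2) by (intro add_mono) auto
    also have "\<dots> = 8 ^ card U / (?a * ?b) * (6 - (?g False + ?g True) - (?h False + ?h True))"
      by (simp add: algebra_simps)
    also have "?g False + ?g True = real (card A) / ?a"
      using cardC[of A] insert.prems by (simp add: add_divide_distrib)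
    also have "?h False + ?h True = real (card B) / ?b"
      using cardC[of B] insert.prems by (simp add: add_divide_distrib)
    finally have le: "(\<Sum>x\<in>Pow (insert u U). (2::real) ^ F x)
        \<le> 8 ^ card U / (?a * ?b) * (6 - real (card A) / ?a - real (card B) / ?b)" .
    define s t where "s = real (card A) / ?a" and "t = real (card B) / ?b"
    have st: "real (card A) = s * ?a" "real (card B) = t * ?b" using ab by (simp_all add: s_def t_def)
    have sum6: "s + t \<le> 6"
    proof -
      have "s = ?g False + ?g True" "t = ?h False + ?h True"
        using cardC[of A] cardC[of B] insert.prems by (simp_all add: add_divide_distrib s_def t_def)
      then show ?thesis using gh1[of False] gh1[of True] by linarith
    qed
    have "real (card A) * real (card B) * (\<Sum>x\<in>Pow (insert u U). 2 ^ F x)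
       \<le> real (card A) * real (card B) * (8 ^ card U / (?a * ?b) * (6 - s - t))"
      using le by (intro mult_left_mono) (auto simp: s_def t_def)
    also have "\<dots> = 8 ^ card U * (s * t * (6 - s - t))" unfolding st using ab by simp
    also have "\<dots> \<le> 8 ^ card U * 8" using amgm_eight[of s t] sum6 by (intro mult_left_mono) (auto simp: s_def t_def)
    finally show ?thesis using insert.hyps by simp
  qed
  ultimately show ?case by blast
qed

text \<open>Complementation maps \<open>C\<close> injectively into \<open>A\<close>, so the two
  factors \<open>card A\<close> in Talagrand's inequality are at least \<open>card C\<close>; the
  third comes from the exponential sum restricted to \<open>C\<close>. In the application,
  complementing an index set swaps the sample with its ghost.\<close>

lemma card_uncovered_antipodal:
  assumes U: "finite U" and A: "A \<subseteq> Pow U"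
    and C: "C \<subseteq> Pow U" "\<And>x. x \<in> C \<Longrightarrow> U - x \<in> A"
      "\<And>x y z. x \<in> C \<Longrightarrow> y \<in> A \<Longrightarrow> z \<in> A \<Longrightarrow> j \<le> card (uncovered U x y z)"
  shows "2 ^ j * real (card C) ^ 3 \<le> 8 ^ card U"
proof (cases "C = {}")
  case False
  have finA: "finite A" and finC: "finite C" using U A C by (meson finite_Pow_iff finite_subset)+
  have "inj_on (\<lambda>x. U - x) C" using C(1) by (auto intro!: inj_onI)
  then have CA: "card C \<le> card A" by (rule card_inj_on_le) (use C finA in auto)
  have Ane: "A \<noteq> {}" using False C by auto
  obtain f where f: "\<forall>x\<in>Pow U. \<exists>y\<in>A. \<exists>z\<in>A. card (uncovered U x y z) \<le> f x"
    "real (card A) * real (card A) * (\<Sum>x\<in>Pow U. 2 ^ f x) \<le> 8 ^ card U"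
    using talagrand_two_points[OF U A A Ane Ane] by blast
  have "j \<le> f x" if "x \<in> C" for x using f(1) C that by (meson order_trans subsetD)
  then have "real (card C) * 2 ^ j \<le> (\<Sum>x\<in>C. 2 ^ f x)"
    using sum_bounded_below[of C "2 ^ j :: real" "\<lambda>x. 2 ^ f x"] by simp
  also have "\<dots> \<le> (\<Sum>x\<in>Pow U. 2 ^ f x)" by (rule sum_mono2) (use U C in auto)
  finally have 1: "real (card C) * 2 ^ j \<le> (\<Sum>x\<in>Pow U. 2 ^ f x)" .
  have "2 ^ j * real (card C) ^ 3 = (real (card C) * real (card C)) * (real (card C) * 2 ^ j)"
    by (simp add: power3_eq_cube)
  also have "\<dots> \<le> (real (card A) * real (card A)) * (\<Sum>x\<in>Pow U. 2 ^ f x)"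
    using 1 CA by (intro mult_mono) auto
  finally show ?thesis using f(2) by linarith
qed simp

section \<open>A net of the unit sphere\<close>

text \<open>With \<open>\<kappa> = 0\<close> this is a plain sum of squared projections; with
  \<kappa> of the order of the sample size it measures how far an unnormalized second-moment matrix
  is from a multiple of the identity. One net argument serves both.\<close>

definition qform :: "nat \<Rightarrow> 'a set \<Rightarrow> ('a \<Rightarrow> nat \<Rightarrow> real) \<Rightarrow> real \<Rightarrow> (nat \<Rightarrow> real) \<Rightarrow> real" where
  "qform d J a \<kappa> v = (\<Sum>i\<in>J. (inner_vec d (a i) v)\<^sup>2) - \<kappa> * inner_vec d v v"

text \<open>The factor \<open>4 \<surd>d\<close> makes rounding towards zero move a vector by at most \<open>1/4\<close>.\<close>

definition net_point :: "nat \<Rightarrow> (nat \<Rightarrow> int) \<Rightarrow> nat \<Rightarrow> real" where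
  "net_point d z = (\<lambda>i. real_of_int (z i) / (4 * sqrt (real d)))"

text \<open>The bound on the sum of the \<open>\<bar>z i\<bar>\<close> keeps the net exponential in
  \<open>d\<close>; the box alone has \<open>(32 d + 1)^d\<close> points.\<close>

definition net :: "nat \<Rightarrow> (nat \<Rightarrow> real) set" where
  "net d = {u \<in> net_point d ` {z \<in> {..<d} \<rightarrow>\<^sub>E {- int (16 * d)..int (16 * d)}. (\<Sum>i<d. \<bar>z i\<bar>) \<le> int (16 * d)}.
     inner_vec d u u \<le> 1}"

lemma finite_net: "finite (net d)"
  unfolding net_def by (intro finite_Collect_conjI disjI1) (auto intro!: finite_imageI finite_PiE)

lemma net_le_1: "u \<in> net d \<Longrightarrow> inner_vec d u u \<le> 1"
  by (simp add: net_def)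

lemma sum_half_powers_le: "(\<Sum>k\<in>{- int m..int m}. (1/2::real) ^ nat \<bar>k\<bar>) \<le> 3 - 2 * (1/2) ^ m"
proof (induction m)
  case (Suc m)
  have "{- int (Suc m)..int (Suc m)} = insert (- int (Suc m)) (insert (int (Suc m)) {- int m..int m})"
    by auto
  then have "(\<Sum>k\<in>{- int (Suc m)..int (Suc m)}. (1/2::real) ^ nat \<bar>k\<bar>)
     = (1/2) ^ Suc m + ((1/2) ^ Suc m + (\<Sum>k\<in>{- int m..int m}. (1/2) ^ nat \<bar>k\<bar>))"
    by (simp del: power_Suc of_nat_Suc)
  then show ?case using Suc by simp
qed simp

text \<open>Counting with exponential weights: \<open>2^(16d)\<close> times the product of the
  \<open>2^-|z i|\<close> is at least 1 at each admissible \<open>z\<close>, and over the whole box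
  these weights factor into one-dimensional sums of at most 3. Finally
  \<open>2^16 * 3 \<le> exp 13\<close>.\<close>

lemma card_net_le: "real (card (net d)) \<le> exp (13 * real d)"
proof -
  let ?F = "{- int (16 * d)..int (16 * d)}"
  let ?Z = "{z \<in> {..<d} \<rightarrow>\<^sub>E ?F. (\<Sum>i<d. \<bar>z i\<bar>) \<le> int (16 * d)}"
  have finP: "finite ({..<d} \<rightarrow>\<^sub>E ?F)" by (intro finite_PiE) auto
  then have finZ: "finite ?Z" by simp
  have "card (net d) \<le> card (net_point d ` ?Z)"
    unfolding net_def using finZ by (intro card_mono) auto
  also have "\<dots> \<le> card ?Z" using finZ by (rule card_image_le)
  finally have 1: "card (net d) \<le> card ?Z" .
  have "real (card ?Z) = (\<Sum>z\<in>?Z. 1)" by simp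
  also have "\<dots> \<le> (\<Sum>z\<in>?Z. 2 ^ (16 * d) * (\<Prod>i<d. (1/2) ^ nat \<bar>z i\<bar>))"
  proof (rule sum_mono)
    fix z assume z: "z \<in> ?Z"
    have "(\<Prod>i<d. (1/2::real) ^ nat \<bar>z i\<bar>) = (1/2) ^ (\<Sum>i<d. nat \<bar>z i\<bar>)" by (simp add: power_sum)
    moreover have "int (\<Sum>i<d. nat \<bar>z i\<bar>) \<le> int (16 * d)" using z by simp
    then have "(\<Sum>i<d. nat \<bar>z i\<bar>) \<le> 16 * d" by (simp only: of_nat_le_iff)
    then have "(1/2::real) ^ (16 * d) \<le> (1/2) ^ (\<Sum>i<d. nat \<bar>z i\<bar>)" by (intro power_decreasing) auto
    then have "1 \<le> (2::real) ^ (16 * d) * (1/2) ^ (\<Sum>i<d. nat \<bar>z i\<bar>)"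
      by (simp add: power_one_over field_simps)
    ultimately show "1 \<le> (2::real) ^ (16 * d) * (\<Prod>i<d. (1/2) ^ nat \<bar>z i\<bar>)" by simp
  qed
  also have "\<dots> \<le> (\<Sum>z\<in>{..<d} \<rightarrow>\<^sub>E ?F. 2 ^ (16 * d) * (\<Prod>i<d. (1/2) ^ nat \<bar>z i\<bar>))"
  proof (rule sum_mono2[OF finP])
    show "?Z \<subseteq> {..<d} \<rightarrow>\<^sub>E ?F" by blast
    show "0 \<le> (2::real) ^ (16 * d) * (\<Prod>i<d. (1/2) ^ nat \<bar>z i\<bar>)" for z :: "nat \<Rightarrow> int"
      by (intro mult_nonneg_nonneg prod_nonneg) simp_all
  qed
  also have "\<dots> = 2 ^ (16 * d) * (\<Sum>z\<in>{..<d} \<rightarrow>\<^sub>E ?F. \<Prod>i<d. (1/2) ^ nat \<bar>z i\<bar>)"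
    by (rule sum_distrib_left[symmetric])
  also have "(\<Sum>z\<in>{..<d} \<rightarrow>\<^sub>E ?F. \<Prod>i<d. (1/2::real) ^ nat \<bar>z i\<bar>) = (\<Prod>i<d. \<Sum>k\<in>?F. (1/2) ^ nat \<bar>k\<bar>)"
    by (rule prod_sum_PiE[symmetric]) auto
  also have "2 ^ (16 * d) * (\<Prod>i<d. \<Sum>k\<in>?F. (1/2::real) ^ nat \<bar>k\<bar>) \<le> 2 ^ (16 * d) * (\<Prod>i<d. 3)"
  proof (intro mult_left_mono prod_mono conjI)
    show "(\<Sum>k\<in>?F. (1/2::real) ^ nat \<bar>k\<bar>) \<le> 3"
      using sum_half_powers_le[of "16 * d"] zero_le_power[of "1/2::real" "16 * d"] by linarith
  qed (auto intro!: sum_nonneg)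
  also have "\<dots> = (2 ^ 16 * 3) ^ d" by (simp add: power_mult flip: power_mult_distrib)
  also have "\<dots> \<le> (exp 13) ^ d"
  proof (rule power_mono)
    have "(2::real) ^ 16 * 3 \<le> (13/8) ^ 26" by (simp add: power_divide)
    also have "\<dots> \<le> exp (1/2) ^ 26"
      using exp_lower_Taylor_quadratic[of "1/2"] by (intro power_mono) (auto simp: power2_eq_square)
    finally show "(2::real) ^ 16 * 3 \<le> exp 13" by (simp flip: exp_of_nat_mult)
  qed simp
  also have "\<dots> = exp (13 * real d)" by (simp flip: exp_of_nat_mult add: mult.commute)
  finally show ?thesis using 1 by (meson of_nat_mono order_trans)
qed

lemma net_approx:
  assumes d: "d \<ge> 1" and v: "inner_vec d v v \<le> 1"
  obtains u where "u \<in> net d" "inner_vec d (\<lambda>i. v i - u i) (\<lambda>i. v i - u i) \<le> 1 / 16"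
proof -
  define s where "s = 4 * sqrt (real d)"
  have s: "s > 0" "s\<^sup>2 = 16 * real d" using d by (auto simp: s_def power2_eq_square)
  \<comment> \<open>Rounding towards zero never lengthens a coordinate, so the net point stays in
    the unit ball.\<close>
  define tr where "tr x = (if 0 \<le> x then \<lfloor>x\<rfloor> else \<lceil>x\<rceil>)" for x :: real
  have tr: "\<bar>real_of_int (tr x)\<bar> \<le> \<bar>x\<bar>" "\<bar>x - real_of_int (tr x)\<bar> \<le> 1" for x
  proof -
    have "\<bar>real_of_int (tr x)\<bar> \<le> \<bar>x\<bar> \<and> \<bar>x - real_of_int (tr x)\<bar> \<le> 1"
    proof (cases "0 \<le> x")
      case True
      then have "0 \<le> real_of_int \<lfloor>x\<rfloor>" "tr x = \<lfloor>x\<rfloor>" by (simp_all add: tr_def)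
      then show ?thesis using True by linarith
    next
      case False
      then have "real_of_int \<lceil>x\<rceil> \<le> 0" "tr x = \<lceil>x\<rceil>" by (simp_all add: tr_def)
      then show ?thesis using False by linarith
    qed
    then show "\<bar>real_of_int (tr x)\<bar> \<le> \<bar>x\<bar>" "\<bar>x - real_of_int (tr x)\<bar> \<le> 1" by auto
  qed
  define z where "z = restrict (\<lambda>i. tr (s * v i)) {..<d}"
  let ?u = "net_point d z"
  have ui: "?u i = real_of_int (tr (s * v i)) / s" if "i < d" for i
    using that by (simp add: net_point_def z_def s_def)
  \<comment> \<open>This turns the Euclidean bound on \<open>s * v\<close>, where
    \<open>s\<^sup>2 = 16 * d\<close>, into the l1 bound built into \<open>net\<close>.\<close>
  have sq: "\<bar>k\<bar> \<le> k\<^sup>2" for k :: int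
  proof (cases "k = 0")
    case False
    then have "\<bar>k\<bar> * 1 \<le> \<bar>k\<bar> * \<bar>k\<bar>" by (intro mult_left_mono) auto
    then show ?thesis by (simp add: power2_eq_square)
  qed simp
  have "real_of_int (\<Sum>i<d. \<bar>z i\<bar>) = (\<Sum>i<d. real_of_int \<bar>tr (s * v i)\<bar>)" by (simp add: z_def)
  also have "\<dots> \<le> (\<Sum>i<d. (s * v i)\<^sup>2)"
  proof (rule sum_mono)
    fix i
    have "real_of_int \<bar>tr (s * v i)\<bar> \<le> real_of_int ((tr (s * v i))\<^sup>2)" using sq by (simp only: of_int_le_iff)
    also have "\<dots> = \<bar>real_of_int (tr (s * v i))\<bar>\<^sup>2" by simp
    also have "\<dots> \<le> \<bar>s * v i\<bar>\<^sup>2" using tr(1) by (intro power_mono) auto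
    finally show "real_of_int \<bar>tr (s * v i)\<bar> \<le> (s * v i)\<^sup>2" by simp
  qed
  also have "\<dots> = s\<^sup>2 * inner_vec d v v"
    by (simp add: inner_vec_def power_mult_distrib sum_distrib_left power2_eq_square[of "v _"])
  also have "\<dots> \<le> 16 * real d" using v s by (simp add: mult_left_le)
  finally have "real_of_int (\<Sum>i<d. \<bar>z i\<bar>) \<le> real_of_int (int (16 * d))" by simp
  then have sumz: "(\<Sum>i<d. \<bar>z i\<bar>) \<le> int (16 * d)" by (simp only: of_int_le_iff)
  have zi: "\<bar>z i\<bar> \<le> int (16 * d)" if "i < d" for i
    using member_le_sum[of i "{..<d}" "\<lambda>i. \<bar>z i\<bar>"] that sumz by fastforce
  have "z \<in> {..<d} \<rightarrow>\<^sub>E {- int (16 * d)..int (16 * d)}"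
  proof (rule PiE_I)
    show "z i \<in> {- int (16 * d)..int (16 * d)}" if "i \<in> {..<d}" for i
      using zi[of i] that by (simp add: abs_le_iff)
  qed (simp add: z_def)
  moreover have "inner_vec d ?u ?u \<le> inner_vec d v v"
    unfolding inner_vec_def
  proof (rule sum_mono)
    fix i assume i: "i \<in> {..<d}"
    have "\<bar>?u i\<bar> = \<bar>real_of_int (tr (s * v i))\<bar> / s" using i ui[of i] s by simp
    also have "\<dots> \<le> \<bar>s * v i\<bar> / s" using tr(1) s by (intro divide_right_mono) auto
    also have "\<dots> = \<bar>v i\<bar>" using s by (simp add: abs_mult)
    finally have "\<bar>?u i\<bar> \<le> \<bar>v i\<bar>" .
    then have "\<bar>?u i\<bar>\<^sup>2 \<le> \<bar>v i\<bar>\<^sup>2" by (intro power_mono) auto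
    then show "?u i * ?u i \<le> v i * v i" by (simp add: power2_eq_square)
  qed
  ultimately have "?u \<in> net d" using v sumz by (auto simp: net_def)
  moreover have "inner_vec d (\<lambda>i. v i - ?u i) (\<lambda>i. v i - ?u i) \<le> 1 / 16"
  proof -
    have "inner_vec d (\<lambda>i. v i - ?u i) (\<lambda>i. v i - ?u i) \<le> (\<Sum>i<d. 1 / s\<^sup>2)"
      unfolding inner_vec_def
    proof (rule sum_mono)
      fix i assume i: "i \<in> {..<d}"
      have "v i - ?u i = (s * v i - real_of_int (tr (s * v i))) / s" using ui i s by (simp add: field_simps)
      then have "\<bar>v i - ?u i\<bar> \<le> 1 / s" using tr(2)[of "s * v i"] s by (simp add: divide_right_mono)
      then have "\<bar>v i - ?u i\<bar>\<^sup>2 \<le> (1 / s)\<^sup>2" by (intro power_mono) auto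
      then show "(v i - ?u i) * (v i - ?u i) \<le> 1 / s\<^sup>2" by (simp add: power2_eq_square)
    qed
    then show ?thesis using d by (simp add: s)
  qed
  ultimately show ?thesis by (rule that)
qed

lemma qform_scale: "qform d J a \<kappa> (\<lambda>i. c * v i) = c\<^sup>2 * qform d J a \<kappa> v"
  by (simp add: qform_def inner_vec_scale_right inner_vec_scale power_mult_distrib sum_distrib_left
      algebra_simps power2_eq_square)

lemma inner_vec_add_right: "inner_vec d u (\<lambda>i. v i + w i) = inner_vec d u v + inner_vec d u w"
  by (simp add: inner_vec_def sum.distrib algebra_simps)

text \<open>The difference is the bilinear form at \<open>v - u\<close> and \<open>v + u\<close>,
  expanded by polarization. The free parameter \<open>c\<close> stretches the short vector
  \<open>v - u\<close> and shrinks \<open>v + u\<close>, so that both can be made to contribute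
  equally.\<close>

lemma qform_parallelogram:
  "qform d J a \<kappa> v - qform d J a \<kappa> u =
     (qform d J a \<kappa> (\<lambda>i. c * (v i - u i) + (v i + u i) / c) - qform d J a \<kappa> (\<lambda>i. c * (v i - u i) - (v i + u i) / c)) / 4"
  if "c \<noteq> 0"
proof -
  have *: "4 * (x\<^sup>2 - y\<^sup>2) = (c * (x - y) + (x + y) / c)\<^sup>2 - (c * (x - y) - (x + y) / c)\<^sup>2" for x y :: real
    using that by (simp add: power2_eq_square field_simps)
  have A: "4 * ((inner_vec d b v)\<^sup>2 - (inner_vec d b u)\<^sup>2)
    = (inner_vec d b (\<lambda>i. c * (v i - u i) + (v i + u i) / c))\<^sup>2
      - (inner_vec d b (\<lambda>i. c * (v i - u i) - (v i + u i) / c))\<^sup>2" for b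
  proof -
    have "inner_vec d b (\<lambda>i. (v i + u i) / c) = (inner_vec d b v + inner_vec d b u) / c"
      using inner_vec_scale_right[of d b "1 / c" "\<lambda>i. v i + u i"] by (simp add: inner_vec_add_right)
    then show ?thesis
      using *[of "inner_vec d b v" "inner_vec d b u"]
      by (simp add: inner_vec_add_right inner_vec_diff_right inner_vec_scale_right)
  qed
  have B: "4 * (inner_vec d v v - inner_vec d u u)
    = inner_vec d (\<lambda>i. c * (v i - u i) + (v i + u i) / c) (\<lambda>i. c * (v i - u i) + (v i + u i) / c)
      - inner_vec d (\<lambda>i. c * (v i - u i) - (v i + u i) / c) (\<lambda>i. c * (v i - u i) - (v i + u i) / c)"
    unfolding inner_vec_def sum_subtractf[symmetric] sum_distrib_left
    by (intro sum.cong refl) (use * in \<open>simp add: power2_eq_square\<close>)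
  have "4 * (qform d J a \<kappa> v - qform d J a \<kappa> u)
     = (\<Sum>i\<in>J. 4 * ((inner_vec d (a i) v)\<^sup>2 - (inner_vec d (a i) u)\<^sup>2)) - \<kappa> * (4 * (inner_vec d v v - inner_vec d u u))"
    by (simp add: qform_def sum_subtractf sum_distrib_left[symmetric] algebra_simps)
  also have "\<dots> = qform d J a \<kappa> (\<lambda>i. c * (v i - u i) + (v i + u i) / c)
      - qform d J a \<kappa> (\<lambda>i. c * (v i - u i) - (v i + u i) / c)"
    unfolding A B by (simp add: qform_def sum_subtractf right_diff_distrib)
  finally show ?thesis by simp
qed

text \<open>Let \<open>s\<close> be the supremum of the form on the unit ball. Its values at a point
  of the ball and at the nearby net point differ by at most \<open>s / 2\<close>, hence
  \<open>s \<le> m + s / 2\<close>; the crude constant \<open>K\<close> makes \<open>s\<close>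
  finite, so that it can be cancelled.\<close>

lemma qform_le_twice_net:
  assumes d: "d \<ge> 1" and m: "\<And>u. u \<in> net d \<Longrightarrow> \<bar>qform d J a \<kappa> u\<bar> \<le> m"
  shows "\<bar>qform d J a \<kappa> v\<bar> \<le> 2 * m * inner_vec d v v"
proof -
  let ?q = "qform d J a \<kappa>"
  define K where "K = (\<Sum>i\<in>J. inner_vec d (a i) (a i)) + \<bar>\<kappa>\<bar>"
  have K0: "0 \<le> K" unfolding K_def by (intro add_nonneg_nonneg sum_nonneg) auto
  have bd: "\<bar>?q v\<bar> \<le> K * inner_vec d v v" for v
  proof -
    have "(\<Sum>i\<in>J. (inner_vec d (a i) v)\<^sup>2) \<le> (\<Sum>i\<in>J. inner_vec d (a i) (a i)) * inner_vec d v v"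
      unfolding sum_distrib_right by (intro sum_mono inner_vec_Cauchy_Schwarz)
    moreover have "0 \<le> (\<Sum>i\<in>J. (inner_vec d (a i) v)\<^sup>2)" by (intro sum_nonneg) auto
    moreover have "\<bar>\<kappa> * inner_vec d v v\<bar> = \<bar>\<kappa>\<bar> * inner_vec d v v" by (simp add: abs_mult)
    ultimately show ?thesis by (simp add: qform_def K_def distrib_right)
  qed
  define S where "S = {\<bar>?q v\<bar> |v. inner_vec d v v \<le> 1}"
  have Sb: "x \<le> K" if "x \<in> S" for x
    using that bd K0 unfolding S_def by (auto intro: order_trans mult_left_le)
  then have bdd: "bdd_above S" unfolding bdd_above_def by blast
  have "\<bar>?q (\<lambda>_. 0)\<bar> \<in> S" unfolding S_def by (auto simp: inner_vec_def intro!: exI[of _ "\<lambda>_. 0"])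
  then have ne: "S \<noteq> {}" by auto
  define s where "s = Sup S"
  have s1: "\<bar>?q v\<bar> \<le> s" if "inner_vec d v v \<le> 1" for v
    unfolding s_def by (rule cSup_upper[OF _ bdd]) (use that in \<open>auto simp: S_def\<close>)
  have s0: "0 \<le> s" using s1[of "\<lambda>_. 0"] by (simp add: inner_vec_def)
  have s: "\<bar>?q v\<bar> \<le> s * inner_vec d v v" for v
  proof (cases "inner_vec d v v = 0")
    case True
    then show ?thesis using bd[of v] by simp
  next
    case False
    define n where "n = sqrt (inner_vec d v v)"
    have n: "n > 0" "n\<^sup>2 = inner_vec d v v" using False inner_vec_self_nonneg[of d v] by (auto simp: n_def less_le)
    have "\<bar>?q (\<lambda>i. (1 / n) * v i)\<bar> \<le> s"
      by (rule s1, subst inner_vec_scale, subst inner_vec_scale_right, subst n(2)[symmetric])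
         (use n(1) in \<open>simp add: power2_eq_square\<close>)
    then have "\<bar>?q v\<bar> / n\<^sup>2 \<le> s" unfolding qform_scale by (simp add: abs_mult power_divide)
    moreover have "inner_vec d v v > 0" using n by (simp flip: n(2))
    ultimately show ?thesis unfolding n(2) by (simp add: field_simps)
  qed
  have "s \<le> m + s / 2"
    unfolding s_def
  proof (rule cSup_least[OF ne])
    fix x assume "x \<in> S"
    then obtain v where v: "x = \<bar>?q v\<bar>" "inner_vec d v v \<le> 1" by (auto simp: S_def)
    obtain u where u: "u \<in> net d" "inner_vec d (\<lambda>i. v i - u i) (\<lambda>i. v i - u i) \<le> 1 / 16"
      using net_approx[OF d v(2)] .
    \<comment> \<open>The value balances the two parts: \<open>2 c^2 |v - u|^2 \<le> 1\<close> since
      \<open>|v - u|^2 \<le> 1/16\<close>, and \<open>2 |v + u|^2 / c^2 \<le> 1\<close> since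
      \<open>|v + u|^2 \<le> 4\<close>.\<close>
    define c where "c = sqrt 8"
    have c: "c \<noteq> 0" "c * c = 8" by (auto simp: c_def)
    let ?x = "\<lambda>i. c * (v i - u i) + (v i + u i) / c" and ?y = "\<lambda>i. c * (v i - u i) - (v i + u i) / c"
    have "inner_vec d ?x ?x + inner_vec d ?y ?y
       = (\<Sum>i<d. 16 * ((v i - u i) * (v i - u i)) + ((v i + u i) * (v i + u i)) / 4)"
      unfolding inner_vec_def sum.distrib[symmetric]
    proof (rule sum.cong[OF refl])
      fix i
      have "(c * p + q / c) * (c * p + q / c) + (c * p - q / c) * (c * p - q / c)
         = 2 * (c * c) * (p * p) + 2 * (q * q) / (c * c)" for p q :: real
        using c(1) by (simp add: field_simps)
      then show "?x i * ?x i + ?y i * ?y i = 16 * ((v i - u i) * (v i - u i)) + ((v i + u i) * (v i + u i)) / 4"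
        by (simp add: c(2))
    qed
    also have "\<dots> = 16 * inner_vec d (\<lambda>i. v i - u i) (\<lambda>i. v i - u i) + inner_vec d (\<lambda>i. v i + u i) (\<lambda>i. v i + u i) / 4"
      by (simp add: inner_vec_def sum.distrib sum_distrib_left sum_divide_distrib)
    finally have sumxy: "inner_vec d ?x ?x + inner_vec d ?y ?y
        = 16 * inner_vec d (\<lambda>i. v i - u i) (\<lambda>i. v i - u i) + inner_vec d (\<lambda>i. v i + u i) (\<lambda>i. v i + u i) / 4" .
    have "inner_vec d (\<lambda>i. v i + u i) (\<lambda>i. v i + u i) \<le> 2 * inner_vec d v v + 2 * inner_vec d u u"
      unfolding inner_vec_def sum_distrib_left sum.distrib[symmetric]
    proof (rule sum_mono)
      fix i
      show "(v i + u i) * (v i + u i) \<le> 2 * (v i * v i) + 2 * (u i * u i)"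
        using zero_le_square[of "v i - u i"] by (simp add: algebra_simps)
    qed
    then have xy: "inner_vec d ?x ?x + inner_vec d ?y ?y \<le> 2"
      unfolding sumxy using u v net_le_1[OF u(1)] by simp
    have "\<bar>?q v - ?q u\<bar> = \<bar>?q ?x - ?q ?y\<bar> / 4"
      by (subst qform_parallelogram[OF c(1)]) simp
    also have "\<dots> \<le> (s * inner_vec d ?x ?x + s * inner_vec d ?y ?y) / 4"
      using s[of ?x] s[of ?y] by simp
    also have "\<dots> = s * (inner_vec d ?x ?x + inner_vec d ?y ?y) / 4" by (simp add: distrib_left)
    also have "\<dots> \<le> s * 2 / 4" using xy s0 by (intro divide_right_mono mult_left_mono) auto
    finally show "x \<le> m + Sup S / 2" using m[OF u(1)] v(1) unfolding s_def by linarith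
  qed
  then have "s \<le> 2 * m" by simp
  then show ?thesis using s[of v] by (meson inner_vec_self_nonneg mult_right_mono order_trans)
qed

section \<open>Symmetrization of i.i.d. samples\<close>

definition mix :: "'i set \<Rightarrow> ('i \<Rightarrow> 'b) \<Rightarrow> ('i \<Rightarrow> 'b) \<Rightarrow> 'i \<Rightarrow> 'b" where
  "mix A X Y = (\<lambda>i. if i \<in> A then X i else Y i)"

lemma measurable_mix [measurable]:
  "(\<lambda>p. mix A (fst p) (snd p)) \<in> Pi\<^sub>M I (\<lambda>_. P) \<Otimes>\<^sub>M Pi\<^sub>M I (\<lambda>_. P) \<rightarrow>\<^sub>M Pi\<^sub>M I (\<lambda>_. P)"
  "(\<lambda>p. mix A (snd p) (fst p)) \<in> Pi\<^sub>M I (\<lambda>_. P) \<Otimes>\<^sub>M Pi\<^sub>M I (\<lambda>_. P) \<rightarrow>\<^sub>M Pi\<^sub>M I (\<lambda>_. P)"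
proof -
  have c: "(\<lambda>p. fst p i) \<in> Pi\<^sub>M I (\<lambda>_. P) \<Otimes>\<^sub>M Pi\<^sub>M I (\<lambda>_. P) \<rightarrow>\<^sub>M P"
    "(\<lambda>p. snd p i) \<in> Pi\<^sub>M I (\<lambda>_. P) \<Otimes>\<^sub>M Pi\<^sub>M I (\<lambda>_. P) \<rightarrow>\<^sub>M P" if "i \<in> I" for i
    using that by (auto intro: measurable_compose[OF measurable_fst measurable_component_singleton]
        measurable_compose[OF measurable_snd measurable_component_singleton])
  show "(\<lambda>p. mix A (fst p) (snd p)) \<in> Pi\<^sub>M I (\<lambda>_. P) \<Otimes>\<^sub>M Pi\<^sub>M I (\<lambda>_. P) \<rightarrow>\<^sub>M Pi\<^sub>M I (\<lambda>_. P)"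
  proof (rule measurable_PiM_single')
    show "(\<lambda>p. mix A (fst p) (snd p) i) \<in> Pi\<^sub>M I (\<lambda>_. P) \<Otimes>\<^sub>M Pi\<^sub>M I (\<lambda>_. P) \<rightarrow>\<^sub>M P" if "i \<in> I" for i
      using c[OF that] by (cases "i \<in> A") (simp_all add: mix_def)
  qed (auto simp: mix_def space_pair_measure space_PiM PiE_iff extensional_def)
  show "(\<lambda>p. mix A (snd p) (fst p)) \<in> Pi\<^sub>M I (\<lambda>_. P) \<Otimes>\<^sub>M Pi\<^sub>M I (\<lambda>_. P) \<rightarrow>\<^sub>M Pi\<^sub>M I (\<lambda>_. P)"
  proof (rule measurable_PiM_single')
    show "(\<lambda>p. mix A (snd p) (fst p) i) \<in> Pi\<^sub>M I (\<lambda>_. P) \<Otimes>\<^sub>M Pi\<^sub>M I (\<lambda>_. P) \<rightarrow>\<^sub>M P" if "i \<in> I" for i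
      using c[OF that] by (cases "i \<in> A") (simp_all add: mix_def)
  qed (auto simp: mix_def space_pair_measure space_PiM PiE_iff extensional_def)
qed

text \<open>\<open>enc B\<close> lays out the pair, exchanged along \<open>B\<close>, as one point
  of the \<open>2n\<close>-fold product. The law of that point is computed on rectangles and does
  not depend on \<open>B\<close>; for \<open>B = UNIV\<close> the exchange is the identity.\<close>

lemma distr_swap_coordinates:
  fixes n :: nat
  assumes P: "prob_space P"
  defines "M \<equiv> Pi\<^sub>M {..<n} (\<lambda>_. P)"
  shows "distr (M \<Otimes>\<^sub>M M) (M \<Otimes>\<^sub>M M) (\<lambda>p. (mix A (fst p) (snd p), mix A (snd p) (fst p))) = M \<Otimes>\<^sub>M M"
proof -
  interpret P: prob_space P by fact
  interpret PP: product_prob_space "\<lambda>_::nat. P" by unfold_locales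
  interpret M: prob_space M unfolding M_def by (rule prob_space_PiM) (rule P)
  define M2 where "M2 = Pi\<^sub>M {..<2 * n} (\<lambda>_. P)"
  define enc where "enc B p = (\<lambda>i\<in>{..<2 * n}. if i < n then mix B (fst p) (snd p) i else mix B (snd p) (fst p) (i - n))"
    for B and p :: "(nat \<Rightarrow> 'a) \<times> (nat \<Rightarrow> 'a)"
  define dec where "dec Z = (\<lambda>i\<in>{..<n}. Z i, \<lambda>i\<in>{..<n}. Z (n + i))" for Z :: "nat \<Rightarrow> 'a"
  have enc_m: "enc B \<in> M \<Otimes>\<^sub>M M \<rightarrow>\<^sub>M M2" for B
    unfolding enc_def M2_def
  proof (rule measurable_restrict)
    fix i assume i: "i \<in> {..<2 * n}"
    have c: "(\<lambda>p. mix B (fst p) (snd p) k) \<in> M \<Otimes>\<^sub>M M \<rightarrow>\<^sub>M P"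
      "(\<lambda>p. mix B (snd p) (fst p) k) \<in> M \<Otimes>\<^sub>M M \<rightarrow>\<^sub>M P" if "k < n" for k
      unfolding M_def
      by (rule measurable_compose[OF measurable_mix(1) measurable_component_singleton]; use that in simp)
         (rule measurable_compose[OF measurable_mix(2) measurable_component_singleton]; use that in simp)
    show "(\<lambda>p. if i < n then mix B (fst p) (snd p) i else mix B (snd p) (fst p) (i - n)) \<in> M \<Otimes>\<^sub>M M \<rightarrow>\<^sub>M P"
      using c[of i] c[of "i - n"] i by (cases "i < n") auto
  qed
  have dec_m: "dec \<in> M2 \<rightarrow>\<^sub>M M \<Otimes>\<^sub>M M"
    unfolding dec_def M2_def M_def
    by (intro measurable_Pair measurable_restrict measurable_component_singleton) auto
  have enc_distr: "distr (M \<Otimes>\<^sub>M M) M2 (enc B) = M2" for B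
    unfolding M2_def
  proof (rule PP.PiM_eqI)
    fix C :: "nat \<Rightarrow> 'a set" assume C: "\<And>i. i \<in> {..<2 * n} \<Longrightarrow> C i \<in> sets P"
    \<comment> \<open>Sides of the preimage rectangle: the \<open>i\<close>-th coordinates of the
      two halves land at \<open>i\<close> and \<open>n + i\<close>, in an order decided by
      \<open>i \<in> B\<close>.\<close>
    define C1 where "C1 i = (if i \<in> B then C i else C (n + i))" for i
    define C2 where "C2 i = (if i \<in> B then C (n + i) else C i)" for i
    have C12: "C1 i \<in> sets P" "C2 i \<in> sets P" if "i < n" for i
      using that C[of i] C[of "n + i"] by (auto simp: C1_def C2_def)
    have "enc B -` Pi\<^sub>E {..<2 * n} C \<inter> space (M \<Otimes>\<^sub>M M) = Pi\<^sub>E {..<n} C1 \<times> Pi\<^sub>E {..<n} C2"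
    proof (intro equalityI subsetI)
      fix p assume p: "p \<in> enc B -` Pi\<^sub>E {..<2 * n} C \<inter> space (M \<Otimes>\<^sub>M M)"
      obtain X Y where xy: "p = (X, Y)" by (cases p)
      have ext: "X \<in> extensional {..<n}" "Y \<in> extensional {..<n}"
        using p by (auto simp: xy M_def space_pair_measure space_PiM PiE_def)
      have in_C: "enc B p i \<in> C i" if "i < 2 * n" for i using p that by auto
      have "X i \<in> C1 i" "Y i \<in> C2 i" if "i < n" for i
        using in_C[of i] in_C[of "n + i"] that by (auto simp: enc_def mix_def xy C1_def C2_def split: if_splits)
      then show "p \<in> Pi\<^sub>E {..<n} C1 \<times> Pi\<^sub>E {..<n} C2" using ext by (auto simp: xy PiE_def)
    next
      fix p assume p: "p \<in> Pi\<^sub>E {..<n} C1 \<times> Pi\<^sub>E {..<n} C2"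
      obtain X Y where xy: "p = (X, Y)" by (cases p)
      have XY: "X i \<in> C1 i" "Y i \<in> C2 i" if "i < n" for i using p that by (auto simp: xy)
      have spP: "X i \<in> space P" "Y i \<in> space P" if "i < n" for i
        using XY[OF that] sets.sets_into_space[OF C12(1)[OF that]] sets.sets_into_space[OF C12(2)[OF that]] by auto
      have sp: "X \<in> space M" "Y \<in> space M"
        using p spP by (auto simp: xy M_def space_PiM PiE_iff)
      have "enc B p i \<in> C i" if "i < 2 * n" for i
      proof (cases "i < n")
        case True
        then show ?thesis using XY[of i] by (auto simp: enc_def mix_def xy C1_def C2_def split: if_splits)
      next
        case False
        then have "i - n < n" "n + (i - n) = i" using that by auto
        then show ?thesis using XY[of "i - n"] False that
          by (auto simp: enc_def mix_def xy C1_def C2_def split: if_splits)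
      qed
      then show "p \<in> enc B -` Pi\<^sub>E {..<2 * n} C \<inter> space (M \<Otimes>\<^sub>M M)"
        using sp by (auto simp: xy space_pair_measure enc_def)
    qed
    moreover have "Pi\<^sub>E {..<2 * n} C \<in> sets M2" unfolding M2_def by (rule sets_PiM_I_finite) (use C in auto)
    ultimately have "emeasure (distr (M \<Otimes>\<^sub>M M) M2 (enc B)) (Pi\<^sub>E {..<2 * n} C)
       = emeasure (M \<Otimes>\<^sub>M M) (Pi\<^sub>E {..<n} C1 \<times> Pi\<^sub>E {..<n} C2)"
      by (simp add: emeasure_distr enc_m)
    also have "\<dots> = emeasure M (Pi\<^sub>E {..<n} C1) * emeasure M (Pi\<^sub>E {..<n} C2)"
      by (rule M.emeasure_pair_measure_Times) (auto simp: M_def C12 intro!: sets_PiM_I_finite)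
    also have "\<dots> = (\<Prod>i<n. emeasure P (C1 i)) * (\<Prod>i<n. emeasure P (C2 i))"
    proof -
      have "emeasure M (Pi\<^sub>E {..<n} C1) = (\<Prod>i<n. emeasure P (C1 i))"
        "emeasure M (Pi\<^sub>E {..<n} C2) = (\<Prod>i<n. emeasure P (C2 i))"
        unfolding M_def by (rule PP.emeasure_PiM; use C12 in auto)+
      then show ?thesis by simp
    qed
    also have "\<dots> = (\<Prod>i<n. emeasure P (C i) * emeasure P (C (n + i)))"
      unfolding prod.distrib[symmetric] by (rule prod.cong) (auto simp: C1_def C2_def mult.commute)
    also have "\<dots> = (\<Prod>i<n. emeasure P (C i)) * (\<Prod>i\<in>{n..<2 * n}. emeasure P (C i))"
      unfolding prod.distrib
      by (subst prod.reindex_bij_witness[of "{n..<2 * n}" "\<lambda>i. n + i" "\<lambda>i. i - n" "{..<n}" "\<lambda>i. emeasure P (C (n + i))"]) auto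
    also have "\<dots> = (\<Prod>i\<in>{..<n} \<union> {n..<2 * n}. emeasure P (C i))"
      by (rule prod.union_disjoint[symmetric]) auto
    also have "{..<n} \<union> {n..<2 * n} = {..<2 * n}" by auto
    finally show "emeasure (distr (M \<Otimes>\<^sub>M M) (Pi\<^sub>M {..<2 * n} (\<lambda>_. P)) (enc B)) (Pi\<^sub>E {..<2 * n} C)
       = (\<Prod>i\<in>{..<2 * n}. emeasure P (C i))" by (simp add: M2_def)
  qed simp_all
  have dec_enc: "dec (enc B p) = (mix B (fst p) (snd p), mix B (snd p) (fst p))" if "p \<in> space (M \<Otimes>\<^sub>M M)" for B p
    using that by (auto simp: dec_def enc_def mix_def M_def space_pair_measure space_PiM PiE_def extensional_def fun_eq_iff)
  have *: "distr (M \<Otimes>\<^sub>M M) (M \<Otimes>\<^sub>M M) (\<lambda>p. (mix B (fst p) (snd p), mix B (snd p) (fst p))) = distr M2 (M \<Otimes>\<^sub>M M) dec" for B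
  proof -
    have "distr M2 (M \<Otimes>\<^sub>M M) dec = distr (distr (M \<Otimes>\<^sub>M M) M2 (enc B)) (M \<Otimes>\<^sub>M M) dec" by (simp only: enc_distr)
    also have "\<dots> = distr (M \<Otimes>\<^sub>M M) (M \<Otimes>\<^sub>M M) (dec \<circ> enc B)" by (rule distr_distr[OF dec_m enc_m])
    also have "\<dots> = distr (M \<Otimes>\<^sub>M M) (M \<Otimes>\<^sub>M M) (\<lambda>p. (mix B (fst p) (snd p), mix B (snd p) (fst p)))"
      by (rule distr_cong) (auto simp: dec_enc)
    finally show ?thesis by simp
  qed
  have "distr (M \<Otimes>\<^sub>M M) (M \<Otimes>\<^sub>M M) (\<lambda>p. (mix A (fst p) (snd p), mix A (snd p) (fst p)))
     = distr (M \<Otimes>\<^sub>M M) (M \<Otimes>\<^sub>M M) (\<lambda>p. (mix UNIV (fst p) (snd p), mix UNIV (snd p) (fst p)))"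
    unfolding * by (rule refl)
  also have "\<dots> = M \<Otimes>\<^sub>M M" by (simp add: mix_def distr_id[unfolded id_def])
  finally show ?thesis .
qed

text \<open>A ghost sample \<open>Y\<close> is added and the coordinates of \<open>X\<close> and \<open>Y\<close> are exchanged at random; for
  fixed \<open>X\<close>, \<open>Y\<close> only a count over subsets of indices remains.\<close>

lemma symmetrization:
  fixes n :: nat and \<eta> :: real
  assumes P: "prob_space P"
  defines "M \<equiv> Pi\<^sub>M {..<n} (\<lambda>_. P)"
  assumes E: "E \<in> sets M" and Q: "Q \<in> sets (M \<Otimes>\<^sub>M M)"
    and half: "\<And>X. X \<in> E \<Longrightarrow> 1/2 \<le> measure M {Y \<in> space M. (X, Y) \<in> Q}"
    and count: "\<And>X Y. X \<in> space M \<Longrightarrow> Y \<in> space M \<Longrightarrow>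
       real (card {A \<in> Pow {..<n}. (mix A X Y, mix A Y X) \<in> Q}) \<le> \<eta> * 2 ^ n"
  shows "measure M E \<le> 2 * \<eta>"
proof -
  interpret M: prob_space M unfolding M_def by (rule prob_space_PiM) (rule P)
  interpret MM: pair_prob_space M M ..
  let ?sw = "\<lambda>A p. (mix A (fst p) (snd p), mix A (snd p) (fst p))"
  have sw_m: "?sw A \<in> M \<Otimes>\<^sub>M M \<rightarrow>\<^sub>M M \<Otimes>\<^sub>M M" for A
    unfolding M_def by (rule measurable_Pair) (rule measurable_mix)+
  \<comment> \<open>Fubini: over each \<open>X\<close> in \<open>E\<close> the section of
    \<open>Q\<close> has measure at least 1/2.\<close>
  have "ennreal (measure M E / 2) \<le> emeasure (M \<Otimes>\<^sub>M M) Q"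
  proof -
    have "ennreal (measure M E / 2) = ennreal (1/2 * measure M E)" by simp
    also have "\<dots> = ennreal (1/2) * emeasure M E"
      unfolding M.emeasure_eq_measure by (rule ennreal_mult) auto
    also have "\<dots> = (\<integral>\<^sup>+ X. ennreal (1/2) * indicator E X \<partial>M)"
      by (rule nn_integral_cmult_indicator[OF E, symmetric])
    also have "\<dots> \<le> (\<integral>\<^sup>+ X. emeasure M (Pair X -` Q) \<partial>M)"
    proof (rule nn_integral_mono)
      fix X assume X: "X \<in> space M"
      have "{Y \<in> space M. (X, Y) \<in> Q} = Pair X -` Q"
        using sets.sets_into_space[OF Q] by (auto simp: space_pair_measure)
      then show "ennreal (1/2) * indicator E X \<le> emeasure M (Pair X -` Q)"
      proof (cases "X \<in> E")
        case True
        have "1/2 \<le> measure M (Pair X -` Q)"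
          using half[OF True] \<open>{Y \<in> space M. (X, Y) \<in> Q} = Pair X -` Q\<close> by simp
        then have "ennreal (1/2) \<le> ennreal (measure M (Pair X -` Q))" by (rule ennreal_leI)
        then show ?thesis using True by (simp only: indicator_simps mult_1_right M.emeasure_eq_measure)
      qed simp
    qed
    also have "\<dots> = emeasure (M \<Otimes>\<^sub>M M) Q" by (rule M.emeasure_pair_measure_alt[OF Q, symmetric])
    finally show ?thesis .
  qed
  then have 1: "measure M E \<le> 2 * measure (M \<Otimes>\<^sub>M M) Q"
    by (simp add: MM.emeasure_eq_measure)
  have sw_measure: "measure (M \<Otimes>\<^sub>M M) Q = (\<integral>p. indicator Q (?sw A p) \<partial>(M \<Otimes>\<^sub>M M))" for A
  proof -
    have "measure (M \<Otimes>\<^sub>M M) Q = (\<integral>p. indicator Q p \<partial>distr (M \<Otimes>\<^sub>M M) (M \<Otimes>\<^sub>M M) (?sw A))"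
      using Q unfolding M_def distr_swap_coordinates[OF P] by (simp add: sets.sets_into_space Int_absorb2 flip: M_def)
    also have "\<dots> = (\<integral>p. indicator Q (?sw A p) \<partial>(M \<Otimes>\<^sub>M M))"
      by (rule integral_distr[OF sw_m]) (use Q in simp)
    finally show ?thesis .
  qed
  have int: "integrable (M \<Otimes>\<^sub>M M) (\<lambda>p. indicator Q (?sw A p) :: real)" for A
  proof (rule MM.integrable_const_bound[where B = 1])
    have "indicator Q \<in> borel_measurable (M \<Otimes>\<^sub>M M)" using Q by simp
    then show "(\<lambda>p. indicator Q (?sw A p) :: real) \<in> borel_measurable (M \<Otimes>\<^sub>M M)"
      by (rule measurable_compose[OF sw_m])
  qed (auto simp: indicator_def)
  \<comment> \<open>Exchangeability gives one identity for every \<open>A\<close>. Averaging over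
    all \<open>2 ^ n\<close> of them moves the randomness to the subsets, where \<open>count\<close>
    bounds it pointwise.\<close>
  have "2 ^ n * measure (M \<Otimes>\<^sub>M M) Q = (\<Sum>A\<in>Pow {..<n}. measure (M \<Otimes>\<^sub>M M) Q)" by (simp add: card_Pow)
  also have "\<dots> = (\<Sum>A\<in>Pow {..<n}. \<integral>p. indicator Q (?sw A p) \<partial>(M \<Otimes>\<^sub>M M))"
    using sw_measure by (intro sum.cong) auto
  also have "\<dots> = (\<integral>p. (\<Sum>A\<in>Pow {..<n}. indicator Q (?sw A p)) \<partial>(M \<Otimes>\<^sub>M M))"
    by (rule Bochner_Integration.integral_sum[symmetric]) (rule int)
  also have "\<dots> \<le> (\<integral>p. \<eta> * 2 ^ n \<partial>(M \<Otimes>\<^sub>M M))"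
  proof (rule integral_mono)
    fix p assume p: "p \<in> space (M \<Otimes>\<^sub>M M)"
    have "(\<Sum>A\<in>Pow {..<n}. indicator Q (?sw A p) :: real) = real (card {A \<in> Pow {..<n}. ?sw A p \<in> Q})"
      by (simp add: indicator_def of_bool_def sum.If_cases Int_def)
    also have "\<dots> \<le> \<eta> * 2 ^ n" using count[of "fst p" "snd p"] p by (auto simp: space_pair_measure)
    finally show "(\<Sum>A\<in>Pow {..<n}. indicator Q (?sw A p)) \<le> \<eta> * 2 ^ n" .
  qed (use int in auto)
  also have "\<dots> = \<eta> * 2 ^ n" by (simp add: MM.prob_space)
  finally have "measure (M \<Otimes>\<^sub>M M) Q \<le> \<eta>" by simp
  then show ?thesis using 1 by linarith
qed

lemma iid_sum_second_moment:
  fixes g :: "'a \<Rightarrow> real" and n :: nat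
  assumes P: "prob_space P" and g: "integrable P g" "integrable P (\<lambda>x. (g x)\<^sup>2)" and g0: "(\<integral>x. g x \<partial>P) = 0"
  defines "M \<equiv> Pi\<^sub>M {..<n} (\<lambda>_. P)"
  shows "integrable M (\<lambda>X. (\<Sum>i<n. g (X i))\<^sup>2)"
    "(\<integral>X. (\<Sum>i<n. g (X i))\<^sup>2 \<partial>M) = real n * (\<integral>x. (g x)\<^sup>2 \<partial>P)"
proof -
  interpret P: prob_space P by fact
  interpret PP: product_prob_space "\<lambda>_::nat. P" by unfold_locales
  \<comment> \<open>The factor of coordinate \<open>k\<close> in \<open>g (X i) * g (X j)\<close>,
    with constant 1 at the other coordinates. In this form integrals over \<open>Pi\<^sub>M\<close>
    factor, and off the diagonal one factor has mean 0.\<close>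
  define f where "f i j k = (if k = i \<and> k = j then (\<lambda>x. (g x)\<^sup>2) else if k = i \<or> k = j then g else (\<lambda>_. 1))" for i j k :: nat
  have fi: "integrable P (f i j k)" for i j k using g by (auto simp: f_def)
  have pf: "g (X i) * g (X j) = (\<Prod>k<n. f i j k (X k))" if "i < n" "j < n" for i j X
  proof (cases "i = j")
    case True
    have "(\<Prod>k<n. f i j k (X k)) = f i j i (X i) * (\<Prod>k\<in>{..<n} - {i}. f i j k (X k))"
      using that by (intro prod.remove) auto
    also have "(\<Prod>k\<in>{..<n} - {i}. f i j k (X k)) = 1" using True by (intro prod.neutral) (auto simp: f_def)
    finally show ?thesis using True by (simp add: f_def power2_eq_square)
  next
    case False
    have "(\<Prod>k<n. f i j k (X k)) = f i j i (X i) * (f i j j (X j) * (\<Prod>k\<in>{..<n} - {i} - {j}. f i j k (X k)))"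
      using that False by (simp add: prod.remove[of "{..<n}" i] prod.remove[of "{..<n} - {i}" j])
    also have "(\<Prod>k\<in>{..<n} - {i} - {j}. f i j k (X k)) = 1" by (intro prod.neutral) (auto simp: f_def)
    finally show ?thesis using False by (simp add: f_def)
  qed
  have int: "integrable M (\<lambda>X. g (X i) * g (X j))" if "i < n" "j < n" for i j
    unfolding pf[OF that] M_def by (rule PP.product_integrable_prod) (use fi in auto)
  have val: "(\<integral>X. g (X i) * g (X j) \<partial>M) = (if i = j then (\<integral>x. (g x)\<^sup>2 \<partial>P) else 0)" if "i < n" "j < n" for i j
  proof -
    have "(\<integral>X. g (X i) * g (X j) \<partial>M) = (\<Prod>k<n. \<integral>x. f i j k x \<partial>P)"
      unfolding pf[OF that] M_def by (rule PP.product_integral_prod) (use fi in auto)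
    also have "\<dots> = (if i = j then (\<integral>x. (g x)\<^sup>2 \<partial>P) else 0)"
    proof (cases "i = j")
      case True
      have "(\<Prod>k<n. \<integral>x. f i j k x \<partial>P) = (\<integral>x. f i j i x \<partial>P) * (\<Prod>k\<in>{..<n} - {i}. \<integral>x. f i j k x \<partial>P)"
        using that by (intro prod.remove) auto
      also have "(\<Prod>k\<in>{..<n} - {i}. \<integral>x. f i j k x \<partial>P) = 1"
        using True by (intro prod.neutral) (auto simp: f_def P.prob_space)
      finally show ?thesis using True by (simp add: f_def)
    next
      case False
      have "(\<integral>x. f i j i x \<partial>P) = 0" using False g0 by (simp add: f_def)
      then have "(\<Prod>k<n. \<integral>x. f i j k x \<partial>P) = 0" using that by (intro prod_zero) auto
      then show ?thesis using False by simp
    qed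
    finally show ?thesis .
  qed
  have sq: "(\<Sum>i<n. g (X i))\<^sup>2 = (\<Sum>i<n. \<Sum>j<n. g (X i) * g (X j))" for X
    by (simp add: power2_eq_square sum_product)
  show "integrable M (\<lambda>X. (\<Sum>i<n. g (X i))\<^sup>2)"
    unfolding sq by (intro Bochner_Integration.integrable_sum int) auto
  have "(\<integral>X. (\<Sum>i<n. g (X i))\<^sup>2 \<partial>M) = (\<Sum>i<n. \<Sum>j<n. \<integral>X. g (X i) * g (X j) \<partial>M)"
  proof -
    have "(\<integral>X. (\<Sum>i<n. g (X i))\<^sup>2 \<partial>M) = (\<Sum>i<n. \<integral>X. (\<Sum>j<n. g (X i) * g (X j)) \<partial>M)"
      unfolding sq by (rule Bochner_Integration.integral_sum) (intro Bochner_Integration.integrable_sum int; simp)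
    also have "\<dots> = (\<Sum>i<n. \<Sum>j<n. \<integral>X. g (X i) * g (X j) \<partial>M)"
      by (intro sum.cong refl Bochner_Integration.integral_sum int) auto
    finally show ?thesis .
  qed
  also have "\<dots> = (\<Sum>i<n. \<Sum>j<n. if i = j then (\<integral>x. (g x)\<^sup>2 \<partial>P) else 0)"
    by (intro sum.cong refl val) auto
  also have "\<dots> = real n * (\<integral>x. (g x)\<^sup>2 \<partial>P)" by (simp cong: if_cong)
  finally show "(\<integral>X. (\<Sum>i<n. g (X i))\<^sup>2 \<partial>M) = real n * (\<integral>x. (g x)\<^sup>2 \<partial>P)" .
qed


lemma iid_chebyshev:
  fixes g :: "'a \<Rightarrow> real" and n :: nat
  assumes P: "prob_space P" and g: "integrable P g" "integrable P (\<lambda>x. (g x)\<^sup>2)"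
    and V: "(\<integral>x. (g x)\<^sup>2 \<partial>P) \<le> V" and s: "s > 0"
  defines "M \<equiv> Pi\<^sub>M {..<n} (\<lambda>_. P)"
  shows "measure M {X \<in> space M. \<bar>(\<Sum>i<n. g (X i)) - real n * (\<integral>x. g x \<partial>P)\<bar> > s} \<le> real n * V / s\<^sup>2"
proof -
  interpret P: prob_space P by fact
  interpret M: prob_space M unfolding M_def by (rule prob_space_PiM) (rule P)
  define h where "h x = g x - (\<integral>x. g x \<partial>P)" for x
  have h: "integrable P h" "integrable P (\<lambda>x. (h x)\<^sup>2)" "(\<integral>x. h x \<partial>P) = 0"
    unfolding h_def using g by (auto simp: power2_diff P.prob_space)
  have hV: "(\<integral>x. (h x)\<^sup>2 \<partial>P) \<le> V"
    using P.variance_eq[OF g] V unfolding h_def by (smt (verit) zero_le_power2)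
  let ?S = "\<lambda>X. \<Sum>i<n. h (X i)"
  have S: "(\<Sum>i<n. g (X i)) - real n * (\<integral>x. g x \<partial>P) = ?S X" for X by (simp add: h_def sum_subtractf)
  have Sm: "?S \<in> borel_measurable M"
  proof (rule borel_measurable_sum)
    fix i assume "i \<in> {..<n}"
    then have "(\<lambda>X. X i) \<in> M \<rightarrow>\<^sub>M P" unfolding M_def by (intro measurable_component_singleton)
    then show "(\<lambda>X. h (X i)) \<in> borel_measurable M" by (rule measurable_compose[OF _ borel_measurable_integrable[OF h(1)]])
  qed
  note mom = iid_sum_second_moment[OF P h, of n, folded M_def]
  have "measure M {X \<in> space M. \<bar>?S X\<bar> > s} \<le> measure M {X \<in> space M. s\<^sup>2 \<le> (?S X)\<^sup>2}"
  proof (rule M.finite_measure_mono)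
    show "{X \<in> space M. s < \<bar>?S X\<bar>} \<subseteq> {X \<in> space M. s\<^sup>2 \<le> (?S X)\<^sup>2}"
      using s by (auto simp: abs_le_square_iff[symmetric])
  qed (use Sm in measurable)
  also have "\<dots> \<le> (\<integral>X. (?S X)\<^sup>2 \<partial>M) / s\<^sup>2"
    by (rule integral_Markov_inequality_measure[where A = "{}"]) (use mom(1) s in auto)
  also have "\<dots> \<le> real n * V / s\<^sup>2"
    unfolding mom(2) using hV by (intro divide_right_mono mult_left_mono) auto
  finally show ?thesis unfolding S .
qed

lemma iid_markov:
  fixes g :: "'a \<Rightarrow> real" and n :: nat
  assumes P: "prob_space P" and g: "integrable P g" "\<And>x. 0 \<le> g x" and s: "s > 0"
  defines "M \<equiv> Pi\<^sub>M {..<n} (\<lambda>_. P)"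
  shows "measure M {X \<in> space M. (\<Sum>i<n. g (X i)) > s} \<le> real n * (\<integral>x. g x \<partial>P) / s"
proof -
  interpret P: prob_space P by fact
  interpret M: prob_space M unfolding M_def by (rule prob_space_PiM) (rule P)
  have d: "distr M P (\<lambda>X. X i) = P" if "i < n" for i
    unfolding M_def by (rule distr_PiM_component[of "{..<n}" "\<lambda>_. P"]) (use P that in auto)
  have m: "(\<lambda>X. X i) \<in> M \<rightarrow>\<^sub>M P" if "i < n" for i
    unfolding M_def by (rule measurable_component_singleton) (use that in simp)
  have int: "integrable M (\<lambda>X. g (X i))" "(\<integral>X. g (X i) \<partial>M) = (\<integral>x. g x \<partial>P)" if "i < n" for i
    using integrable_distr[OF m[OF that], of g] integral_distr[OF m[OF that], of g] g(1) d[OF that] by auto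
  have "measure M {X \<in> space M. (\<Sum>i<n. g (X i)) > s} \<le> measure M {X \<in> space M. s \<le> (\<Sum>i<n. g (X i))}"
  proof (rule M.finite_measure_mono)
    have "(\<lambda>X. \<Sum>i<n. g (X i)) \<in> borel_measurable M"
      by (intro borel_measurable_sum borel_measurable_integrable int(1)) auto
    then show "{X \<in> space M. s \<le> (\<Sum>i<n. g (X i))} \<in> sets M" by measurable
  qed auto
  also have "\<dots> \<le> (\<integral>X. (\<Sum>i<n. g (X i)) \<partial>M) / s"
    by (rule integral_Markov_inequality_measure[where A = "{}"])
       (use int(1) g s in \<open>auto intro!: Bochner_Integration.integrable_sum sum_nonneg\<close>)
  also have "(\<integral>X. (\<Sum>i<n. g (X i)) \<partial>M) = real n * (\<integral>x. g x \<partial>P)"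
    by (subst Bochner_Integration.integral_sum) (use int in auto)
  finally show ?thesis .
qed

text \<open>If no index set works for \<open>X\<close>, then any two good samples leave at least \<open>j\<close> coordinates of
  \<open>X\<close> uncovered, which Talagrand's inequality makes unlikely.\<close>

lemma subset_selection:
  fixes g :: "'r \<Rightarrow> 'a \<Rightarrow> real" and n j :: nat and \<eta> :: real
  assumes P: "prob_space P" and F: "finite F"
    and g: "\<And>r. r \<in> F \<Longrightarrow> g r \<in> borel_measurable P" "\<And>r x. r \<in> F \<Longrightarrow> 0 \<le> g r x"
    and \<eta>: "0 \<le> \<eta>" "1 \<le> \<eta> ^ 3 * 2 ^ j"
  defines "M \<equiv> Pi\<^sub>M {..<n} (\<lambda>_. P)"
  assumes half: "1/2 \<le> measure M {X \<in> space M. \<forall>r\<in>F. (\<Sum>i<n. g r (X i)) \<le> m r}"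
  shows "measure M {X \<in> space M. \<not> (\<exists>I\<in>Pow {..<n}. card ({..<n} - I) < j \<and> (\<forall>r\<in>F. (\<Sum>i\<in>I. g r (X i)) \<le> 2 * m r))} \<le> 2 * \<eta>"
proof -
  interpret M: prob_space M unfolding M_def by (rule prob_space_PiM) (rule P)
  have meas: "(\<lambda>X. \<Sum>i\<in>I. g r (X i)) \<in> borel_measurable M" if "r \<in> F" "I \<subseteq> {..<n}" for r I
  proof (rule borel_measurable_sum)
    fix i assume "i \<in> I"
    then have "(\<lambda>X. X i) \<in> M \<rightarrow>\<^sub>M P" unfolding M_def using that by (intro measurable_component_singleton) auto
    then show "(\<lambda>X. g r (X i)) \<in> borel_measurable M" by (rule measurable_compose[OF _ g(1)[OF that(1)]])
  qed
  define E where "E = {X \<in> space M. \<not> (\<exists>I\<in>Pow {..<n}. card ({..<n} - I) < j \<and> (\<forall>r\<in>F. (\<Sum>i\<in>I. g r (X i)) \<le> 2 * m r))}"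
  define G where "G = {X \<in> space M. \<forall>r\<in>F. (\<Sum>i<n. g r (X i)) \<le> m r}"
  have le_m: "{X \<in> space M. (\<Sum>i\<in>I. g r (X i)) \<le> c} \<in> sets M" if "r \<in> F" "I \<subseteq> {..<n}" for r I c
    using meas[OF that] by measurable
  have "E \<in> sets M"
    unfolding E_def by (intro sets.sets_Collect_neg sets.sets_Collect_finite_Ex sets.sets_Collect_conj sets.sets_Collect_const
        sets.sets_Collect_finite_All F le_m) auto
  moreover have Gm: "G \<in> sets M"
    unfolding G_def by (intro sets.sets_Collect_finite_All F le_m) auto
  have "E \<times> G \<in> sets (M \<Otimes>\<^sub>M M)" using calculation Gm by auto
  have "measure M E \<le> 2 * \<eta>"
    unfolding M_def
  proof (rule symmetrization[OF P, where Q = "E \<times> G"], fold M_def)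
    fix X assume X: "X \<in> E"
    have "{Y \<in> space M. (X, Y) \<in> E \<times> G} = G" using X by (auto simp: G_def)
    then show "1/2 \<le> measure M {Y \<in> space M. (X, Y) \<in> E \<times> G}" using half by (simp add: G_def)
  next
    fix X Y assume XY: "X \<in> space M" "Y \<in> space M"
    let ?A = "{A \<in> Pow {..<n}. mix A X Y \<in> G}"
    let ?C = "{A \<in> Pow {..<n}. (mix A X Y, mix A Y X) \<in> E \<times> G}"
    \<comment> \<open>Complementing \<open>A\<close> within the index range exchanges the two
      samples; this supplies the antipodal hypothesis of
      \<open>card_uncovered_antipodal\<close>.\<close>
    have compl: "mix ({..<n} - A) X Y = mix A Y X" if "A \<subseteq> {..<n}" for A
      using XY that by (auto simp: mix_def fun_eq_iff M_def space_PiM PiE_iff extensional_def)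
    have "2 ^ j * real (card ?C) ^ 3 \<le> 8 ^ card {..<n}"
    proof (rule card_uncovered_antipodal[where A = ?A])
      fix A B C assume A: "A \<in> ?C" and B: "B \<in> ?A" and C: "C \<in> ?A"
      let ?I = "{..<n} - uncovered {..<n} A B C"
      have "(\<Sum>i\<in>?I. g r (mix A X Y i)) \<le> 2 * m r" if r: "r \<in> F" for r
      proof -
        \<comment> \<open>At a covered coordinate the value is shared with one of two good samples.
          Since \<open>g r\<close> is nonnegative, their full sums dominate, which is the origin of
          the factor 2.\<close>
        have "(\<Sum>i\<in>?I. g r (mix A X Y i)) \<le> (\<Sum>i\<in>?I. g r (mix B X Y i) + g r (mix C X Y i))"
        proof (rule sum_mono)
          fix i assume "i \<in> ?I"
          then have "mix A X Y i = mix B X Y i \<or> mix A X Y i = mix C X Y i"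
            by (auto simp: uncovered_def mix_def)
          then show "g r (mix A X Y i) \<le> g r (mix B X Y i) + g r (mix C X Y i)"
            using g(2)[OF r] by (smt (verit))
        qed
        also have "\<dots> \<le> (\<Sum>i<n. g r (mix B X Y i) + g r (mix C X Y i))"
          by (rule sum_mono2) (use g(2)[OF r] in \<open>auto intro: add_nonneg_nonneg\<close>)
        also have "\<dots> \<le> m r + m r"
          unfolding sum.distrib using B C r by (intro add_mono) (auto simp: G_def)
        finally show ?thesis by simp
      qed
      then have sums: "\<forall>r\<in>F. (\<Sum>i\<in>?I. g r (mix A X Y i)) \<le> 2 * m r" by blast
      have I: "{..<n} - ?I = uncovered {..<n} A B C" "?I \<in> Pow {..<n}" by (auto simp: uncovered_def)
      have "\<not> (card ({..<n} - ?I) < j \<and> (\<forall>r\<in>F. (\<Sum>i\<in>?I. g r (mix A X Y i)) \<le> 2 * m r))"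
        using A I(2) unfolding E_def by blast
      then show "j \<le> card (uncovered {..<n} A B C)" using sums I(1) by simp
    qed (auto simp: compl)
    also have "\<dots> \<le> (\<eta> ^ 3 * 2 ^ j) * 8 ^ n" using \<eta> by simp
    also have "\<dots> = 2 ^ j * (\<eta> * 2 ^ n) ^ 3" 
    proof -
      have "((2::real) ^ n) ^ 3 = 8 ^ n" 
      proof -
        have "((2::real) ^ n) ^ 3 = (2 ^ 3) ^ n" by (simp only: power_mult[symmetric] mult.commute)
        then show ?thesis by simp
      qed
      then show ?thesis by (simp add: power_mult_distrib)
    qed
    finally have "real (card ?C) ^ 3 \<le> (\<eta> * 2 ^ n) ^ 3" by simp
    then show "real (card ?C) \<le> \<eta> * 2 ^ n" using power_mono_iff[of "real (card ?C)" "\<eta> * 2 ^ n" 3] \<eta> by simp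
  qed (use calculation \<open>E \<times> G \<in> sets (M \<Otimes>\<^sub>M M)\<close> in \<open>auto simp: M_def\<close>)
  then show ?thesis by (simp add: E_def)
qed

section \<open>Truncated samples\<close>

lemma mix_diff: "f (mix A X Y i) - f (mix A Y X i) = sg A i * (f (X i) - f (Y i))" for f :: "'a \<Rightarrow> real"
  by (simp add: mix_def sg_def)

lemma mix_sum: "f (mix A X Y i) + f (mix A Y X i) = f (X i) + f (Y i)" for f :: "'a \<Rightarrow> real"
  by (simp add: mix_def)

text \<open>Closes the self-bounding estimates below, where an unknown deviation reappears in its
  own variance.\<close>

lemma quadratic_bound:
  fixes x p q :: real
  assumes "x\<^sup>2 \<le> p * x + q\<^sup>2" "0 \<le> p" "0 \<le> q"
  shows "x \<le> p + q"
proof (rule ccontr)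
  assume "\<not> ?thesis"
  then have x: "x > p + q" by simp
  then have "q * q \<le> q * x" using assms by (intro mult_left_mono) auto
  moreover have "(p + q) * x < x * x" using x assms by (intro mult_strict_right_mono) auto
  ultimately show False using assms(1) by (simp add: power2_eq_square distrib_right)
qed

lemma exp_minus_5: "exp (- 5 :: real) \<le> 1 / 20"
proof -
  have "(2::real) ^ 5 \<le> exp 1 ^ 5" using exp_ge_add_one_self[of 1] by (intro power_mono) auto
  also have "\<dots> = exp 5" by (simp flip: exp_of_nat_mult)
  finally show ?thesis by (simp add: exp_minus divide_simps)
qed

text \<open>\<open>R\<close> is the square of the truncation radius and \<open>\<theta>\<close> the square of the clipping level.  For
  \<open>\<beta> > 1\<close> only upper bounds matter and \<open>\<theta> = 0\<close>, so that nothing is clipped away from the excess.\<close>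

locale truncated_sample =
  fixes P :: "'a measure" and y :: "'a \<Rightarrow> nat \<Rightarrow> real" and bad :: "'a \<Rightarrow> bool"
    and d n :: nat and \<alpha> \<beta> \<theta> R L :: real
  assumes P: "prob_space P" and d: "d \<ge> 1" and n: "n \<ge> 1" and \<alpha>: "\<alpha> > 0" and \<beta>: "\<beta> > 0" and L: "L \<ge> 0"
    and y_meas: "\<And>j. j < d \<Longrightarrow> (\<lambda>x. y x j) \<in> borel_measurable P"
    and bad_meas: "{x \<in> space P. bad x} \<in> sets P"
    and y_norm: "\<And>x. inner_vec d (y x) (y x) \<le> R"
    and R: "R = 160 * real d * min \<beta> 1 / \<alpha>"
    and second: "\<And>v. (\<integral>x. (inner_vec d (y x) v)\<^sup>2 \<partial>P) \<le> inner_vec d v v"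
    and clipped: "\<And>u. inner_vec d u u \<le> 1 \<Longrightarrow>
       inner_vec d u u - 3 * \<beta> \<le> (\<integral>x. min ((inner_vec d (y x) u)\<^sup>2) \<theta> \<partial>P)"
    and bias: "\<And>v. (\<integral>x. inner_vec d (y x) v \<partial>P)\<^sup>2 \<le> 4 * \<alpha> * \<beta> * inner_vec d v v"
    and bad_prob: "measure P {x \<in> space P. bad x} \<le> \<alpha> / 80"
    and \<theta>: "0 \<le> \<theta>" "\<theta> \<le> \<beta> / \<alpha>" "\<theta> = 0 \<or> \<beta> \<le> 1"
    and large1: "real d * max 1 (ln (real d)) + L \<le> \<alpha> * \<beta> * real n"
    and large2: "200 * (1 + L) \<le> \<alpha> * real n"
begin

abbreviation "M \<equiv> Pi\<^sub>M {..<n} (\<lambda>_. P)"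

definition psi :: "(nat \<Rightarrow> real) \<Rightarrow> 'a \<Rightarrow> real" where
  "psi u x = min ((inner_vec d (y x) u)\<^sup>2) \<theta>"

definition excess :: "(nat \<Rightarrow> real) \<Rightarrow> 'a \<Rightarrow> real" where
  "excess u x = (inner_vec d (y x) u)\<^sup>2 - psi u x"

sublocale P: prob_space P by (rule P)

sublocale M: prob_space M by (rule prob_space_PiM) (rule P)

lemma psi_bounds: "0 \<le> psi u x" "psi u x \<le> \<theta>" "psi u x \<le> (inner_vec d (y x) u)\<^sup>2" "0 \<le> excess u x"
  using \<theta> by (auto simp: psi_def excess_def)

lemma d_le: "real d \<le> \<alpha> * \<beta> * real n" "1 + L \<le> \<alpha> * \<beta> * real n" "real d + L \<le> \<alpha> * \<beta> * real n"
proof -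
  have "real d * 1 \<le> real d * max 1 (ln (real d))" by (intro mult_left_mono) auto
  then show "real d + L \<le> \<alpha> * \<beta> * real n" using large1 by linarith
  then show "real d \<le> \<alpha> * \<beta> * real n" "1 + L \<le> \<alpha> * \<beta> * real n" using L d by auto
qed

lemma \<theta>\<alpha>: "\<theta> * \<alpha> \<le> \<beta>"
  using \<theta> \<alpha> by (simp add: field_simps)

lemma inner_meas: "(\<lambda>x. inner_vec d (y x) v) \<in> borel_measurable P"
  unfolding inner_vec_def using y_meas by (intro borel_measurable_sum borel_measurable_times) auto

lemma norm_meas: "(\<lambda>x. inner_vec d (y x) (y x)) \<in> borel_measurable P"
  unfolding inner_vec_def using y_meas by (intro borel_measurable_sum borel_measurable_times) auto

lemma inner_sq_meas: "(\<lambda>x. (inner_vec d (y x) v)\<^sup>2) \<in> borel_measurable P"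
  using inner_meas by measurable

lemma psi_meas: "psi u \<in> borel_measurable P"
  unfolding psi_def using inner_sq_meas by measurable

lemma excess_meas: "excess u \<in> borel_measurable P"
  unfolding excess_def using inner_sq_meas psi_meas by measurable

lemma inner_sq_le: "(inner_vec d (y x) v)\<^sup>2 \<le> R * inner_vec d v v"
  using inner_vec_Cauchy_Schwarz[of d "y x" v] mult_right_mono[OF y_norm[of x], of "inner_vec d v v"] by simp

lemma R0: "0 \<le> R"
  using y_norm inner_vec_self_nonneg by (meson order_trans)

lemma inner_sq_int: "integrable P (\<lambda>x. (inner_vec d (y x) v)\<^sup>2)"
  by (rule P.integrable_const_bound[where B = "R * inner_vec d v v"]) (use inner_sq_le inner_sq_meas in auto)

lemma inner_int: "integrable P (\<lambda>x. inner_vec d (y x) v)"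
  by (rule P.square_integrable_imp_integrable[OF inner_meas inner_sq_int])

lemma psi_int: "integrable P (psi u)"
  by (rule P.integrable_const_bound[where B = \<theta>]) (use psi_bounds psi_meas in auto)

lemma psi_expectation_le: "(\<integral>x. psi u x \<partial>P) \<le> inner_vec d u u"
  using second[of u] integral_mono[OF psi_int inner_sq_int psi_bounds(3), of u] by linarith

lemma psi_expectation_ge: "inner_vec d u u \<le> 1 \<Longrightarrow> inner_vec d u u - 3 * \<beta> \<le> (\<integral>x. psi u x \<partial>P)"
  using clipped unfolding psi_def .

lemma sum_meas:
  fixes f :: "'a \<Rightarrow> real"
  assumes "f \<in> borel_measurable P" "I \<subseteq> {..<n}"
  shows "(\<lambda>X. \<Sum>i\<in>I. f (X i)) \<in> borel_measurable M"
proof (rule borel_measurable_sum)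
  fix i assume "i \<in> I"
  then have "(\<lambda>X. X i) \<in> M \<rightarrow>\<^sub>M P" using assms by (intro measurable_component_singleton) auto
  then show "(\<lambda>X. f (X i)) \<in> borel_measurable M" by (rule measurable_compose[OF _ assms(1)])
qed

section \<open>Concentration of the clipped energies\<close>

definition dev :: "('a \<Rightarrow> real) \<Rightarrow> (nat \<Rightarrow> 'a) \<Rightarrow> real" where
  "dev f X = \<bar>(\<Sum>i<n. f (X i)) - real n * (\<integral>x. f x \<partial>P)\<bar>"

lemma dev_meas: "f \<in> borel_measurable P \<Longrightarrow> dev f \<in> borel_measurable M"
  unfolding dev_def using sum_meas[of f "{..<n}"]
  by (intro borel_measurable_abs borel_measurable_diff borel_measurable_const) auto

lemma dev_sets:
  assumes "f \<in> borel_measurable P"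
  shows "{X \<in> space M. dev f X \<le> c} \<in> sets M" "{X \<in> space M. dev f X > c} \<in> sets M"
  using dev_meas[OF assms] by measurable

text \<open>Values and second moments are at most \<theta>, hence at most \<beta>/\<alpha>. With
  \<open>large1\<close> this allows a Rademacher tail of order \<open>L + d\<close>, enough for a
  union over \<open>exp (13 * d)\<close> directions. The variance of the exchanged sums is bounded
  by the totals themselves, which gives a quadratic inequality for the deviation.\<close>

lemma clipped_deviation:
  "measure M {X \<in> space M. \<exists>u\<in>net d. dev (psi u) X > 460 * \<beta> * real n} \<le> exp (- L) / 10"
proof (cases "\<theta> = 0")
  case True
  have "psi u = (\<lambda>_. 0)" for u unfolding psi_def by (auto simp: True fun_eq_iff)
  then have e: "{X \<in> space M. \<exists>u\<in>net d. dev (psi u) X > 460 * \<beta> * real n} = {}"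
    using mult_nonneg_nonneg[of \<beta> "real n"] \<beta> by (auto simp: dev_def not_less[symmetric])
  show ?thesis unfolding e by simp
next
  case False
  then have \<beta>1: "\<beta> \<le> 1" and \<theta>p: "\<theta> > 0" using \<theta> by auto
  define bn where "bn = \<beta> * real n"
  have bn: "bn > 0" using \<beta> n by (simp add: bn_def)
  define A B where "A u = {X \<in> space M. dev (psi u) X > 460 * bn}"
    and "B u = {Y \<in> space M. dev (psi u) Y \<le> 2 * bn}" for u
  have AB: "A u \<in> sets M" "B u \<in> sets M" for u
    unfolding A_def B_def using dev_sets[OF psi_meas] by auto
  \<comment> \<open>The \<open>9 * d\<close> is fixed by the final count
    \<open>13 d - 2 p \<le> - 5 d - 2 L\<close>: it pays for the net and leaves
    \<open>exp (- 5)\<close> against the factor 2 of symmetrization.\<close>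
  define p where "p = nat \<lceil>L\<rceil> + 9 * d"
  have p: "p \<ge> 1" "real p \<le> 10 * (\<alpha> * \<beta> * real n)" "real p \<ge> L + 9 * real d"
  proof -
    have "real (nat \<lceil>L\<rceil>) \<le> L + 1" "real (nat \<lceil>L\<rceil>) \<ge> L" using L by linarith+
    moreover have "real p = real (nat \<lceil>L\<rceil>) + 9 * real d" "real d \<ge> 1" using d by (simp_all add: p_def)
    ultimately show "real p \<le> 10 * (\<alpha> * \<beta> * real n)" "real p \<ge> L + 9 * real d"
      using d_le(3) L by linarith+
  qed (use d in \<open>simp add: p_def\<close>)
  define E where "E = (\<Union>u\<in>net d. A u)"
  define Q where "Q = (\<Union>u\<in>net d. A u \<times> B u)"
  have Em: "E \<in> sets M" unfolding E_def using AB finite_net by (intro sets.finite_UN) auto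
  have Qm: "Q \<in> sets (M \<Otimes>\<^sub>M M)" unfolding Q_def using AB finite_net by (intro sets.finite_UN) auto
  have half: "1/2 \<le> measure M {Y \<in> space M. (X, Y) \<in> Q}" if X: "X \<in> E" for X
  proof -
    obtain u where u: "u \<in> net d" "X \<in> A u" using X by (auto simp: E_def)
    have "measure M {Y \<in> space M. dev (psi u) Y > 2 * bn} \<le> real n * \<theta> / (2 * bn)\<^sup>2"
      unfolding dev_def
    proof (rule iid_chebyshev[OF P psi_int])
      show "integrable P (\<lambda>x. (psi u x)\<^sup>2)"
        by (rule P.integrable_const_bound[where B = "\<theta>\<^sup>2"])
          (use psi_bounds psi_meas in \<open>auto intro!: power_mono borel_measurable_power\<close>)
      then have "(\<integral>x. (psi u x)\<^sup>2 \<partial>P) \<le> (\<integral>x. \<theta> * psi u x \<partial>P)"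
        by (rule integral_mono) (use psi_int psi_bounds in \<open>auto simp: power2_eq_square intro!: mult_right_mono\<close>)
      also have "\<dots> \<le> \<theta> * 1"
        using psi_expectation_le[of u] net_le_1[OF u(1)] \<theta>p by (simp del: mult_1_right) 
      finally show "(\<integral>x. (psi u x)\<^sup>2 \<partial>P) \<le> \<theta>" by simp
    qed (use bn in auto)
    also have "\<dots> \<le> 1/2"
    proof -
      have "real n * \<theta> * 1 \<le> real n * \<theta> * (\<alpha> * \<beta> * real n)"
        using d_le(2) L \<theta>p by (intro mult_left_mono) auto
      also have "\<dots> = (\<theta> * \<alpha>) * (real n * real n * \<beta>)" by (simp add: mult_ac)
      also have "\<dots> \<le> \<beta> * (real n * real n * \<beta>)" using \<theta>\<alpha> \<beta> by (intro mult_right_mono) auto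
      also have "\<dots> = bn\<^sup>2" by (simp add: bn_def power2_eq_square)
      finally have "real n * \<theta> \<le> bn\<^sup>2" by simp
      also have "bn\<^sup>2 \<le> 1/2 * (2 * bn)\<^sup>2" by (simp add: power_mult_distrib)
      finally show ?thesis using bn by (subst pos_divide_le_eq) auto
    qed
    finally have 1: "measure M {Y \<in> space M. dev (psi u) Y > 2 * bn} \<le> 1/2" .
    have "B u = space M - {Y \<in> space M. dev (psi u) Y > 2 * bn}" by (auto simp: B_def)
    then have "measure M (B u) = 1 - measure M {Y \<in> space M. dev (psi u) Y > 2 * bn}"
      using dev_sets(2)[OF psi_meas] by (simp add: M.prob_compl)
    then have "1/2 \<le> measure M (B u)" using 1 by simp
    also have "\<dots> \<le> measure M {Y \<in> space M. (X, Y) \<in> Q}"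
    proof (rule M.finite_measure_mono)
      show "B u \<subseteq> {Y \<in> space M. (X, Y) \<in> Q}" using u by (auto simp: Q_def B_def)
      have "{Y \<in> space M. (X, Y) \<in> Q} = Pair X -` Q" using sets.sets_into_space[OF Qm] by (auto simp: space_pair_measure)
      then show "{Y \<in> space M. (X, Y) \<in> Q} \<in> sets M" using sets_Pair1[OF Qm] by simp
    qed
    finally show ?thesis .
  qed
  have "measure M E \<le> 2 * (exp (13 * real d) * exp (- 2 * real p))"
  proof (rule symmetrization[OF P Em Qm half])
    fix X Y assume XY: "X \<in> space M" "Y \<in> space M"
    define V where "V u = (\<Sum>i<n. (psi u (X i) - psi u (Y i))\<^sup>2)" for u
    let ?C = "\<lambda>u. {S \<in> Pow {..<n}. (\<Sum>i<n. sg S i * (psi u (X i) - psi u (Y i)))\<^sup>2 > 40 * real p * V u}"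
    have "{S \<in> Pow {..<n}. (mix S X Y, mix S Y X) \<in> Q} \<subseteq> (\<Union>u\<in>net d. ?C u)"
    proof
      fix S assume S: "S \<in> {S \<in> Pow {..<n}. (mix S X Y, mix S Y X) \<in> Q}"
      then obtain u where u: "u \<in> net d" "dev (psi u) (mix S X Y) > 460 * bn" "dev (psi u) (mix S Y X) \<le> 2 * bn"
        by (auto simp: Q_def A_def B_def)
      define a b where "a = (\<Sum>i<n. psi u (mix S X Y i))" and "b = (\<Sum>i<n. psi u (mix S Y X i))"
      have ab0: "0 \<le> a" "0 \<le> b" using psi_bounds by (auto simp: a_def b_def intro!: sum_nonneg)
      have diff: "a - b = (\<Sum>i<n. sg S i * (psi u (X i) - psi u (Y i)))"
        by (simp add: a_def b_def mix_diff flip: sum_subtractf)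
      have "S \<in> ?C u"
      proof (rule ccontr)
        assume "S \<notin> ?C u"
        then have le: "(a - b)\<^sup>2 \<le> 40 * real p * V u" using S by (auto simp: diff not_less)
        \<comment> \<open>The conditional variance is controlled by \<open>a + b\<close>, a total
          that the exchange leaves unchanged. The ghost total \<open>b\<close> is
          \<open>O(n)\<close>, and \<open>a\<close> exceeds it by at most the unknown difference
          \<open>x\<close>.\<close>
        have "V u \<le> (\<Sum>i<n. \<theta> * (psi u (X i) + psi u (Y i)))"
          unfolding V_def
        proof (rule sum_mono)
          fix i
          have "\<bar>psi u (X i) - psi u (Y i)\<bar> * \<bar>psi u (X i) - psi u (Y i)\<bar> \<le> \<theta> * (psi u (X i) + psi u (Y i))"
            using psi_bounds[of u "X i"] psi_bounds[of u "Y i"] by (intro mult_mono) auto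
          then show "(psi u (X i) - psi u (Y i))\<^sup>2 \<le> \<theta> * (psi u (X i) + psi u (Y i))"
            by (simp add: power2_eq_square)
        qed
        also have "\<dots> = \<theta> * (a + b)"
          by (simp add: a_def b_def mix_sum sum_distrib_left flip: sum.distrib)
        finally have "V u \<le> \<theta> * (a + b)" .
        then have "40 * real p * V u \<le> 40 * (10 * (\<alpha> * \<beta> * real n)) * (\<theta> * (a + b))"
          using p ab0 \<theta>p \<alpha> \<beta> by (intro mult_mono mult_left_mono) (auto simp: V_def intro!: sum_nonneg)
        also have "\<dots> = 400 * ((\<theta> * \<alpha>) * (bn * (a + b)))" by (simp add: bn_def mult_ac)
        also have "\<dots> \<le> 400 * (\<beta> * (bn * (a + b)))"
          using \<theta>\<alpha> bn ab0 by (intro mult_left_mono mult_right_mono) auto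
        finally have 1: "(a - b)\<^sup>2 \<le> 400 * (\<beta> * (bn * (a + b)))" using le by linarith
        have E1: "real n * (\<integral>x. psi u x \<partial>P) \<le> real n"
          using psi_expectation_le[of u] net_le_1[OF u(1)] by (simp add: mult_left_le)
        have bnn: "bn \<le> real n" using \<beta>1 by (simp add: bn_def mult_left_le_one_le \<beta> less_imp_le)
        have b3: "b \<le> 3 * real n" using u(3) E1 bnn unfolding dev_def b_def by linarith
        define x where "x = \<bar>a - b\<bar>"
        have "a + b \<le> 6 * real n + x" using b3 by (simp add: x_def)
        then have "x\<^sup>2 \<le> 400 * (\<beta> * (bn * (6 * real n + x)))"
          using 1 \<beta> bn by (simp add: x_def) (smt (verit) mult_left_mono)
        also have "\<dots> = 2400 * bn\<^sup>2 + 400 * (\<beta> * (bn * x))" by (simp add: bn_def power2_eq_square algebra_simps)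
        also have "\<beta> * (bn * x) \<le> 1 * (bn * x)" using \<beta>1 bn by (intro mult_right_mono) (auto simp: x_def)
        also have "2400 * bn\<^sup>2 \<le> (49 * bn)\<^sup>2" by (simp add: power_mult_distrib)
        finally have "x\<^sup>2 \<le> (400 * bn) * x + (49 * bn)\<^sup>2" by simp
        then have "x \<le> 400 * bn + 49 * bn" by (rule quadratic_bound) (use bn in auto)
        then show False using u(2,3) bn unfolding dev_def x_def a_def[symmetric] b_def[symmetric] by linarith
      qed
      then show "S \<in> (\<Union>u\<in>net d. ?C u)" using u(1) by blast
    qed
    then have "card {S \<in> Pow {..<n}. (mix S X Y, mix S Y X) \<in> Q} \<le> card (\<Union>u\<in>net d. ?C u)"
      using finite_net by (intro card_mono) auto
    also have "\<dots> \<le> (\<Sum>u\<in>net d. card (?C u))" by (rule card_UN_le[OF finite_net])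
    finally have "card {S \<in> Pow {..<n}. (mix S X Y, mix S Y X) \<in> Q} \<le> (\<Sum>u\<in>net d. card (?C u))" .
    then have "real (card {S \<in> Pow {..<n}. (mix S X Y, mix S Y X) \<in> Q}) \<le> real (\<Sum>u\<in>net d. card (?C u))"
      by (rule of_nat_mono)
    also have "\<dots> = (\<Sum>u\<in>net d. real (card (?C u)))" by (rule of_nat_sum)
    also have "\<dots> \<le> (\<Sum>u\<in>net d. 2 ^ card {..<n} * exp (- 2 * real p))"
      by (intro sum_mono rademacher_scalar_tail p(1)) (simp_all add: V_def)
    also have "\<dots> = real (card (net d)) * (2 ^ n * exp (- 2 * real p))" by simp
    also have "\<dots> \<le> exp (13 * real d) * (2 ^ n * exp (- 2 * real p))"
      by (intro mult_right_mono card_net_le) auto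
    finally show "real (card {S \<in> Pow {..<n}. (mix S X Y, mix S Y X) \<in> Q}) \<le> exp (13 * real d) * exp (- 2 * real p) * 2 ^ n"
      by (simp only: mult_ac)
  qed
  also have "exp (13 * real d) * exp (- 2 * real p) \<le> exp (- 5) * exp (- L)"
    unfolding exp_add[symmetric] using p(3) L d by simp
  also have "2 * (exp (- 5) * exp (- L)) \<le> exp (- L) / 10"
    using mult_right_mono[OF exp_minus_5, of "exp (- L)"] by simp
  finally have "measure M E \<le> exp (- L) / 10" by simp
  moreover have "E = {X \<in> space M. \<exists>u\<in>net d. dev (psi u) X > 460 * \<beta> * real n}"
    by (auto simp: E_def A_def bn_def mult.assoc)
  ultimately show ?thesis by simp
qed

section \<open>Energies without clipping, at constant probability\<close>

abbreviation "energy u x \<equiv> (inner_vec d (y x) u)\<^sup>2"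

lemma energy_expectation_le: "u \<in> net d \<Longrightarrow> (\<integral>x. energy u x \<partial>P) \<le> 1"
  using second[of u] net_le_1[of u d] by linarith

lemma sum_energy_le_net:
  assumes "\<And>u. u \<in> net d \<Longrightarrow> (\<Sum>i\<in>J. energy u (X i)) \<le> m"
  shows "(\<Sum>i\<in>J. energy v (X i)) \<le> 2 * m * inner_vec d v v"
  using qform_le_twice_net[OF d, of J "\<lambda>i. y (X i)" 0 m v] assms
  by (simp add: qform_def abs_of_nonneg sum_nonneg)

text \<open>The operator bound presupposes a bound for the total energy in all directions, which is
  what is being estimated. The event therefore singles out a direction \<open>u\<close> of maximal
  deviation \<open>D\<close>: all other directions are bounded through \<open>D\<close>, and
  \<open>D\<close> through the square root \<open>q\<close> of the variance level, so that a
  quadratic inequality in \<open>q\<close> closes the argument.\<close>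

lemma energy_deviation:
  "measure M {X \<in> space M. \<exists>u\<in>net d. dev (energy u) X > 1600000 * \<beta> * real n} \<le> 1/4"
proof -
  define bn where "bn = \<beta> * real n"
  have bn: "bn > 0" using \<beta> n by (simp add: bn_def)
  define \<rho> where "\<rho> = min \<beta> 1"
  have \<rho>: "0 < \<rho>" "\<rho> \<le> \<beta>" "\<rho> \<le> 1" using \<beta> by (auto simp: \<rho>_def)
  define p where "p = max 1 (nat \<lceil>ln (real d)\<rceil>)"
  have p: "p \<ge> 1" "ln (real d) \<le> real p" "real p \<le> 2 * max 1 (ln (real d))"
  proof -
    have "0 \<le> ln (real d)" using d by simp
    then have r: "real (nat \<lceil>ln (real d)\<rceil>) \<le> ln (real d) + 1" "ln (real d) \<le> real (nat \<lceil>ln (real d)\<rceil>)" by linarith+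
    have "l \<le> max 1 r \<and> max 1 r \<le> 2 * max 1 l" if "r \<le> l + 1" "l \<le> r" "0 \<le> l" for r l :: real
      using that by (auto simp: max_def)
    from this[OF r] \<open>0 \<le> ln (real d)\<close>
    have "ln (real d) \<le> max 1 (real (nat \<lceil>ln (real d)\<rceil>))"
      "max 1 (real (nat \<lceil>ln (real d)\<rceil>)) \<le> 2 * max 1 (ln (real d))" by blast+
    moreover have "real p = max 1 (real (nat \<lceil>ln (real d)\<rceil>))" by (simp add: p_def)
    ultimately show "ln (real d) \<le> real p" "real p \<le> 2 * max 1 (ln (real d))" by (simp_all only:)
  qed (simp add: p_def)
  \<comment> \<open>Here the truncation radius pays for the logarithm: \<open>p R\<close> is of
    order \<open>(\<rho> / \<alpha>) d log d\<close>, and \<open>large1\<close> turns this into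
    \<open>\<rho> \<beta> n\<close>. The factor \<rho> serves \<open>pRn\<close> through
    \<open>\<rho> \<le> \<beta>\<close> and \<open>pRbn\<close> through
    \<open>\<rho> \<le> 1\<close>.\<close>
  have pR: "real p * R \<le> 320 * \<rho> * bn"
  proof -
    have "real p * R \<le> (2 * max 1 (ln (real d))) * R" using p R0 by (intro mult_right_mono) auto
    also have "\<dots> = 320 * (\<rho> / \<alpha>) * (real d * max 1 (ln (real d)))" by (simp add: R \<rho>_def)
    also have "\<dots> \<le> 320 * (\<rho> / \<alpha>) * (\<alpha> * \<beta> * real n)"
      using large1 L \<rho> \<alpha> by (intro mult_left_mono) auto
    also have "\<dots> = 320 * \<rho> * bn" using \<alpha> by (simp add: bn_def)
    finally show ?thesis .
  qed
  have pRn: "real p * R * real n \<le> 320 * bn\<^sup>2"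
  proof -
    have "real p * R * real n \<le> 320 * \<rho> * bn * real n" using pR by (intro mult_right_mono) auto
    also have "\<dots> \<le> 320 * \<beta> * bn * real n" using \<rho> bn by (intro mult_right_mono mult_left_mono) auto
    also have "\<dots> = 320 * bn\<^sup>2" by (simp add: bn_def power2_eq_square)
    finally show ?thesis .
  qed
  have pRbn: "real p * R * bn \<le> 320 * bn\<^sup>2"
  proof -
    have "real p * R * bn \<le> 320 * \<rho> * bn * bn" using pR bn by (intro mult_right_mono) auto
    also have "\<dots> \<le> 320 * 1 * bn * bn" using \<rho> bn by (intro mult_right_mono mult_left_mono) auto
    finally show ?thesis by (simp add: power2_eq_square)
  qed
  define A B where "A u = {X \<in> space M. dev (energy u) X > 1600000 * bn \<and> (\<forall>w\<in>net d. dev (energy w) X \<le> dev (energy u) X)}"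
    and "B u = {Y \<in> space M. dev (energy u) Y \<le> 26 * bn}" for u
  have AB: "A u \<in> sets M" "B u \<in> sets M" for u
  proof -
    have 1: "{X \<in> space M. dev (energy w) X \<le> dev (energy u) X} \<in> sets M" for w
      using dev_meas[OF inner_sq_meas[of w]] dev_meas[OF inner_sq_meas[of u]] by measurable
    show "A u \<in> sets M"
      unfolding A_def by (intro sets.sets_Collect_conj sets.sets_Collect_finite_All dev_sets(2) inner_sq_meas finite_net 1)
    show "B u \<in> sets M" unfolding B_def by (rule dev_sets(1)[OF inner_sq_meas])
  qed
  define E where "E = (\<Union>u\<in>net d. A u)"
  define Q where "Q = (\<Union>u\<in>net d. A u \<times> B u)"
  have Em: "E \<in> sets M" unfolding E_def using AB finite_net by (intro sets.finite_UN) auto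
  have Qm: "Q \<in> sets (M \<Otimes>\<^sub>M M)" unfolding Q_def using AB finite_net by (intro sets.finite_UN) auto
  have half: "1/2 \<le> measure M {Y \<in> space M. (X, Y) \<in> Q}" if X: "X \<in> E" for X
  proof -
    obtain u where u: "u \<in> net d" "X \<in> A u" using X by (auto simp: E_def)
    have eu: "energy u x \<le> R" for x
      using inner_sq_le[of x u] net_le_1[OF u(1)] R0 by (meson mult_left_le order_trans)
    have "measure M {Y \<in> space M. dev (energy u) Y > 26 * bn} \<le> real n * R / (26 * bn)\<^sup>2"
      unfolding dev_def
    proof (rule iid_chebyshev[OF P inner_sq_int])
      show int: "integrable P (\<lambda>x. (energy u x)\<^sup>2)"
      proof (rule P.integrable_const_bound[where B = "R\<^sup>2"])
        have "norm ((energy u x)\<^sup>2) \<le> R\<^sup>2" for x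
          unfolding real_norm_def abs_power2 by (rule power_mono[OF eu]) simp
        then show "AE x in P. norm ((energy u x)\<^sup>2) \<le> R\<^sup>2" by (intro AE_I2)
      qed (rule borel_measurable_power[OF inner_sq_meas])
      have "(\<integral>x. (energy u x)\<^sup>2 \<partial>P) \<le> (\<integral>x. R * energy u x \<partial>P)"
      proof (rule integral_mono[OF int])
        show "integrable P (\<lambda>x. R * energy u x)" using inner_sq_int by simp
        show "(energy u x)\<^sup>2 \<le> R * energy u x" for x
          unfolding power2_eq_square[of "energy u x"] using eu by (intro mult_right_mono) auto
      qed
      also have "\<dots> \<le> R * 1"
        unfolding Bochner_Integration.integral_mult_right_zero
        using energy_expectation_le[OF u(1)] R0 by (intro mult_left_mono)
      finally show "(\<integral>x. (energy u x)\<^sup>2 \<partial>P) \<le> R" by simp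
    qed (use bn in auto)
    also have "\<dots> \<le> 1/2"
    proof -
      have "1 * (R * real n) \<le> real p * (R * real n)" using p(1) R0 by (intro mult_right_mono) auto
      then have "real n * R \<le> 320 * bn\<^sup>2" using pRn by (simp add: mult_ac)
      also have "\<dots> \<le> 1/2 * (26 * bn)\<^sup>2" by (simp add: power_mult_distrib)
      finally show ?thesis using bn by (subst pos_divide_le_eq) auto
    qed
    finally have 1: "measure M {Y \<in> space M. dev (energy u) Y > 26 * bn} \<le> 1/2" .
    have "B u = space M - {Y \<in> space M. dev (energy u) Y > 26 * bn}" by (auto simp: B_def)
    then have "measure M (B u) = 1 - measure M {Y \<in> space M. dev (energy u) Y > 26 * bn}"
      using dev_sets(2)[OF inner_sq_meas] by (simp add: M.prob_compl)
    then have "1/2 \<le> measure M (B u)" using 1 by simp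
    also have "\<dots> \<le> measure M {Y \<in> space M. (X, Y) \<in> Q}"
    proof (rule M.finite_measure_mono)
      show "B u \<subseteq> {Y \<in> space M. (X, Y) \<in> Q}" using u by (auto simp: Q_def B_def)
      have "{Y \<in> space M. (X, Y) \<in> Q} = Pair X -` Q" using sets.sets_into_space[OF Qm] by (auto simp: space_pair_measure)
      then show "{Y \<in> space M. (X, Y) \<in> Q} \<in> sets M" using sets_Pair1[OF Qm] by simp
    qed
    finally show ?thesis .
  qed
  have "measure M E \<le> 2 * (1/8)"
  proof (rule symmetrization[OF P Em Qm half])
    fix X Y assume XY: "X \<in> space M" "Y \<in> space M"
    \<comment> \<open>The joint energy of both samples in the worst net direction. It is invariant
      under exchange, hence available as a variance level before the signs are drawn.\<close>
    define m where "m = (MAX u\<in>net d. \<Sum>i<n. energy u (X i) + energy u (Y i))"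
    have net0: "net d \<noteq> {}" using net_approx[OF d, of "\<lambda>_. 0"] by (auto simp: inner_vec_def)
    have m: "(\<Sum>i<n. energy u (X i) + energy u (Y i)) \<le> m" if "u \<in> net d" for u
      unfolding m_def using that finite_net by (intro Max_ge) auto
    have m0: "0 \<le> m" using m net0 by (meson all_not_in_conv order_trans sum_nonneg add_nonneg_nonneg zero_le_power2)
    have sX: "(\<Sum>i<n. energy u (X i)) \<le> m" "(\<Sum>i<n. energy u (Y i)) \<le> m" if "u \<in> net d" for u
      using m[OF that] sum_nonneg[of "{..<n}" "\<lambda>i. energy u (X i)"] sum_nonneg[of "{..<n}" "\<lambda>i. energy u (Y i)"]
      by (auto simp: sum.distrib)
    let ?\<kappa> = "200 * real p * R * (2 * m)"
    let ?K = "\<lambda>Z. {S \<in> Pow {..<n}. \<exists>v. (\<Sum>i<n. sg S i * energy v (Z i))\<^sup>2 > (inner_vec d v v)\<^sup>2 * ?\<kappa>}"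
    have K: "real (card (?K Z)) \<le> 2 ^ n / 16" if "\<And>u. u \<in> net d \<Longrightarrow> (\<Sum>i<n. energy u (Z i)) \<le> m" for Z
      using rademacher_operator_tail[of "{..<n}" d "\<lambda>i. y (Z i)" "2 * m" R p] sum_energy_le_net[where J = "{..<n}" and X = Z and m = m]
        that y_norm m0 R0 p d by simp
    have "{S \<in> Pow {..<n}. (mix S X Y, mix S Y X) \<in> Q} \<subseteq> ?K X \<union> ?K Y"
    proof (rule subsetI, rule ccontr)
      fix S assume S: "S \<in> {S \<in> Pow {..<n}. (mix S X Y, mix S Y X) \<in> Q}" and nK: "S \<notin> ?K X \<union> ?K Y"
      let ?X = "mix S X Y" and ?Y = "mix S Y X"
      obtain u where u: "u \<in> net d" "dev (energy u) ?X > 1600000 * bn"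
        "\<And>w. w \<in> net d \<Longrightarrow> dev (energy w) ?X \<le> dev (energy u) ?X" "dev (energy u) ?Y \<le> 26 * bn"
        using S by (auto simp: Q_def A_def B_def)
      define D where "D = dev (energy u) ?X"
      define q where "q = sqrt ?\<kappa>"
      have q0: "0 \<le> q" "q\<^sup>2 = ?\<kappa>" using R0 m0 by (auto simp: q_def)
      have good: "\<bar>\<Sum>i<n. sg S i * energy w (Z i)\<bar> \<le> q" if "Z = X \<or> Z = Y" "w \<in> net d" for Z w
      proof -
        have "(\<Sum>i<n. sg S i * energy w (Z i))\<^sup>2 \<le> (inner_vec d w w)\<^sup>2 * ?\<kappa>"
          using nK S that(1) by (auto simp: not_less)
        also have "\<dots> \<le> 1 * q\<^sup>2"
          unfolding q0(2) using net_le_1[OF that(2)] R0 m0 by (intro mult_right_mono) (auto simp: power_le_one)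
        finally have "\<bar>\<Sum>i<n. sg S i * energy w (Z i)\<bar> \<le> \<bar>q\<bar>" unfolding abs_le_square_iff by simp
        then show ?thesis using q0(1) by simp
      qed
      \<comment> \<open>The difference of the exchanged totals is a Rademacher sum in
        \<open>X\<close> minus one in \<open>Y\<close>; hence the two exceptional sets
        \<open>?K X\<close>, \<open>?K Y\<close> and the bound \<open>2 * q\<close>.\<close>
      have dd: "\<bar>(\<Sum>i<n. energy w (?X i)) - (\<Sum>i<n. energy w (?Y i))\<bar> \<le> 2 * q" if "w \<in> net d" for w
      proof -
        have "(\<Sum>i<n. energy w (?X i)) - (\<Sum>i<n. energy w (?Y i))
          = (\<Sum>i<n. sg S i * energy w (X i)) - (\<Sum>i<n. sg S i * energy w (Y i))"
          by (simp add: mix_diff[of "energy w"] right_diff_distrib flip: sum_subtractf)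
        then show ?thesis using good[of X w] good[of Y w] that by auto
      qed
      have D1: "D \<le> 26 * bn + 2 * q" using dd[OF u(1)] u(4) unfolding D_def dev_def by linarith
      have "m \<le> 2 * real n + 52 * bn + 6 * q"
        unfolding m_def
      proof (rule Max.boundedI)
        fix a assume "a \<in> (\<lambda>u. \<Sum>i<n. energy u (X i) + energy u (Y i)) ` net d"
        then obtain w where w: "w \<in> net d" "a = (\<Sum>i<n. energy w (X i) + energy w (Y i))" by auto
        have "a = (\<Sum>i<n. energy w (?X i)) + (\<Sum>i<n. energy w (?Y i))"
          unfolding w(2) by (simp add: mix_sum[of "energy w"] flip: sum.distrib)
        moreover have "(\<Sum>i<n. energy w (?X i)) \<le> real n + D"
        proof -
          have "real n * (\<integral>x. energy w x \<partial>P) \<le> real n" using energy_expectation_le[OF w(1)] by (simp add: mult_left_le)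
          then show ?thesis using u(3)[OF w(1)] unfolding D_def dev_def by linarith
        qed
        ultimately show "a \<le> 2 * real n + 52 * bn + 6 * q" using dd[OF w(1)] D1 by linarith
      qed (use finite_net net0 in auto)
      then have "q\<^sup>2 \<le> 200 * real p * R * (2 * (2 * real n + 52 * bn + 6 * q))"
        unfolding q0(2) using R0 by (intro mult_left_mono) auto
      also have "\<dots> = 800 * (real p * R * real n) + 20800 * (real p * R * bn) + (2400 * (real p * R)) * q"
        by (simp add: algebra_simps)
      also have "\<dots> \<le> 800 * (320 * bn\<^sup>2) + 20800 * (320 * bn\<^sup>2) + (2400 * (320 * bn)) * q"
      proof -
        have "real p * R \<le> 320 * bn"
        proof -
          have "320 * \<rho> * bn \<le> 320 * 1 * bn" using \<rho> bn by (intro mult_right_mono mult_left_mono) auto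
          then show ?thesis using pR by linarith
        qed
        then have "(2400 * (real p * R)) * q \<le> (2400 * (320 * bn)) * q"
          using q0(1) by (intro mult_right_mono mult_left_mono) simp_all
        then show ?thesis using pRn pRbn by linarith
      qed
      also have "\<dots> \<le> (768000 * bn) * q + (2700 * bn)\<^sup>2" by (simp add: power_mult_distrib)
      finally have "q \<le> 768000 * bn + 2700 * bn" by (rule quadratic_bound) (use bn in auto)
      then show False using D1 u(2) bn by (simp add: D_def)
    qed
    then have "card {S \<in> Pow {..<n}. (mix S X Y, mix S Y X) \<in> Q} \<le> card (?K X \<union> ?K Y)"
      by (intro card_mono) auto
    also have "\<dots> \<le> card (?K X) + card (?K Y)" by (rule card_Un_le)
    finally have "card {S \<in> Pow {..<n}. (mix S X Y, mix S Y X) \<in> Q} \<le> card (?K X) + card (?K Y)" .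
    then have "real (card {S \<in> Pow {..<n}. (mix S X Y, mix S Y X) \<in> Q}) \<le> real (card (?K X) + card (?K Y))"
      by (rule of_nat_mono)
    also have "\<dots> \<le> 2 ^ n / 16 + 2 ^ n / 16"
      unfolding of_nat_add using K[of X] K[of Y] sX by (intro add_mono) auto
    finally show "real (card {S \<in> Pow {..<n}. (mix S X Y, mix S Y X) \<in> Q}) \<le> 1/8 * 2 ^ n" by simp
  qed
  moreover have sub: "{X \<in> space M. \<exists>u\<in>net d. dev (energy u) X > 1600000 * \<beta> * real n} \<subseteq> E"
  proof
    fix X assume X: "X \<in> {X \<in> space M. \<exists>u\<in>net d. dev (energy u) X > 1600000 * \<beta> * real n}"
    then have ne: "net d \<noteq> {}" by auto
    let ?m = "MAX u\<in>net d. dev (energy u) X"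
    have "?m \<in> (\<lambda>u. dev (energy u) X) ` net d" using ne finite_net by (intro Max_in) auto
    then obtain u where u: "u \<in> net d" "?m = dev (energy u) X" by auto
    have le: "dev (energy w) X \<le> dev (energy u) X" if "w \<in> net d" for w
      unfolding u(2)[symmetric] using that finite_net by (intro Max_ge) auto
    obtain w where w: "w \<in> net d" "dev (energy w) X > 1600000 * \<beta> * real n" using X by auto
    have "1600000 * bn < dev (energy u) X" using w(2) le[OF w(1)] by (simp add: bn_def mult.assoc)
    then have "X \<in> A u" using le X by (simp add: A_def)
    then show "X \<in> E" using u(1) by (auto simp: E_def)
  qed
  ultimately show ?thesis using M.finite_measure_mono[OF sub Em] by linarith
qed

end

lemma inner_vec_add_le:
  "inner_vec d (\<lambda>j. v j + w j) (\<lambda>j. v j + w j) \<le> 2 * inner_vec d v v + 2 * inner_vec d w w"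
  unfolding inner_vec_def sum_distrib_left sum.distrib[symmetric]
proof (rule sum_mono)
  fix i
  show "(v i + w i) * (v i + w i) \<le> 2 * (v i * v i) + 2 * (w i * w i)"
    using zero_le_square[of "v i - w i"] by (simp add: algebra_simps)
qed

lemma inner_vec_diff_le:
  "inner_vec d (\<lambda>j. v j - w j) (\<lambda>j. v j - w j) \<le> 2 * inner_vec d v v + 2 * inner_vec d w w"
  using inner_vec_add_le[of d v "\<lambda>j. - w j"] by (simp add: inner_vec_def)

text \<open>The sum \<open>s\<close> is tested against itself: Cauchy-Schwarz over the indices gives
  \<open>|s|^4 \<le> card J * m * |s|^2\<close>. This is the estimate that makes the removal of few
  points harmless for the mean.\<close>

lemma inner_vec_sum_le_card:
  assumes b: "\<And>v. (\<Sum>i\<in>J. (inner_vec d (a i) v)\<^sup>2) \<le> m * inner_vec d v v" and m: "0 \<le> m"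
  shows "inner_vec d (\<lambda>j. \<Sum>i\<in>J. a i j) (\<lambda>j. \<Sum>i\<in>J. a i j) \<le> real (card J) * m"
proof -
  let ?s = "\<lambda>j. \<Sum>i\<in>J. a i j"
  let ?N = "inner_vec d ?s ?s"
  have "?N\<^sup>2 = (\<Sum>i\<in>J. 1 * inner_vec d (a i) ?s)\<^sup>2" by (simp add: inner_vec_sum)
  also have "\<dots> \<le> (\<Sum>i\<in>J. 1\<^sup>2) * (\<Sum>i\<in>J. (inner_vec d (a i) ?s)\<^sup>2)" by (rule Cauchy_Schwarz_ineq_sum)
  also have "\<dots> \<le> real (card J) * (m * ?N)" using b[of ?s] by (simp add: mult_left_mono)
  finally have le: "?N * ?N \<le> real (card J) * m * ?N" by (simp add: power2_eq_square mult.assoc)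
  show ?thesis
  proof (cases "?N = 0")
    case False
    then have "?N > 0" using inner_vec_self_nonneg[of d ?s] by linarith
    then show ?thesis using le by simp
  qed (use m in simp)
qed

context truncated_sample
begin

section \<open>Typical behaviour of a whole sample\<close>

definition ysum :: "nat set \<Rightarrow> (nat \<Rightarrow> 'a) \<Rightarrow> nat \<Rightarrow> real" where
  "ysum J X = (\<lambda>j. \<Sum>i\<in>J. y (X i) j)"

abbreviation "sumsq J X \<equiv> inner_vec d (ysum J X) (ysum J X)"

abbreviation "ynorm x \<equiv> inner_vec d (y x) (y x)"

definition "Bad = {x \<in> space P. bad x}"

lemma Bad_sets: "Bad \<in> sets P"
  using bad_meas by (simp add: Bad_def)

lemma sumsq_meas: "J \<subseteq> {..<n} \<Longrightarrow> sumsq J \<in> borel_measurable M"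
proof -
  assume J: "J \<subseteq> {..<n}"
  have m: "(\<lambda>X. \<Sum>i\<in>J. y (X i) j) \<in> borel_measurable M" if "j < d" for j
    using sum_meas[OF y_meas[OF that] J] .
  show "sumsq J \<in> borel_measurable M"
    unfolding inner_vec_def ysum_def
    by (rule borel_measurable_sum, rule borel_measurable_times) (use m in simp_all)
qed

lemma nd_le: "real n * real d \<le> \<alpha> * \<beta> * (real n)\<^sup>2"
  using mult_left_mono[OF d_le(1), of "real n"] by (simp add: power2_eq_square mult_ac)

lemma prob_le_compl:
  assumes "A \<in> sets M" "measure M {X \<in> space M. X \<notin> A} \<le> c" shows "1 - c \<le> measure M A"
  using assms M.prob_compl[of A] by (simp add: set_diff_eq)

text \<open>Markov for the coordinatewise variances, at most \<open>n d\<close> in total, plus the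
  bias of the mean; 48 = 2 * 20 + 2 * 4 from splitting the square of a sum.\<close>

lemma sum_deviation: "measure M {X \<in> space M. sumsq {..<n} X > 48 * (\<alpha> * \<beta> * (real n)\<^sup>2)} \<le> 1/20"
proof -
  define \<mu> where "\<mu> j = (\<integral>x. y x j \<partial>P)" for j
  define c where "c j x = y x j - \<mu> j" for j x
  have yj: "inner_vec d (y x) (id_mat j) = y x j" if "j < d" for x j
  proof -
    have "inner_vec d (y x) (id_mat j) = (\<Sum>i<d. if j = i then y x i else 0)"
      unfolding inner_vec_def id_mat_def by (rule sum.cong) auto
    then show ?thesis using that by simp
  qed
  have int: "integrable P (\<lambda>x. y x j)" "integrable P (\<lambda>x. (y x j)\<^sup>2)" "(\<integral>x. (y x j)\<^sup>2 \<partial>P) \<le> 1" if "j < d" for j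
    using inner_int[of "id_mat j"] inner_sq_int[of "id_mat j"] second[of "id_mat j"] inner_vec_id_mat[OF that] yj[OF that] by auto
  have c: "integrable P (c j)" "integrable P (\<lambda>x. (c j x)\<^sup>2)" "(\<integral>x. c j x \<partial>P) = 0" "(\<integral>x. (c j x)\<^sup>2 \<partial>P) \<le> 1" if "j < d" for j
  proof -
    show "integrable P (c j)" "integrable P (\<lambda>x. (c j x)\<^sup>2)" "(\<integral>x. c j x \<partial>P) = 0"
      unfolding c_def[abs_def] using int[OF that] by (auto simp: power2_diff P.prob_space \<mu>_def)
    show "(\<integral>x. (c j x)\<^sup>2 \<partial>P) \<le> 1"
      using P.variance_eq[OF int(1,2)[OF that]] int(3)[OF that] unfolding c_def \<mu>_def by (smt (verit) zero_le_power2)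
  qed
  let ?F = "\<lambda>X. \<Sum>j<d. (\<Sum>i<n. c j (X i))\<^sup>2"
  have F: "integrable M ?F" "(\<integral>X. ?F X \<partial>M) \<le> real n * real d"
  proof -
    have i: "integrable M (\<lambda>X. (\<Sum>i<n. c j (X i))\<^sup>2)" "(\<integral>X. (\<Sum>i<n. c j (X i))\<^sup>2 \<partial>M) \<le> real n" if "j < d" for j
      using iid_sum_second_moment[OF P c(1-3)[OF that], of n] c(4)[OF that] by (auto simp: mult_left_le)
    show "integrable M ?F" by (intro Bochner_Integration.integrable_sum i) auto
    have "(\<integral>X. ?F X \<partial>M) = (\<Sum>j<d. \<integral>X. (\<Sum>i<n. c j (X i))\<^sup>2 \<partial>M)"
      by (rule Bochner_Integration.integral_sum) (use i in auto)
    also have "\<dots> \<le> (\<Sum>j<d. real n)" by (intro sum_mono i) auto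
    finally show "(\<integral>X. ?F X \<partial>M) \<le> real n * real d" by (simp add: mult.commute)
  qed
  have nd: "0 < real n * real d" using n d by simp
  \<comment> \<open>The hypothesis \<open>bias\<close> is applied in the direction of the mean
    vector itself.\<close>
  have mu: "inner_vec d \<mu> \<mu> \<le> 4 * \<alpha> * \<beta>"
  proof -
    have "(\<integral>x. inner_vec d (y x) \<mu> \<partial>P) = inner_vec d \<mu> \<mu>"
    proof -
      have "(\<integral>x. inner_vec d (y x) \<mu> \<partial>P) = (\<Sum>j<d. \<integral>x. y x j * \<mu> j \<partial>P)"
        unfolding inner_vec_def by (rule Bochner_Integration.integral_sum) (use int(1) in simp)
      also have "\<dots> = inner_vec d \<mu> \<mu>"
        unfolding inner_vec_def by (rule sum.cong[OF refl]) (simp add: \<mu>_def)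
      finally show ?thesis .
    qed
    then have "inner_vec d \<mu> \<mu> * inner_vec d \<mu> \<mu> \<le> 4 * \<alpha> * \<beta> * inner_vec d \<mu> \<mu>"
      using bias[of \<mu>] by (simp add: power2_eq_square)
    then show ?thesis using inner_vec_self_nonneg[of d \<mu>] \<alpha> \<beta> by (cases "inner_vec d \<mu> \<mu> = 0") auto
  qed
  have det: "sumsq {..<n} X \<le> 48 * (\<alpha> * \<beta> * (real n)\<^sup>2)" if F20: "?F X < 20 * (real n * real d)" for X
  proof -
    have ys: "ysum {..<n} X = (\<lambda>j. (\<Sum>i<n. c j (X i)) + real n * \<mu> j)"
      by (simp add: ysum_def c_def sum_subtractf)
    have 1: "sumsq {..<n} X \<le> 2 * inner_vec d (\<lambda>j. \<Sum>i<n. c j (X i)) (\<lambda>j. \<Sum>i<n. c j (X i))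
        + 2 * inner_vec d (\<lambda>j. real n * \<mu> j) (\<lambda>j. real n * \<mu> j)"
      unfolding ys by (rule inner_vec_add_le)
    have 2: "inner_vec d (\<lambda>j. \<Sum>i<n. c j (X i)) (\<lambda>j. \<Sum>i<n. c j (X i)) = ?F X"
      by (simp add: inner_vec_def power2_eq_square)
    have "inner_vec d (\<lambda>j. real n * \<mu> j) (\<lambda>j. real n * \<mu> j) = (real n)\<^sup>2 * inner_vec d \<mu> \<mu>"
      by (simp add: inner_vec_scale inner_vec_scale_right power2_eq_square)
    also have "\<dots> \<le> (real n)\<^sup>2 * (4 * \<alpha> * \<beta>)" using mu by (intro mult_left_mono) auto
    also have "\<dots> = 4 * (\<alpha> * \<beta> * (real n)\<^sup>2)" by simp
    finally show ?thesis using 1 2 F20 nd_le by linarith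
  qed
  have "measure M {X \<in> space M. sumsq {..<n} X > 48 * (\<alpha> * \<beta> * (real n)\<^sup>2)} \<le> measure M {X \<in> space M. 20 * (real n * real d) \<le> ?F X}"
  proof (rule M.finite_measure_mono)
    show "{X \<in> space M. sumsq {..<n} X > 48 * (\<alpha> * \<beta> * (real n)\<^sup>2)} \<subseteq> {X \<in> space M. 20 * (real n * real d) \<le> ?F X}"
      using det by (force simp: not_less[symmetric])
    show "{X \<in> space M. 20 * (real n * real d) \<le> ?F X} \<in> sets M"
      using borel_measurable_integrable[OF F(1)] by measurable
  qed
  also have "\<dots> \<le> (\<integral>X. ?F X \<partial>M) / (20 * (real n * real d))"
    by (rule integral_Markov_inequality_measure[where A = "{}"]) (use F(1) nd in \<open>auto intro!: sum_nonneg\<close>)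
  also have "\<dots> \<le> (real n * real d) / (20 * (real n * real d))" using F(2) nd by (intro divide_right_mono) auto
  also have "\<dots> = 1/20" using n d by simp
  finally show ?thesis .
qed

lemma energy_total: "measure M {X \<in> space M. (\<Sum>i<n. ynorm (X i)) > 20 * (real n * real d)} \<le> 1/20"
proof -
  have yn: "ynorm x = (\<Sum>j<d. energy (id_mat j) x)" for x
    by (subst inner_vec_parseval) (simp add: power2_eq_square)
  have int: "integrable P (\<lambda>x. ynorm x)" unfolding yn by (intro Bochner_Integration.integrable_sum inner_sq_int)
  have "(\<integral>x. ynorm x \<partial>P) = (\<Sum>j<d. \<integral>x. energy (id_mat j) x \<partial>P)"
    unfolding yn by (rule Bochner_Integration.integral_sum) (rule inner_sq_int)
  also have "\<dots> \<le> (\<Sum>j<d. 1)"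
  proof (rule sum_mono)
    fix j assume "j \<in> {..<d}"
    then show "(\<integral>x. energy (id_mat j) x \<partial>P) \<le> 1" using second[of "id_mat j"] inner_vec_id_mat[of j d] by simp
  qed
  finally have le: "(\<integral>x. ynorm x \<partial>P) \<le> real d" by simp
  have nd: "0 < real n * real d" using n d by simp
  have "measure M {X \<in> space M. (\<Sum>i<n. ynorm (X i)) > 20 * (real n * real d)} \<le> real n * (\<integral>x. ynorm x \<partial>P) / (20 * (real n * real d))"
    by (rule iid_markov[OF P int]) (use nd in auto)
  also have "\<dots> \<le> real n * real d / (20 * (real n * real d))"
    using le nd by (intro divide_right_mono mult_left_mono) auto
  also have "\<dots> = 1/20" using n d by simp
  finally show ?thesis .
qed

lemma bad_count: "measure M {X \<in> space M. (\<Sum>i<n. indicat_real Bad (X i)) > \<alpha> * real n / 4} \<le> 1/20"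
proof -
  have an: "0 < \<alpha> * real n" using \<alpha> n by simp
  have "measure M {X \<in> space M. (\<Sum>i<n. indicat_real Bad (X i)) > \<alpha> * real n / 4}
     \<le> real n * (\<integral>x. indicat_real Bad x \<partial>P) / (\<alpha> * real n / 4)"
  proof (rule iid_markov[OF P])
    show "integrable P (indicat_real Bad)"
      by (rule P.integrable_const_bound[where B = 1]) (use Bad_sets in auto)
  qed (use an in auto)
  also have "(\<integral>x. indicat_real Bad x \<partial>P) = measure P Bad"
    using Bad_sets by (simp add: Bad_def Int_def conj_commute cong: conj_cong)
  also have "real n * measure P Bad / (\<alpha> * real n / 4) \<le> real n * (\<alpha> / 80) / (\<alpha> * real n / 4)"
    using bad_prob an by (intro divide_right_mono mult_left_mono) (auto simp: Bad_def)
  also have "\<dots> = 1/20" using \<alpha> n by simp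
  finally show ?thesis .
qed

text \<open>The requirements on the ghost sample. Their failure probabilities are at most 1/20,
  1/10, 1/4, 1/20 and 1/20, with sum 1/2, as symmetrization demands.\<close>

definition good :: "(nat \<Rightarrow> 'a) \<Rightarrow> bool" where
  "good X \<longleftrightarrow> (\<Sum>i<n. indicat_real Bad (X i)) \<le> \<alpha> * real n / 4 \<and>
     (\<forall>u\<in>net d. dev (psi u) X \<le> 460 * \<beta> * real n) \<and> (\<forall>u\<in>net d. dev (energy u) X \<le> 1600000 * \<beta> * real n) \<and>
     sumsq {..<n} X \<le> 48 * (\<alpha> * \<beta> * (real n)\<^sup>2) \<and> (\<Sum>i<n. ynorm (X i)) \<le> 20 * (real n * real d)"

lemma sets_le: "f \<in> borel_measurable M \<Longrightarrow> {X \<in> space M. f X \<le> c} \<in> sets M" for f :: "_ \<Rightarrow> real"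
  by measurable

lemma indicator_sum_meas: "I \<subseteq> {..<n} \<Longrightarrow> (\<lambda>X. \<Sum>i\<in>I. indicat_real Bad (X i)) \<in> borel_measurable M"
  using Bad_sets by (intro sum_meas) auto

lemma good_sets: "{X \<in> space M. good X} \<in> sets M"
  unfolding good_def
  by (intro sets.sets_Collect_conj sets.sets_Collect_finite_All finite_net dev_sets(1) psi_meas inner_sq_meas
      sets_le sumsq_meas indicator_sum_meas sum_meas[OF norm_meas]) auto

lemma good_prob: "1/2 \<le> measure M {X \<in> space M. good X}"
proof -
  let ?A = "{X \<in> space M. (\<Sum>i<n. indicat_real Bad (X i)) > \<alpha> * real n / 4}"
  let ?B = "{X \<in> space M. \<exists>u\<in>net d. dev (psi u) X > 460 * \<beta> * real n}"
  let ?C = "{X \<in> space M. \<exists>u\<in>net d. dev (energy u) X > 1600000 * \<beta> * real n}"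
  let ?D = "{X \<in> space M. sumsq {..<n} X > 48 * (\<alpha> * \<beta> * (real n)\<^sup>2)}"
  let ?E = "{X \<in> space M. (\<Sum>i<n. ynorm (X i)) > 20 * (real n * real d)}"
  have less: "{X \<in> space M. f X > c} \<in> sets M" if "f \<in> borel_measurable M" for f :: "_ \<Rightarrow> real" and c
    using that by measurable
  have s: "?A \<in> sets M" "?B \<in> sets M" "?C \<in> sets M" "?D \<in> sets M" "?E \<in> sets M"
    by (intro sets.sets_Collect_finite_Ex finite_net dev_sets(2) psi_meas inner_sq_meas
      less sumsq_meas indicator_sum_meas sum_meas[OF norm_meas]; simp)+
  have "measure M {X \<in> space M. X \<notin> {X \<in> space M. good X}} \<le> measure M (?A \<union> (?B \<union> (?C \<union> (?D \<union> ?E))))"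
    by (rule M.finite_measure_mono) (use s in \<open>auto simp: good_def not_le\<close>)
  also have "\<dots> \<le> measure M ?A + (measure M ?B + (measure M ?C + (measure M ?D + measure M ?E)))"
    using s by (intro order_trans[OF measure_Un_le] add_left_mono sets.Un order_refl)
  also have "\<dots> \<le> 1/20 + (1/10 + (1/4 + (1/20 + 1/20)))"
  proof (intro add_mono bad_count energy_deviation sum_deviation energy_total)
    show "measure M ?B \<le> 1/10" using clipped_deviation L by (smt (verit) divide_right_mono exp_le_one_iff)
  qed
  finally have "measure M {X \<in> space M. X \<notin> {X \<in> space M. good X}} \<le> 1/2" by simp
  then show ?thesis using prob_le_compl[OF good_sets] by fastforce
qed

text \<open>The excess is the energy minus its clipped part, and on the net their expectations
  differ by at most \<open>3 * \<beta>\<close>: 1600463 = 1600000 + 460 + 3.\<close>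

lemma good_excess:
  assumes "good X" "u \<in> net d"
  shows "(\<Sum>i<n. excess u (X i)) \<le> 1600463 * \<beta> * real n"
proof -
  have "(\<Sum>i<n. excess u (X i)) = (\<Sum>i<n. energy u (X i)) - (\<Sum>i<n. psi u (X i))"
    by (simp add: excess_def sum_subtractf)
  moreover have "(\<Sum>i<n. energy u (X i)) \<le> real n * (\<integral>x. energy u x \<partial>P) + 1600000 * \<beta> * real n"
    "(\<Sum>i<n. psi u (X i)) \<ge> real n * (\<integral>x. psi u x \<partial>P) - 460 * \<beta> * real n"
  proof -
    have "dev (energy u) X \<le> 1600000 * \<beta> * real n" "dev (psi u) X \<le> 460 * \<beta> * real n"
      using assms by (auto simp: good_def)
    then show "(\<Sum>i<n. energy u (X i)) \<le> real n * (\<integral>x. energy u x \<partial>P) + 1600000 * \<beta> * real n"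
      "(\<Sum>i<n. psi u (X i)) \<ge> real n * (\<integral>x. psi u x \<partial>P) - 460 * \<beta> * real n"
      unfolding dev_def by linarith+
  qed
  moreover have "real n * (\<integral>x. energy u x \<partial>P) - real n * (\<integral>x. psi u x \<partial>P) \<le> real n * (3 * \<beta>)"
    unfolding right_diff_distrib[symmetric]
    using second[of u] psi_expectation_ge[OF net_le_1[OF assms(2)]] by (intro mult_left_mono) auto
  ultimately show ?thesis by (simp add: algebra_simps)
qed

section \<open>Deletion of few points, and the sum of the kept ones\<close>

definition crit :: "(('a \<Rightarrow> real) \<times> real) set" where
  "crit = insert (indicat_real Bad, \<alpha> * real n / 4) (insert (ynorm, 20 * (real n * real d))
     ((\<lambda>u. (excess u, 1600463 * \<beta> * real n)) ` net d))"

text \<open>A quarter of the deletion budget \<alpha> n is spent here; the rest is reserved for bad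
  points. The factor 2 is that of control by two points.\<close>

definition selectable :: "(nat \<Rightarrow> 'a) \<Rightarrow> bool" where
  "selectable X \<longleftrightarrow> (\<exists>I\<in>Pow {..<n}. card ({..<n} - I) < nat \<lfloor>\<alpha> * real n / 4\<rfloor> \<and>
     (\<forall>r\<in>crit. (\<Sum>i\<in>I. fst r (X i)) \<le> 2 * snd r))"

lemma crit_props:
  assumes "r \<in> crit"
  shows "fst r \<in> borel_measurable P" "0 \<le> fst r x"
  using assms Bad_sets norm_meas excess_meas psi_bounds(4) by (auto simp: crit_def)

lemma finite_crit: "finite crit"
  by (simp add: crit_def finite_net)

lemma good_crit: "good X \<Longrightarrow> r \<in> crit \<Longrightarrow> (\<Sum>i<n. fst r (X i)) \<le> snd r"
  using good_excess by (auto simp: crit_def good_def)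

lemma crit_sum_sets: "r \<in> crit \<Longrightarrow> I \<subseteq> {..<n} \<Longrightarrow> {X \<in> space M. (\<Sum>i\<in>I. fst r (X i)) \<le> c} \<in> sets M"
  by (intro sets_le sum_meas crit_props)

lemma selectable_prob: "measure M {X \<in> space M. \<not> selectable X} \<le> exp (- L) / 10"
proof -
  define j where "j = nat \<lfloor>\<alpha> * real n / 4\<rfloor>"
  have "measure M {X \<in> space M. \<not> selectable X} \<le> 2 * exp (- (L + 5))"
    unfolding selectable_def
  proof (rule subset_selection[OF P finite_crit crit_props])
    \<comment> \<open>By \<open>large2\<close> the number \<open>j\<close> is at least
      \<open>50 * L + 49\<close>, so that \<open>2 ^ j\<close> outweighs
      \<open>exp (3 * (L + 5))\<close>, the third power demanded by
      \<open>subset_selection\<close>.\<close>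
    have "real j \<ge> \<alpha> * real n / 4 - 1" unfolding j_def by linarith
    moreover have "50 * (1 + L) \<le> \<alpha> * real n / 4" using large2 by simp
    ultimately have "real j \<ge> 50 * L + 49" by (simp add: algebra_simps)
    then have "exp (3 * (L + 5)) \<le> exp (real j * (1/2))" using L by simp
    also have "\<dots> = exp (1/2) ^ j" by (simp only: exp_of_nat_mult)
    also have "\<dots> \<le> 2 ^ j"
    proof (rule power_mono)
      have "exp (1/2::real) ^ 2 = exp 1" by (simp flip: exp_of_nat_mult)
      also have "\<dots> \<le> 2 ^ 2" using e_less_272 by simp
      finally show "exp (1/2::real) \<le> 2" by (rule power2_le_imp_le) simp
    qed simp
    finally have "exp (- (L + 5)) ^ 3 * exp (3 * (L + 5)) \<le> exp (- (L + 5)) ^ 3 * 2 ^ j" by (intro mult_left_mono) auto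
    moreover have "exp (- (L + 5)) ^ 3 * exp (3 * (L + 5)) = 1"
      unfolding exp_of_nat_mult[symmetric] exp_add[symmetric] by (simp flip: exp_of_nat_mult exp_add)
    ultimately show "1 \<le> exp (- (L + 5)) ^ 3 * 2 ^ nat \<lfloor>\<alpha> * real n / 4\<rfloor>"
      unfolding j_def[symmetric] by linarith
    have "{X \<in> space M. \<forall>r\<in>crit. (\<Sum>i<n. fst r (X i)) \<le> snd r} \<in> sets M"
      by (intro sets.sets_Collect_finite_All finite_crit crit_sum_sets) auto
    then have "measure M {X \<in> space M. good X} \<le> measure M {X \<in> space M. \<forall>r\<in>crit. (\<Sum>i<n. fst r (X i)) \<le> snd r}"
      by (intro M.finite_measure_mono) (auto intro: good_crit)
    then show "1/2 \<le> measure M {X \<in> space M. \<forall>r\<in>crit. (\<Sum>i<n. fst r (X i)) \<le> snd r}" using good_prob by linarith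
  qed auto
  also have "2 * exp (- (L + 5)) = 2 * exp (- 5) * exp (- L)" by (simp flip: exp_add)
  also have "\<dots> \<le> exp (- L) / 10" using mult_right_mono[OF exp_minus_5, of "exp (- L)"] by simp
  finally show ?thesis .
qed

text \<open>The excess bound is three times that of a good sample: two parts from the selection, one
  from the ghost. The level \<open>10 ^ 10\<close> is what \<open>kept_prob\<close> can
  afford.\<close>

definition kept :: "(nat \<Rightarrow> 'a) \<Rightarrow> nat set \<Rightarrow> bool" where
  "kept X J \<longleftrightarrow> real (card ({..<n} - J)) \<le> \<alpha> * real n \<and> (\<forall>i\<in>J. X i \<notin> Bad) \<and>
     (\<forall>u\<in>net d. (\<Sum>i\<in>J. excess u (X i)) \<le> 4801389 * \<beta> * real n) \<and> sumsq J X \<le> 10 ^ 10 * (\<alpha> * \<beta> * (real n)\<^sup>2)"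

lemma kept_sets: "J \<subseteq> {..<n} \<Longrightarrow> {X \<in> space M. kept X J} \<in> sets M"
proof -
  assume J: "J \<subseteq> {..<n}"
  have "{X \<in> space M. X i \<notin> Bad} \<in> sets M" if "i \<in> J" for i
  proof -
    have "(\<lambda>X. X i) \<in> M \<rightarrow>\<^sub>M P" using that J by (intro measurable_component_singleton) auto
    then have "(\<lambda>X. X i) -` Bad \<inter> space M \<in> sets M" using Bad_sets by (rule measurable_sets)
    then have "space M - (\<lambda>X. X i) -` Bad \<inter> space M \<in> sets M" by (rule sets.compl_sets)
    moreover have "space M - (\<lambda>X. X i) -` Bad \<inter> space M = {X \<in> space M. X i \<notin> Bad}" by auto
    ultimately show ?thesis by simp
  qed
  then show ?thesis
    unfolding kept_def using finite_subset[OF J] J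
    by (intro sets.sets_Collect_conj sets.sets_Collect_const sets.sets_Collect_finite_All sets_le sumsq_meas
        sum_meas[OF excess_meas] finite_net) auto
qed

text \<open>On at most \<open>k \<alpha> n\<close> points the clipped parts contribute at most
  \<theta> each, in total \<open>k \<beta> n\<close> because
  \<open>\<theta> * \<alpha> \<le> \<beta>\<close>. On such small sets a bound on the excess is a
  bound on the energy.\<close>

lemma sum_psi_le:
  assumes "\<And>u. u \<in> net d \<Longrightarrow> (\<Sum>i\<in>J. excess u (X i)) \<le> c * \<beta> * real n" "u \<in> net d" "real (card J) \<le> k * (\<alpha> * real n)" "0 \<le> k"
  shows "(\<Sum>i\<in>J. energy u (X i)) \<le> (k + c) * \<beta> * real n"
proof -
  have "(\<Sum>i\<in>J. psi u (X i)) \<le> (\<Sum>i\<in>J. \<theta>)" by (intro sum_mono psi_bounds)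
  also have "\<dots> \<le> k * (\<alpha> * real n) * \<theta>" using assms(3) \<theta>(1) by (simp add: mult_right_mono)
  also have "\<dots> = k * real n * (\<theta> * \<alpha>)" by simp
  also have "\<dots> \<le> k * real n * \<beta>" using \<theta>\<alpha> assms(4) by (intro mult_left_mono) auto
  finally have "(\<Sum>i\<in>J. psi u (X i)) \<le> k * real n * \<beta>" .
  moreover have "(\<Sum>i\<in>J. energy u (X i)) = (\<Sum>i\<in>J. psi u (X i)) + (\<Sum>i\<in>J. excess u (X i))"
    by (simp add: excess_def flip: sum.distrib)
  ultimately show ?thesis using assms(1)[OF assms(2)] by (simp add: algebra_simps)
qed

text \<open>A cardinality of order \<alpha> n times an energy of order \<beta> n, by
  \<open>inner_vec_sum_le_card\<close>. This product is the origin of the scale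
  \<open>\<alpha> * \<beta> * (real n)\<^sup>2\<close>.\<close>

lemma sumsq_le_of_excess:
  assumes "\<And>u. u \<in> net d \<Longrightarrow> (\<Sum>i\<in>J. excess u (X i)) \<le> c * \<beta> * real n" "real (card J) \<le> k * (\<alpha> * real n)" "0 \<le> k" "0 \<le> c"
  shows "sumsq J X \<le> 2 * k * (k + c) * (\<alpha> * \<beta> * (real n)\<^sup>2)"
proof -
  have b0: "0 \<le> (k + c) * \<beta> * real n" using assms \<beta> by simp
  have "(\<Sum>i\<in>J. (inner_vec d (y (X i)) v)\<^sup>2) \<le> 2 * ((k + c) * \<beta> * real n) * inner_vec d v v" for v
    by (rule sum_energy_le_net) (rule sum_psi_le[OF assms(1) _ assms(2,3)])
  then have "sumsq J X \<le> real (card J) * (2 * ((k + c) * \<beta> * real n))"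
    unfolding ysum_def using b0 by (intro inner_vec_sum_le_card) auto
  also have "\<dots> \<le> (k * (\<alpha> * real n)) * (2 * ((k + c) * \<beta> * real n))"
    using assms(2) b0 by (intro mult_right_mono) auto
  also have "\<dots> = 2 * k * (k + c) * (\<alpha> * \<beta> * (real n)\<^sup>2)" by (simp add: power2_eq_square mult_ac)
  finally show ?thesis .
qed

lemma ysum_split: "J \<subseteq> I \<Longrightarrow> finite I \<Longrightarrow> ysum J X = (\<lambda>j. ysum I X j - ysum (I - J) X j)"
  unfolding ysum_def by (auto simp: fun_eq_iff sum_diff)

lemma sumsq_subset_le:
  assumes "J \<subseteq> I" "finite I"
  shows "sumsq J X \<le> 2 * sumsq I X + 2 * sumsq (I - J) X"
  unfolding ysum_split[OF assms] by (rule inner_vec_diff_le)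

text \<open>The sum remains to be controlled, but the index set depends on the sample. For fixed
  \<open>X\<close>, \<open>Y\<close> one exchange in the event supplies a set \<open>J\<close> whose
  bounds hold for both samples together. The same \<open>J\<close> is then tested for every exchange
  in the event, where it can fail only through its sum; up to the sum of the good ghost, this is a
  Rademacher sum over \<open>J\<close>.\<close>

lemma kept_prob:
  "measure M {X \<in> space M. \<not> ((\<forall>u\<in>net d. dev (psi u) X \<le> 460 * \<beta> * real n) \<and> (\<exists>J\<in>Pow {..<n}. kept X J))} \<le> exp (- L)"
proof -
  define E where "E = {X \<in> space M. (\<forall>u\<in>net d. dev (psi u) X \<le> 460 * \<beta> * real n) \<and> selectable X \<and> \<not> (\<exists>J\<in>Pow {..<n}. kept X J)}"
  define G where "G = {X \<in> space M. good X}"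
  have sel_sets: "{X \<in> space M. selectable X} \<in> sets M"
    unfolding selectable_def
    by (intro sets.sets_Collect_finite_Ex sets.sets_Collect_conj sets.sets_Collect_const sets.sets_Collect_finite_All
        finite_crit crit_sum_sets) auto
  have Em: "E \<in> sets M"
    unfolding E_def
    by (intro sets.sets_Collect_finite_Ex sets.sets_Collect_conj sets.sets_Collect_neg sets.sets_Collect_finite_All
        finite_net dev_sets(1) psi_meas sel_sets kept_sets) auto
  have Gm: "G \<in> sets M" unfolding G_def by (rule good_sets)
  define p where "p = nat \<lceil>L\<rceil> + 3"
  have p: "real p \<ge> L + 3" "real p \<le> 4 * (1 + L)"
  proof -
    define c where "c = real (nat \<lceil>L\<rceil>)"
    have "c \<le> L + 1" "c \<ge> L" using L unfolding c_def by linarith+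
    moreover have "real p = c + 3" by (simp add: p_def c_def)
    ultimately show "real p \<ge> L + 3" "real p \<le> 4 * (1 + L)" using L by simp_all
  qed
  define B where "B = \<alpha> * \<beta> * (real n)\<^sup>2"
  have B0: "0 \<le> B" using \<alpha> \<beta> by (simp add: B_def)
  have "measure M E \<le> 2 * exp (- 2 * real p)"
  proof (rule symmetrization[OF P Em, where Q = "E \<times> G"])
    show "E \<times> G \<in> sets (M \<Otimes>\<^sub>M M)" using Em Gm by auto
    fix X assume "X \<in> E"
    then have "{Y \<in> space M. (X, Y) \<in> E \<times> G} = G" by (auto simp: G_def)
    then show "1/2 \<le> measure M {Y \<in> space M. (X, Y) \<in> E \<times> G}" using good_prob by (simp add: G_def)
  next
    fix X Y assume XY: "X \<in> space M" "Y \<in> space M"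
    let ?C = "{S \<in> Pow {..<n}. (mix S X Y, mix S Y X) \<in> E \<times> G}"
    show "real (card ?C) \<le> exp (- 2 * real p) * 2 ^ n"
    proof (cases "?C = {}")
      case True
      show ?thesis unfolding True by simp
    next
      case False
      then obtain S0 where S0: "mix S0 X Y \<in> E" "mix S0 Y X \<in> G" by auto
      let ?X0 = "mix S0 X Y" and ?Y0 = "mix S0 Y X"
      have "selectable ?X0" using S0(1) by (simp add: E_def)
      then obtain I where I: "I \<subseteq> {..<n}" "card ({..<n} - I) < nat \<lfloor>\<alpha> * real n / 4\<rfloor>"
        "\<And>r. r \<in> crit \<Longrightarrow> (\<Sum>i\<in>I. fst r (?X0 i)) \<le> 2 * snd r"
        unfolding selectable_def by blast
      have gd: "good ?Y0" using S0(2) by (simp add: G_def)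
      have crit3: "(\<Sum>i\<in>J. fst r (X i) + fst r (Y i)) \<le> 3 * snd r" if "r \<in> crit" "J \<subseteq> I" for r J
      proof -
        have "(\<Sum>i\<in>J. fst r (X i) + fst r (Y i)) \<le> (\<Sum>i\<in>I. fst r (X i) + fst r (Y i))"
          using that crit_props(2)[OF that(1)] finite_subset[OF I(1)]
          by (intro sum_mono2) (auto intro: add_nonneg_nonneg)
        also have "\<dots> = (\<Sum>i\<in>I. fst r (?X0 i)) + (\<Sum>i\<in>I. fst r (?Y0 i))"
          by (simp add: mix_sum[of "fst r"] flip: sum.distrib)
        also have "(\<Sum>i\<in>I. fst r (?Y0 i)) \<le> (\<Sum>i<n. fst r (?Y0 i))"
          using I(1) crit_props(2)[OF that(1)] by (intro sum_mono2) auto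
        also have "\<dots> \<le> snd r" by (rule good_crit[OF gd that(1)])
        finally show ?thesis using I(3)[OF that(1)] by simp
      qed
      \<comment> \<open>Indices bad in either sample are dropped, so that no exchange brings a bad
        point into \<open>J\<close>. The bad points of both samples number at most
        \<open>3 \<alpha> n / 4\<close> within \<open>I\<close>, which together with the complement
        of \<open>I\<close> stays within \<alpha> n.\<close>
      define J where "J = {i \<in> I. X i \<notin> Bad \<and> Y i \<notin> Bad}"
      have J: "J \<subseteq> I" "J \<subseteq> {..<n}" using I(1) by (auto simp: J_def)
      have finI: "finite I" and finJ: "finite J" using finite_subset[OF I(1)] finite_subset[OF J(2)] by auto
      have cardJ: "real (card ({..<n} - J)) \<le> \<alpha> * real n"
      proof -
        have "real (card (I - J)) = (\<Sum>i\<in>I - J. 1)" by simp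
        also have "\<dots> \<le> (\<Sum>i\<in>I - J. indicat_real Bad (X i) + indicat_real Bad (Y i))"
          by (intro sum_mono) (auto simp: J_def indicator_def)
        also have "\<dots> \<le> 3 * (\<alpha> * real n / 4)"
          using crit3[of "(indicat_real Bad, \<alpha> * real n / 4)" "I - J"] by (auto simp: crit_def)
        finally have 1: "real (card (I - J)) \<le> 3 * (\<alpha> * real n / 4)" .
        have "{..<n} - J = ({..<n} - I) \<union> (I - J)" using J I by auto
        then have "card ({..<n} - J) \<le> card ({..<n} - I) + card (I - J)" by (simp add: card_Un_le)
        then have "real (card ({..<n} - J)) \<le> real (card ({..<n} - I)) + real (card (I - J))"
          by (metis of_nat_add of_nat_mono)
        moreover have "real (card ({..<n} - I)) \<le> \<alpha> * real n / 4" using I(2) by linarith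
        ultimately show ?thesis using 1 by linarith
      qed
      have excessJ: "(\<Sum>i\<in>J. excess u (X i) + excess u (Y i)) \<le> 4801389 * \<beta> * real n" if "u \<in> net d" for u
        using crit3[of "(excess u, 1600463 * \<beta> * real n)" J] that J by (auto simp: crit_def)
      have ynormJ: "(\<Sum>i\<in>J. ynorm (X i) + ynorm (Y i)) \<le> 60 * (real n * real d)"
        using crit3[of "(ynorm, 20 * (real n * real d))" J] J by (auto simp: crit_def)
      \<comment> \<open>The clipped parts give at most \<open>n + 460 \<beta> n\<close> for each
        sample, and the joint excess is added: 4802309 = 4801389 + 2 * 460.\<close>
      define m where "m = 2 * real n + 4802309 * \<beta> * real n"
      have m0: "0 \<le> m" using \<beta> by (simp add: m_def)
      have energyJ: "(\<Sum>i\<in>J. energy u (X i) + energy u (Y i)) \<le> m" if u: "u \<in> net d" for u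
      proof -
        have "(\<Sum>i\<in>J. psi u (X i) + psi u (Y i)) \<le> (\<Sum>i<n. psi u (X i) + psi u (Y i))"
          using J psi_bounds(1) by (intro sum_mono2) (auto intro: add_nonneg_nonneg)
        also have "\<dots> = (\<Sum>i<n. psi u (?X0 i)) + (\<Sum>i<n. psi u (?Y0 i))"
          by (simp add: mix_sum[of "psi u"] flip: sum.distrib)
        also have "\<dots> \<le> 2 * real n + 920 * \<beta> * real n"
        proof -
          have "real n * (\<integral>x. psi u x \<partial>P) \<le> real n"
            using psi_expectation_le[of u] net_le_1[OF u] by (simp add: mult_left_le)
          moreover have "dev (psi u) ?X0 \<le> 460 * \<beta> * real n" "dev (psi u) ?Y0 \<le> 460 * \<beta> * real n"
            using S0(1) gd u by (auto simp: E_def good_def)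
          ultimately show ?thesis unfolding dev_def by linarith
        qed
        finally have 1: "(\<Sum>i\<in>J. psi u (X i) + psi u (Y i)) \<le> 2 * real n + 920 * \<beta> * real n" .
        have "(\<Sum>i\<in>J. energy u (X i) + energy u (Y i))
          = (\<Sum>i\<in>J. psi u (X i) + psi u (Y i)) + (\<Sum>i\<in>J. excess u (X i) + excess u (Y i))"
          by (simp add: excess_def algebra_simps flip: sum.distrib)
        then show ?thesis using 1 excessJ[OF u] by (simp add: m_def)
      qed
      \<comment> \<open>Extension by zero: the signs range over all subsets of
        \<open>{..<n}\<close>, while only the indices in \<open>J\<close> contribute.\<close>
      define a where "a i = (if i \<in> J then (\<lambda>j. y (X i) j - y (Y i) j) else (\<lambda>_. 0))" for i
      have restr: "(\<Sum>i<n. f (a i)) = (\<Sum>i\<in>J. f (\<lambda>j. y (X i) j - y (Y i) j))" if "f (\<lambda>_. 0) = 0" for f :: "_ \<Rightarrow> real"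
      proof -
        have "(\<Sum>i<n. f (a i)) = (\<Sum>i\<in>J. f (a i))"
          using J that by (intro sum.mono_neutral_right) (auto simp: a_def)
        then show ?thesis by (simp add: a_def)
      qed
      have lam: "(\<Sum>i<n. (inner_vec d (a i) v)\<^sup>2) \<le> 8 * m * inner_vec d v v" for v
      proof -
        have sp: "(\<Sum>i\<in>J. energy v (Z i)) \<le> 2 * m * inner_vec d v v" if "Z = X \<or> Z = Y" for Z
        proof (rule sum_energy_le_net)
          fix u assume u: "u \<in> net d"
          have "(\<Sum>i\<in>J. energy u (Z i)) \<le> (\<Sum>i\<in>J. energy u (X i) + energy u (Y i))"
            using that by (intro sum_mono) auto
          then show "(\<Sum>i\<in>J. energy u (Z i)) \<le> m" using energyJ[OF u] by linarith
        qed
        have "(\<Sum>i<n. (inner_vec d (a i) v)\<^sup>2) = (\<Sum>i\<in>J. (inner_vec d (y (X i)) v - inner_vec d (y (Y i)) v)\<^sup>2)"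
          by (subst restr) (simp_all add: inner_vec_diff inner_vec_def)
        also have "\<dots> \<le> (\<Sum>i\<in>J. 2 * energy v (X i) + 2 * energy v (Y i))"
        proof (rule sum_mono)
          fix i
          show "(inner_vec d (y (X i)) v - inner_vec d (y (Y i)) v)\<^sup>2 \<le> 2 * energy v (X i) + 2 * energy v (Y i)"
            using zero_le_power2[of "inner_vec d (y (X i)) v + inner_vec d (y (Y i)) v"]
            by (simp add: power2_eq_square algebra_simps)
        qed
        also have "\<dots> = 2 * (\<Sum>i\<in>J. energy v (X i)) + 2 * (\<Sum>i\<in>J. energy v (Y i))"
          by (simp add: sum.distrib sum_distrib_left)
        finally show ?thesis using sp[of X] sp[of Y] by (simp add: algebra_simps)
      qed
      have T: "(\<Sum>i<n. inner_vec d (a i) (a i)) \<le> 120 * (real n * real d)"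
      proof -
        have "(\<Sum>i<n. inner_vec d (a i) (a i)) = (\<Sum>i\<in>J. inner_vec d (\<lambda>j. y (X i) j - y (Y i) j) (\<lambda>j. y (X i) j - y (Y i) j))"
          by (rule restr[of "\<lambda>w. inner_vec d w w"]) (simp add: inner_vec_def)
        also have "\<dots> \<le> (\<Sum>i\<in>J. 2 * ynorm (X i) + 2 * ynorm (Y i))" by (intro sum_mono inner_vec_diff_le)
        also have "\<dots> = 2 * (\<Sum>i\<in>J. ynorm (X i) + ynorm (Y i))" by (simp add: sum.distrib sum_distrib_left)
        finally show ?thesis using ynormJ by linarith
      qed
      \<comment> \<open>The contributions \<open>n d\<close>, \<open>(1 + L) n\<close> and
        \<open>(1 + L) \<beta> n\<close> are each at most \<open>B\<close>, the first two by
        \<open>large1\<close> and the last by \<open>large2\<close>.\<close>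
      have total: "8 * (120 * (real n * real d) + 4 * real p * (8 * m)) \<le> 4917567424 * B"
      proof -
        have n1: "(1 + L) * real n \<le> B"
          using mult_right_mono[OF d_le(2), of "real n"] by (simp add: B_def power2_eq_square mult_ac)
        have n2: "(1 + L) * (\<beta> * real n) \<le> B"
        proof -
          have "(1 + L) * (\<beta> * real n) \<le> (\<alpha> * real n) * (\<beta> * real n)"
            using large2 L \<beta> by (intro mult_right_mono) auto
          then show ?thesis by (simp add: B_def power2_eq_square mult_ac)
        qed
        have "real p * m \<le> 4 * (1 + L) * m" using p m0 by (intro mult_right_mono) auto
        also have "\<dots> = 8 * ((1 + L) * real n) + 19209236 * ((1 + L) * (\<beta> * real n))"
          by (simp add: m_def algebra_simps)
        finally have "real p * m \<le> 19209244 * B" using n1 n2 by linarith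
        then show ?thesis using nd_le by (simp add: B_def[symmetric])
      qed
      have "?C \<subseteq> {S \<in> Pow {..<n}. inner_vec d (rsum {..<n} a S) (rsum {..<n} a S) > 8 * (120 * (real n * real d) + 4 * real p * (8 * m))}"
      proof
        fix S assume S: "S \<in> ?C"
        let ?X = "mix S X Y" and ?Y = "mix S Y X"
        have gS: "good ?Y" and nk: "\<not> kept ?X J" using S J by (auto simp: G_def E_def)
        have rs: "rsum {..<n} a S = (\<lambda>j. ysum J ?X j - ysum J ?Y j)"
        proof
          fix j
          have "rsum {..<n} a S j = (\<Sum>i\<in>J. sg S i * a i j)"
            unfolding rsum_def using J by (intro sum.mono_neutral_right) (auto simp: a_def)
          also have "\<dots> = (\<Sum>i\<in>J. sg S i * (y (X i) j - y (Y i) j))" by (simp add: a_def)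
          also have "\<dots> = (\<Sum>i\<in>J. y (?X i) j - y (?Y i) j)" by (simp only: mix_diff[of "\<lambda>x. y x j"])
          finally show "rsum {..<n} a S j = ysum J ?X j - ysum J ?Y j" by (simp add: ysum_def sum_subtractf)
        qed
        \<comment> \<open>Otherwise \<open>J\<close> would satisfy every clause of
          \<open>kept\<close>. The level \<open>10 ^ 10\<close> exceeds twice 4917567424 plus twice
          6401952, the bounds for the Rademacher sum and the ghost.\<close>
        have "sumsq J ?X > 10 ^ 10 * B"
        proof (rule ccontr)
          assume "\<not> ?thesis"
          then have sq: "sumsq J ?X \<le> 10 ^ 10 * (\<alpha> * \<beta> * (real n)\<^sup>2)" by (simp add: B_def)
          have "?X i \<notin> Bad" if "i \<in> J" for i using that by (auto simp: J_def mix_def)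
          moreover have "(\<Sum>i\<in>J. excess u (?X i)) \<le> 4801389 * \<beta> * real n" if u: "u \<in> net d" for u
          proof -
            have "(\<Sum>i\<in>J. excess u (?X i)) \<le> (\<Sum>i\<in>J. excess u (X i) + excess u (Y i))"
              using psi_bounds(4) by (intro sum_mono) (auto simp: mix_def)
            then show ?thesis using excessJ[OF u] by linarith
          qed
          ultimately have "kept ?X J" using cardJ sq by (auto simp: kept_def)
          then show False using nk by simp
        qed
        moreover have "sumsq J ?Y \<le> 6401952 * B"
        proof -
          have "sumsq J ?Y \<le> 2 * sumsq {..<n} ?Y + 2 * sumsq ({..<n} - J) ?Y" using J by (intro sumsq_subset_le) auto
          moreover have "sumsq {..<n} ?Y \<le> 48 * B" using gS by (simp add: good_def B_def)
          moreover have "sumsq ({..<n} - J) ?Y \<le> 2 * 1 * (1 + 1600463) * (\<alpha> * \<beta> * (real n)\<^sup>2)"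
          proof (rule sumsq_le_of_excess)
            fix u assume u: "u \<in> net d"
            have "(\<Sum>i\<in>{..<n} - J. excess u (?Y i)) \<le> (\<Sum>i<n. excess u (?Y i))"
              using psi_bounds(4) by (intro sum_mono2) auto
            then show "(\<Sum>i\<in>{..<n} - J. excess u (?Y i)) \<le> 1600463 * \<beta> * real n" using good_excess[OF gS u] by linarith
          qed (use cardJ in auto)
          ultimately show ?thesis by (simp add: B_def)
        qed
        moreover have "sumsq J ?X \<le> 2 * inner_vec d (rsum {..<n} a S) (rsum {..<n} a S) + 2 * sumsq J ?Y"
        proof -
          have "ysum J ?X = (\<lambda>j. rsum {..<n} a S j + ysum J ?Y j)" by (simp add: rs)
          then show ?thesis using inner_vec_add_le[of d "rsum {..<n} a S" "ysum J ?Y"] by simp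
        qed
        ultimately show "S \<in> {S \<in> Pow {..<n}. inner_vec d (rsum {..<n} a S) (rsum {..<n} a S) > 8 * (120 * (real n * real d) + 4 * real p * (8 * m))}"
          using total S B0 by auto
      qed
      then have "card ?C \<le> card {S \<in> Pow {..<n}. inner_vec d (rsum {..<n} a S) (rsum {..<n} a S) > 8 * (120 * (real n * real d) + 4 * real p * (8 * m))}"
        by (intro card_mono) auto
      then have "real (card ?C) \<le> real (card {S \<in> Pow {..<n}. inner_vec d (rsum {..<n} a S) (rsum {..<n} a S) > 8 * (120 * (real n * real d) + 4 * real p * (8 * m))})"
        by (rule of_nat_mono)
      also have "\<dots> \<le> 2 ^ card {..<n} * exp (- 2 * real p)"
        by (rule rademacher_vector_tail) (use lam T m0 in auto)
      finally show ?thesis by (simp add: mult.commute)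
    qed
  qed
  also have "exp (- 2 * real p) \<le> exp (- 5) * exp (- L)" unfolding exp_add[symmetric] using p(1) L by simp
  also have "2 * (exp (- 5) * exp (- L)) \<le> exp (- L) / 10" using mult_right_mono[OF exp_minus_5, of "exp (- L)"] by simp
  finally have PE: "measure M E \<le> exp (- L) / 10" by simp
  let ?S = "{X \<in> space M. \<exists>u\<in>net d. dev (psi u) X > 460 * \<beta> * real n}"
  have Sm: "?S \<in> sets M" by (intro sets.sets_Collect_finite_Ex finite_net dev_sets(2) psi_meas)
  have Nm: "{X \<in> space M. \<not> selectable X} \<in> sets M" by (intro sets.sets_Collect_neg sel_sets)
  have "measure M {X \<in> space M. \<not> ((\<forall>u\<in>net d. dev (psi u) X \<le> 460 * \<beta> * real n) \<and> (\<exists>J\<in>Pow {..<n}. kept X J))}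
     \<le> measure M (?S \<union> ({X \<in> space M. \<not> selectable X} \<union> E))"
    by (rule M.finite_measure_mono) (use Sm Nm Em in \<open>auto simp: E_def not_le\<close>)
  also have "\<dots> \<le> measure M ?S + (measure M {X \<in> space M. \<not> selectable X} + measure M E)"
    using Sm Nm Em by (intro order_trans[OF measure_Un_le] add_left_mono sets.Un order_refl)
  also have "\<dots> \<le> exp (- L) / 10 + (exp (- L) / 10 + exp (- L) / 10)"
    by (intro add_mono clipped_deviation selectable_prob PE)
  also have "\<dots> \<le> exp (- L)" by simp
  finally show ?thesis .
qed

text \<open>A further deletion changes the clipped sums by at most \<theta> per point and the vector
  sum as in \<open>sumsq_le_of_excess\<close>, while excess sums can only decrease. The allowance
  \<open>3 \<alpha> n\<close> covers the \<alpha> n points missing from \<open>J\<close> and the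
  \<open>2 \<alpha> n\<close> that stability may remove.\<close>

lemma kept_stable:
  assumes dv: "\<And>u. u \<in> net d \<Longrightarrow> dev (psi u) X \<le> 460 * \<beta> * real n" and k: "kept X J" "J \<subseteq> {..<n}"
    and J': "J' \<subseteq> J" "real (card ({..<n} - J')) \<le> 3 * (\<alpha> * real n)"
  shows "\<bar>(\<Sum>i\<in>J'. energy v (X i)) - real n * inner_vec d v v\<bar> \<le> 10 ^ 7 * \<beta> * real n * inner_vec d v v"
    and "sumsq J' X \<le> 10 ^ 11 * (\<alpha> * \<beta> * (real n)\<^sup>2)"
proof -
  have finJ: "finite J" using finite_subset[OF k(2)] by simp
  have ex: "(\<Sum>i\<in>K. excess u (X i)) \<le> 4801389 * \<beta> * real n" if "u \<in> net d" "K \<subseteq> J" for u K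
  proof -
    have "(\<Sum>i\<in>K. excess u (X i)) \<le> (\<Sum>i\<in>J. excess u (X i))" using that psi_bounds(4) finJ by (intro sum_mono2) auto
    then show ?thesis using k(1) that(1) unfolding kept_def by force
  qed
  have "\<bar>qform d J' (\<lambda>i. y (X i)) (real n) u\<bar> \<le> 4801389 * \<beta> * real n + 463 * \<beta> * real n" if u: "u \<in> net d" for u
  proof -
    have sp: "(\<Sum>i<n. psi u (X i)) = (\<Sum>i\<in>J'. psi u (X i)) + (\<Sum>i\<in>{..<n} - J'. psi u (X i))"
      using J'(1) k(2) by (subst sum.subset_diff[of J']) auto
    have "(\<Sum>i\<in>{..<n} - J'. psi u (X i)) \<le> (\<Sum>i\<in>{..<n} - J'. \<theta>)" by (intro sum_mono psi_bounds)
    also have "\<dots> \<le> 3 * (\<alpha> * real n) * \<theta>" using J'(2) \<theta>(1) by (simp add: mult_right_mono)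
    also have "\<dots> = 3 * real n * (\<theta> * \<alpha>)" by simp
    also have "\<dots> \<le> 3 * real n * \<beta>" using \<theta>\<alpha> by (intro mult_left_mono) auto
    finally have rem: "(\<Sum>i\<in>{..<n} - J'. psi u (X i)) \<le> 3 * \<beta> * real n" by (simp add: mult_ac)
    have rem0: "0 \<le> (\<Sum>i\<in>{..<n} - J'. psi u (X i))" by (intro sum_nonneg psi_bounds)
    have ex0: "0 \<le> (\<Sum>i\<in>J'. excess u (X i))" by (intro sum_nonneg psi_bounds)
    have "real n * (\<integral>x. psi u x \<partial>P) \<le> real n * inner_vec d u u" using psi_expectation_le by (intro mult_left_mono) auto
    moreover have "real n * (inner_vec d u u - 3 * \<beta>) \<le> real n * (\<integral>x. psi u x \<partial>P)"
      using psi_expectation_ge[OF net_le_1[OF u]] by (intro mult_left_mono) auto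
    moreover have "real n * (inner_vec d u u - 3 * \<beta>) = real n * inner_vec d u u - 3 * \<beta> * real n" by (simp add: algebra_simps)
    moreover have "(\<Sum>i\<in>J'. energy u (X i)) = (\<Sum>i\<in>J'. psi u (X i)) + (\<Sum>i\<in>J'. excess u (X i))"
      by (simp add: excess_def flip: sum.distrib)
    moreover have "0 \<le> \<beta> * real n" using \<beta> by simp
    ultimately show ?thesis
      using dv[OF u] ex[OF u J'(1)] rem rem0 ex0 sp unfolding qform_def dev_def by linarith
  qed
  then have "\<bar>qform d J' (\<lambda>i. y (X i)) (real n) v\<bar> \<le> 2 * (4801389 * \<beta> * real n + 463 * \<beta> * real n) * inner_vec d v v"
    by (rule qform_le_twice_net[OF d])
  also have "\<dots> \<le> 10 ^ 7 * \<beta> * real n * inner_vec d v v"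
    using \<beta> by (intro mult_right_mono) (auto simp: algebra_simps)
  finally show "\<bar>(\<Sum>i\<in>J'. energy v (X i)) - real n * inner_vec d v v\<bar> \<le> 10 ^ 7 * \<beta> * real n * inner_vec d v v"
    by (simp add: qform_def)
  have "sumsq (J - J') X \<le> 2 * 3 * (3 + 4801389) * (\<alpha> * \<beta> * (real n)\<^sup>2)"
  proof (rule sumsq_le_of_excess)
    have "card (J - J') \<le> card ({..<n} - J')" using k(2) by (intro card_mono) auto
    then show "real (card (J - J')) \<le> 3 * (\<alpha> * real n)" using J'(2) by linarith
  qed (use ex in auto)
  moreover have "sumsq J' X \<le> 2 * sumsq J X + 2 * sumsq (J - J') X" using J'(1) finJ by (rule sumsq_subset_le)
  moreover have "sumsq J X \<le> 10 ^ 10 * (\<alpha> * \<beta> * (real n)\<^sup>2)" using k(1) by (simp add: kept_def)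
  moreover have "0 \<le> \<alpha> * \<beta> * (real n)\<^sup>2" using \<alpha> \<beta> by simp
  ultimately show "sumsq J' X \<le> 10 ^ 11 * (\<alpha> * \<beta> * (real n)\<^sup>2)" by simp
qed

end

section \<open>Spectral norm and stability\<close>

text \<open>A crude bound with two uses: the supremum in \<open>spectral_norm\<close> is taken over
  a set bounded above, and the numerator vanishes with the denominator, so that the value
  \<open>0 / 0 = 0\<close> is harmless.\<close>

lemma L2_set_mat_vec_le:
  "L2_set (mat_vec d A v) {..<d} \<le> (\<Sum>i<d. \<Sum>j<d. \<bar>A i j\<bar>) * L2_set v {..<d}"
proof -
  have "L2_set (mat_vec d A v) {..<d} \<le> (\<Sum>i<d. \<bar>mat_vec d A v i\<bar>)" by (rule L2_set_le_sum_abs)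
  also have "\<dots> \<le> (\<Sum>i<d. \<Sum>j<d. \<bar>A i j\<bar> * L2_set v {..<d})"
  proof (rule sum_mono)
    fix i
    have "\<bar>mat_vec d A v i\<bar> \<le> (\<Sum>j<d. \<bar>A i j * v j\<bar>)" unfolding mat_vec_def by (rule sum_abs)
    also have "\<dots> \<le> (\<Sum>j<d. \<bar>A i j\<bar> * L2_set v {..<d})"
    proof (rule sum_mono)
      fix j assume "j \<in> {..<d}"
      then have "\<bar>v j\<bar> \<le> L2_set (\<lambda>j. \<bar>v j\<bar>) {..<d}" by (intro member_le_L2_set) auto
      then have "\<bar>v j\<bar> \<le> L2_set v {..<d}" by (simp add: L2_set_def)
      then show "\<bar>A i j * v j\<bar> \<le> \<bar>A i j\<bar> * L2_set v {..<d}" by (simp add: abs_mult mult_left_mono)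
    qed
    finally show "\<bar>mat_vec d A v i\<bar> \<le> (\<Sum>j<d. \<bar>A i j\<bar> * L2_set v {..<d})" .
  qed
  finally show ?thesis by (simp add: sum_distrib_right)
qed

lemma spectral_norm_le_iff:
  assumes "0 \<le> c"
  shows "spectral_norm d A \<le> c \<longleftrightarrow> (\<forall>v. L2_set (mat_vec d A v) {..<d} \<le> c * L2_set v {..<d})"
proof -
  let ?K = "\<Sum>i<d. \<Sum>j<d. \<bar>A i j\<bar>"
  let ?r = "\<lambda>v. L2_set (mat_vec d A v) {..<d} / L2_set v {..<d}"
  have K0: "0 \<le> ?K" by (intro sum_nonneg) auto
  have div: "?r v \<le> k \<longleftrightarrow> L2_set (mat_vec d A v) {..<d} \<le> k * L2_set v {..<d}" if "0 \<le> k" for k v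
  proof (cases "L2_set v {..<d} = 0")
    case True
    then have "L2_set (mat_vec d A v) {..<d} \<le> 0" using L2_set_mat_vec_le[of d A v] by simp
    then show ?thesis using True that by simp
  next
    case False
    then have "L2_set v {..<d} > 0" using L2_set_nonneg[of v "{..<d}"] by linarith
    then show ?thesis by (simp add: divide_le_eq)
  qed
  have "bdd_above (range ?r)"
    by (rule bdd_aboveI[of _ ?K]) (use div[OF K0] L2_set_mat_vec_le in auto)
  then have "(SUP v. ?r v) \<le> c \<longleftrightarrow> (\<forall>v. ?r v \<le> c)" by (simp add: cSUP_le_iff)
  then show ?thesis unfolding spectral_norm_def using div[OF assms] by simp
qed

text \<open>Rational vectors suffice; this makes the spectral norm of a random matrix measurable.\<close>

lemma spectral_norm_le_iff_rational:
  assumes c: "0 \<le> c"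
  shows "spectral_norm d A \<le> c \<longleftrightarrow>
    (\<forall>v\<in>{..<d} \<rightarrow>\<^sub>E \<rat>. L2_set (mat_vec d A v) {..<d} \<le> c * L2_set v {..<d})"
proof (rule iffI)
  assume R: "\<forall>v\<in>{..<d} \<rightarrow>\<^sub>E \<rat>. L2_set (mat_vec d A v) {..<d} \<le> c * L2_set v {..<d}"
  let ?K = "\<Sum>i<d. \<Sum>j<d. \<bar>A i j\<bar>"
  have K0: "0 \<le> ?K" by (intro sum_nonneg) auto
  show "spectral_norm d A \<le> c"
    unfolding spectral_norm_le_iff[OF c]
  proof
    fix v
    show "L2_set (mat_vec d A v) {..<d} \<le> c * L2_set v {..<d}"
    proof (rule field_le_epsilon)
      fix e :: real assume e: "0 < e"
      define \<eta> where "\<eta> = e / ((c + ?K) * real d + 1)"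
      have den: "(c + ?K) * real d + 1 > 0" using c K0 by (simp add: add_nonneg_pos)
      have \<eta>: "0 < \<eta>" using e den by (simp add: \<eta>_def)
      have "\<exists>r\<in>\<rat>. \<bar>v i - r\<bar> < \<eta>" for i
      proof -
        obtain r where "r \<in> \<rat>" "v i < r" "r < v i + \<eta>" using Rats_dense_in_real[of "v i" "v i + \<eta>"] \<eta> by auto
        then show ?thesis by (intro bexI[of _ r]) auto
      qed
      then obtain r where r: "\<And>i. r i \<in> \<rat>" "\<And>i. \<bar>v i - r i\<bar> < \<eta>" by metis
      define w where "w = restrict r {..<d}"
      have w: "w \<in> {..<d} \<rightarrow>\<^sub>E \<rat>" using r by (auto simp: w_def)
      let ?N = "\<lambda>v. L2_set v {..<d}"
      let ?D = "\<lambda>i. v i - w i"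
      have D: "?N ?D \<le> real d * \<eta>"
      proof -
        have "?N ?D \<le> (\<Sum>i<d. \<bar>?D i\<bar>)" by (rule L2_set_le_sum_abs)
        also have "\<dots> \<le> (\<Sum>i<d. \<eta>)" by (intro sum_mono) (use r in \<open>auto simp: w_def intro: less_imp_le\<close>)
        finally show ?thesis by simp
      qed
      have split: "mat_vec d A v = (\<lambda>i. mat_vec d A w i + mat_vec d A ?D i)"
        by (simp add: mat_vec_def fun_eq_iff right_diff_distrib flip: sum.distrib)
      have "?N (mat_vec d A v) \<le> ?N (mat_vec d A w) + ?N (mat_vec d A ?D)"
        unfolding split by (rule L2_set_triangle_ineq)
      also have "\<dots> \<le> c * ?N w + ?K * ?N ?D" using R w L2_set_mat_vec_le by (intro add_mono) auto
      also have "c * ?N w \<le> c * (?N v + ?N ?D)"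
      proof (rule mult_left_mono[OF _ c])
        have "?N w = ?N (\<lambda>i. v i + - ?D i)" by simp
        also have "\<dots> \<le> ?N v + ?N (\<lambda>i. - ?D i)" by (rule L2_set_triangle_ineq)
        also have "?N (\<lambda>i. - ?D i) = ?N ?D" by (simp add: L2_set_def power2_commute)
        finally show "?N w \<le> ?N v + ?N ?D" .
      qed
      finally have "?N (mat_vec d A v) \<le> c * ?N v + (c + ?K) * ?N ?D" by (simp add: algebra_simps)
      also have "(c + ?K) * ?N ?D \<le> (c + ?K) * (real d * \<eta>)" using D c K0 by (intro mult_left_mono) auto
      also have "\<dots> \<le> ((c + ?K) * real d + 1) * \<eta>" using \<eta> by (simp add: algebra_simps)
      also have "\<dots> = e" using den by (simp add: \<eta>_def)
      finally show "?N (mat_vec d A v) \<le> c * ?N v + e" by simp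
    qed
  qed
qed (use spectral_norm_le_iff[OF c] in blast)

text \<open>Quantification over submultisets becomes quantification over finitely many index sets,
  independent of the sample; this is the form in which stability events can be shown
  measurable.\<close>

lemma subseteq_image_mset_set_iff:
  assumes "finite I"
  shows "S \<subseteq># image_mset f (mset_set I) \<longleftrightarrow> (\<exists>J\<subseteq>I. S = image_mset f (mset_set J))"
proof
  show "S \<subseteq># image_mset f (mset_set I) \<Longrightarrow> \<exists>J\<subseteq>I. S = image_mset f (mset_set J)"
    using assms
  proof (induction I arbitrary: S rule: finite_induct)
    case (insert x I)
    then have S: "S \<subseteq># add_mset (f x) (image_mset f (mset_set I))" by simp
    show ?case
    proof (cases "f x \<in># S")
      case True
      then obtain T where T: "S = add_mset (f x) T" by (metis insert_DiffM)
      then obtain J where J: "J \<subseteq> I" "T = image_mset f (mset_set J)" using S insert.IH by auto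
      have "finite J" "x \<notin> J" using J(1) insert.hyps finite_subset by auto
      then show ?thesis using J T by (intro exI[of _ "insert x J"]) auto
    next
      case False
      then have "S \<subseteq># image_mset f (mset_set I)" using S
        by (metis (no_types, lifting) add_mset_remove_trivial diff_single_trivial mset_subset_eq_multiset_union_diff_commute
            subset_eq_diff_conv union_single_eq_member add_mset_add_single)
      then show ?thesis using insert.IH by blast
    qed
  qed simp
next
  assume "\<exists>J\<subseteq>I. S = image_mset f (mset_set J)"
  then show "S \<subseteq># image_mset f (mset_set I)"
    using assms by (auto intro!: image_mset_subseteq_mono subset_imp_msubset_mset_set)
qed

lemma samples_subset_iff: "S \<subseteq># samples n X \<longleftrightarrow> (\<exists>J\<subseteq>{..<n}. S = image_mset X (mset_set J))"
  unfolding samples_def by (rule subseteq_image_mset_set_iff) simp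

lemma sample_mean_image: "sample_mean (image_mset X (mset_set J)) i = (\<Sum>k\<in>J. X k i) / real (card J)"
  by (simp add: sample_mean_def sum_unfold_sum_mset image_mset.compositionality comp_def)

lemma sample_second_moment_image:
  "sample_second_moment \<mu> (image_mset X (mset_set J)) i j = (\<Sum>k\<in>J. (X k i - \<mu> i) * (X k j - \<mu> j)) / real (card J)"
  by (simp add: sample_second_moment_def sum_unfold_sum_mset image_mset.compositionality comp_def)

lemma stable_image_iff:
  assumes "finite J"
  shows "stable_multiset d \<epsilon> \<delta> (image_mset X (mset_set J)) \<mu> 1 \<longleftrightarrow>
     0 < \<epsilon> \<and> \<epsilon> < 1/2 \<and> \<delta> \<ge> \<epsilon> \<and>
     (\<forall>J'\<in>Pow J. real (card J') \<ge> (1 - \<epsilon>) * real (card J) \<longrightarrow>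
        L2_set (\<lambda>i. (\<Sum>k\<in>J'. X k i) / real (card J') - \<mu> i) {..<d} \<le> \<delta> \<and>
        spectral_norm d (\<lambda>i j. (\<Sum>k\<in>J'. (X k i - \<mu> i) * (X k j - \<mu> j)) / real (card J') - id_mat i j)
          \<le> \<delta>\<^sup>2 / \<epsilon>)"
proof -
  let ?g = "\<lambda>J. image_mset X (mset_set J)"
  have "stable_multiset d \<epsilon> \<delta> (?g J) \<mu> 1 \<longleftrightarrow> 0 < \<epsilon> \<and> \<epsilon> < 1/2 \<and> \<delta> \<ge> \<epsilon> \<and>
     (\<forall>J'\<in>Pow J. real (size (?g J')) \<ge> (1 - \<epsilon>) * real (size (?g J)) \<longrightarrow>
        L2_set (\<lambda>i. sample_mean (?g J') i - \<mu> i) {..<d} \<le> 1 * \<delta> \<and>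
        spectral_norm d (\<lambda>i j. sample_second_moment \<mu> (?g J') i j - 1\<^sup>2 * id_mat i j) \<le> 1\<^sup>2 * \<delta>\<^sup>2 / \<epsilon>)"
    unfolding stable_multiset_def subseteq_image_mset_set_iff[OF assms] by blast
  then show ?thesis by (simp add: sample_mean_image sample_second_moment_image)
qed

lemma borel_measurable_L2_set:
  assumes "\<And>i. i \<in> I \<Longrightarrow> f i \<in> borel_measurable M"
  shows "(\<lambda>x. L2_set (\<lambda>i. f i x) I) \<in> borel_measurable M"
  unfolding L2_set_def using assms by measurable

text \<open>\<open>measure\<close> is 0 on sets outside the \<sigma>-algebra, so a positive lower
  bound for the probability of the event presupposes its measurability.\<close>

lemma stable_event_sets:
  fixes n d :: nat and \<epsilon> :: real
  assumes P: "sets P = sets (Pi\<^sub>M {..<d} (\<lambda>_. borel :: real measure))" and \<epsilon>: "0 < \<epsilon>"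
  defines "M \<equiv> Pi\<^sub>M {..<n} (\<lambda>_. P)"
  shows "{X \<in> space M. \<exists>S'. S' \<subseteq># samples n X \<and> real (size S') \<ge> c \<and> stable_multiset d \<epsilon> \<delta> S' \<mu> 1} \<in> sets M"
proof -
  have coord: "(\<lambda>X. X k i) \<in> borel_measurable M" if "k < n" "i < d" for k i
  proof -
    have "(\<lambda>x. x i) \<in> Pi\<^sub>M {..<d} (\<lambda>_. borel :: real measure) \<rightarrow>\<^sub>M borel"
      using that by (intro measurable_component_singleton) auto
    then have 1: "(\<lambda>x. x i) \<in> P \<rightarrow>\<^sub>M (borel :: real measure)" using measurable_cong_sets[OF P refl] by blast
    have "(\<lambda>X. X k) \<in> M \<rightarrow>\<^sub>M P" unfolding M_def using that by (intro measurable_component_singleton) auto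
    then show ?thesis by (rule measurable_compose[OF _ 1])
  qed
  have le: "{X \<in> space M. f X \<le> g X} \<in> sets M" if "f \<in> borel_measurable M" "g \<in> borel_measurable M" for f g :: "_ \<Rightarrow> real"
    using that by measurable
  have mean: "{X \<in> space M. L2_set (\<lambda>i. (\<Sum>k\<in>J. X k i) / real (card J) - \<mu> i) {..<d} \<le> \<delta>} \<in> sets M"
    if J: "J \<subseteq> {..<n}" for J
  proof (rule le)
    have "(\<lambda>X. (\<Sum>k\<in>J. X k i) / real (card J) - \<mu> i) \<in> borel_measurable M" if "i < d" for i
      using J that by (intro borel_measurable_diff borel_measurable_divide borel_measurable_sum coord) auto
    then show "(\<lambda>X. L2_set (\<lambda>i. (\<Sum>k\<in>J. X k i) / real (card J) - \<mu> i) {..<d}) \<in> borel_measurable M"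
      by (intro borel_measurable_L2_set) auto
  qed simp
  have spec: "{X \<in> space M. spectral_norm d (\<lambda>i j. (\<Sum>k\<in>J. (X k i - \<mu> i) * (X k j - \<mu> j)) / real (card J) - id_mat i j) \<le> \<delta>\<^sup>2 / \<epsilon>} \<in> sets M"
    if J: "J \<subseteq> {..<n}" for J
  proof -
    define A where "A X i j = (\<Sum>k\<in>J. (X k i - \<mu> i) * (X k j - \<mu> j)) / real (card J) - id_mat i j" for X and i j :: nat
    have A: "(\<lambda>X. A X i j) \<in> borel_measurable M" if "i < d" "j < d" for i j
      unfolding A_def using J that
      by (intro borel_measurable_diff borel_measurable_divide borel_measurable_sum borel_measurable_times coord borel_measurable_const) auto
    have c0: "0 \<le> \<delta>\<^sup>2 / \<epsilon>" using \<epsilon> by simp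
    have "{X \<in> space M. \<forall>v\<in>{..<d} \<rightarrow>\<^sub>E \<rat>. L2_set (mat_vec d (A X) v) {..<d} \<le> \<delta>\<^sup>2 / \<epsilon> * L2_set v {..<d}} \<in> sets M"
    proof (rule sets.sets_Collect_countable_All')
      fix v :: "nat \<Rightarrow> real"
      have "(\<lambda>X. mat_vec d (A X) v i) \<in> borel_measurable M" if "i < d" for i
        unfolding mat_vec_def using that by (intro borel_measurable_sum borel_measurable_times A) auto
      then have "(\<lambda>X. L2_set (mat_vec d (A X) v) {..<d}) \<in> borel_measurable M"
        by (intro borel_measurable_L2_set) auto
      then show "{X \<in> space M. L2_set (mat_vec d (A X) v) {..<d} \<le> \<delta>\<^sup>2 / \<epsilon> * L2_set v {..<d}} \<in> sets M"
        by (rule le) simp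
    qed (intro countable_PiE countable_rat; simp)
    then show ?thesis unfolding spectral_norm_le_iff_rational[OF c0] A_def .
  qed
  have ev: "{X \<in> space M. \<exists>J\<in>Pow {..<n}. real (card J) \<ge> c \<and> (0 < \<epsilon> \<and> \<epsilon> < 1/2 \<and> \<delta> \<ge> \<epsilon> \<and>
     (\<forall>J'\<in>Pow J. real (card J') \<ge> (1 - \<epsilon>) * real (card J) \<longrightarrow>
        L2_set (\<lambda>i. (\<Sum>k\<in>J'. X k i) / real (card J') - \<mu> i) {..<d} \<le> \<delta> \<and>
        spectral_norm d (\<lambda>i j. (\<Sum>k\<in>J'. (X k i - \<mu> i) * (X k j - \<mu> j)) / real (card J') - id_mat i j)
          \<le> \<delta>\<^sup>2 / \<epsilon>))} \<in> sets M"
    by (intro sets.sets_Collect_finite_Ex sets.sets_Collect_conj sets.sets_Collect_imp sets.sets_Collect_const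
        sets.sets_Collect_finite_All mean spec) (auto intro: finite_subset)
  have iff: "(\<exists>S'. S' \<subseteq># samples n X \<and> real (size S') \<ge> c \<and> stable_multiset d \<epsilon> \<delta> S' \<mu> 1) \<longleftrightarrow>
    (\<exists>J\<in>Pow {..<n}. real (card J) \<ge> c \<and> (0 < \<epsilon> \<and> \<epsilon> < 1/2 \<and> \<delta> \<ge> \<epsilon> \<and>
     (\<forall>J'\<in>Pow J. real (card J') \<ge> (1 - \<epsilon>) * real (card J) \<longrightarrow>
        L2_set (\<lambda>i. (\<Sum>k\<in>J'. X k i) / real (card J') - \<mu> i) {..<d} \<le> \<delta> \<and>
        spectral_norm d (\<lambda>i j. (\<Sum>k\<in>J'. (X k i - \<mu> i) * (X k j - \<mu> j)) / real (card J') - id_mat i j)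
          \<le> \<delta>\<^sup>2 / \<epsilon>)))" for X
  proof -
    have "(\<exists>S'. S' \<subseteq># samples n X \<and> real (size S') \<ge> c \<and> stable_multiset d \<epsilon> \<delta> S' \<mu> 1) \<longleftrightarrow>
      (\<exists>J\<in>Pow {..<n}. real (card J) \<ge> c \<and> stable_multiset d \<epsilon> \<delta> (image_mset X (mset_set J)) \<mu> 1)"
    proof
      assume "\<exists>J\<in>Pow {..<n}. real (card J) \<ge> c \<and> stable_multiset d \<epsilon> \<delta> (image_mset X (mset_set J)) \<mu> 1"
      then obtain J where J: "J \<subseteq> {..<n}" "real (card J) \<ge> c" "stable_multiset d \<epsilon> \<delta> (image_mset X (mset_set J)) \<mu> 1"
        by auto
      then show "\<exists>S'. S' \<subseteq># samples n X \<and> real (size S') \<ge> c \<and> stable_multiset d \<epsilon> \<delta> S' \<mu> 1"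
        unfolding samples_subset_iff by (intro exI[of _ "image_mset X (mset_set J)"]) auto
    qed (auto simp: samples_subset_iff)
    also have "\<dots> \<longleftrightarrow> (\<exists>J\<in>Pow {..<n}. real (card J) \<ge> c \<and> (0 < \<epsilon> \<and> \<epsilon> < 1/2 \<and> \<delta> \<ge> \<epsilon> \<and>
     (\<forall>J'\<in>Pow J. real (card J') \<ge> (1 - \<epsilon>) * real (card J) \<longrightarrow>
        L2_set (\<lambda>i. (\<Sum>k\<in>J'. X k i) / real (card J') - \<mu> i) {..<d} \<le> \<delta> \<and>
        spectral_norm d (\<lambda>i j. (\<Sum>k\<in>J'. (X k i - \<mu> i) * (X k j - \<mu> j)) / real (card J') - id_mat i j)
          \<le> \<delta>\<^sup>2 / \<epsilon>)))"
      by (intro bex_cong refl conj_cong stable_image_iff) (auto intro: finite_subset)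
    finally show ?thesis .
  qed
  show ?thesis unfolding iff by (rule ev)
qed

text \<open>For a symmetric matrix the quadratic form controls the norm: polarize
  \<open><u, A v>\<close> and take \<open>u\<close> in the direction of \<open>A v\<close> with the
  length of \<open>v\<close>; by the parallelogram law the two form values add up to at most
  \<open>4 b |v|^2\<close>.\<close>

lemma L2_set_mat_vec_le_of_form:
  assumes form: "\<And>v. \<bar>qform d J a \<kappa> v\<bar> \<le> b * inner_vec d v v" and m: "m > 0" and b: "0 \<le> b"
    and A: "\<And>v i. i < d \<Longrightarrow> mat_vec d A v i = ((\<Sum>k\<in>J. inner_vec d (a k) v * a k i) - \<kappa> * v i) / m"
  shows "L2_set (mat_vec d A v) {..<d} \<le> b / m * L2_set v {..<d}"
proof -
  let ?w = "mat_vec d A v"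
  let ?N = "\<lambda>v. L2_set v {..<d}"
  have B: "inner_vec d u ?w = (qform d J a \<kappa> (\<lambda>i. u i + v i) - qform d J a \<kappa> (\<lambda>i. u i - v i)) / (4 * m)" for u
  proof -
    have "inner_vec d u ?w = inner_vec d u (\<lambda>i. ((\<Sum>k\<in>J. inner_vec d (a k) v * a k i) - \<kappa> * v i) * (1 / m))"
      unfolding inner_vec_def[of d u] by (rule sum.cong) (simp_all add: A)
    also have "\<dots> = (inner_vec d u (\<lambda>i. \<Sum>k\<in>J. inner_vec d (a k) v * a k i) - \<kappa> * inner_vec d u v) * (1 / m)"
      by (subst mult.commute, subst inner_vec_scale_right, subst inner_vec_diff_right, subst inner_vec_scale_right) simp
    also have "inner_vec d u (\<lambda>i. \<Sum>k\<in>J. inner_vec d (a k) v * a k i) = (\<Sum>k\<in>J. inner_vec d (a k) v * inner_vec d (a k) u)"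
      by (subst inner_vec_commute) (rule inner_vec_lincomb)
    finally have 1: "inner_vec d u ?w = ((\<Sum>k\<in>J. inner_vec d (a k) v * inner_vec d (a k) u) - \<kappa> * inner_vec d u v) * (1 / m)" .
    have 2: "(inner_vec d c (\<lambda>i. u i + v i))\<^sup>2 - (inner_vec d c (\<lambda>i. u i - v i))\<^sup>2 = 4 * (inner_vec d c v * inner_vec d c u)" for c
      by (simp add: inner_vec_add_right inner_vec_diff_right power2_eq_square algebra_simps)
    have 3: "inner_vec d (\<lambda>i. u i + v i) (\<lambda>i. u i + v i) - inner_vec d (\<lambda>i. u i - v i) (\<lambda>i. u i - v i) = 4 * inner_vec d u v"
      unfolding inner_vec_def sum_subtractf[symmetric] sum_distrib_left by (intro sum.cong refl) (simp add: algebra_simps)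
    have "qform d J a \<kappa> (\<lambda>i. u i + v i) - qform d J a \<kappa> (\<lambda>i. u i - v i)
      = (\<Sum>k\<in>J. (inner_vec d (a k) (\<lambda>i. u i + v i))\<^sup>2 - (inner_vec d (a k) (\<lambda>i. u i - v i))\<^sup>2)
        - \<kappa> * (inner_vec d (\<lambda>i. u i + v i) (\<lambda>i. u i + v i) - inner_vec d (\<lambda>i. u i - v i) (\<lambda>i. u i - v i))"
      by (simp add: qform_def sum_subtractf right_diff_distrib)
    also have "\<dots> = 4 * ((\<Sum>k\<in>J. inner_vec d (a k) v * inner_vec d (a k) u) - \<kappa> * inner_vec d u v)"
      unfolding 2 3 by (simp add: sum_distrib_left right_diff_distrib)
    finally have e: "qform d J a \<kappa> (\<lambda>i. u i + v i) - qform d J a \<kappa> (\<lambda>i. u i - v i)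
      = 4 * ((\<Sum>k\<in>J. inner_vec d (a k) v * inner_vec d (a k) u) - \<kappa> * inner_vec d u v)" .
    have "z * (1 / m) = (4 * z) / (4 * m)" for z by simp
    then show ?thesis unfolding 1 e .
  qed
  show ?thesis
  proof (cases "?N ?w = 0")
    case True
    then show ?thesis using b m by simp
  next
    case False
    then have w: "?N ?w > 0" using L2_set_nonneg[of ?w "{..<d}"] by linarith
    have sq: "inner_vec d x x = (?N x)\<^sup>2" for x by (simp add: L2_set_inner_vec)
    define t where "t = ?N v / ?N ?w"
    let ?u = "\<lambda>i. t * ?w i"
    have t0: "0 \<le> t" using w by (simp add: t_def)
    have uw: "inner_vec d ?u ?w = ?N v * ?N ?w"
      unfolding inner_vec_scale sq t_def using w by (simp add: power2_eq_square)
    have uu: "inner_vec d ?u ?u = (?N v)\<^sup>2"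
      unfolding inner_vec_scale inner_vec_scale_right sq t_def using w by (simp add: power2_eq_square)
    have par: "inner_vec d (\<lambda>i. ?u i + v i) (\<lambda>i. ?u i + v i) + inner_vec d (\<lambda>i. ?u i - v i) (\<lambda>i. ?u i - v i)
       = 2 * inner_vec d ?u ?u + 2 * inner_vec d v v"
      unfolding inner_vec_def sum.distrib[symmetric] sum_distrib_left by (intro sum.cong refl) (simp add: algebra_simps)
    have "?N v * ?N ?w * (4 * m) = qform d J a \<kappa> (\<lambda>i. ?u i + v i) - qform d J a \<kappa> (\<lambda>i. ?u i - v i)"
      using B[of ?u] uw m by simp
    also have "\<dots> \<le> b * (inner_vec d (\<lambda>i. ?u i + v i) (\<lambda>i. ?u i + v i) + inner_vec d (\<lambda>i. ?u i - v i) (\<lambda>i. ?u i - v i))"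
      using form[of "\<lambda>i. ?u i + v i"] form[of "\<lambda>i. ?u i - v i"] unfolding distrib_left by linarith
    also have "\<dots> = b * (4 * (?N v)\<^sup>2)" unfolding par uu sq[of v] by simp
    finally have le: "?N v * (?N ?w * m) \<le> ?N v * (b * ?N v)" by (simp add: power2_eq_square algebra_simps)
    have "?N v > 0"
    proof (rule ccontr)
      assume "\<not> ?thesis"
      then have "?N v = 0" using L2_set_nonneg[of v "{..<d}"] by linarith
      then show False using L2_set_mat_vec_le[of d A v] w by simp
    qed
    then have "?N ?w * m \<le> b * ?N v" using le by simp
    then show ?thesis using m by (simp add: field_simps)
  qed
qed

text \<open>Bounds normalized by \<open>n\<close> become bounds normalized by
  \<open>m = card J'\<close>. At most \<open>3 \<alpha> n\<close> points are missing and
  \<open>\<alpha> \<le> 1/8\<close>, so \<open>n \<le> 2 * m\<close>, which gives the factor 4 for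
  \<open>D\<close>. The 8 for \<open>B\<close> consists of a factor 2 from replacing
  \<open>n\<close> by \<open>m\<close> in the quadratic form, 2 from the division by
  \<open>m\<close>, and 2 from the stability parameter \<open>2 * \<alpha>\<close>.\<close>

lemma stable_of_bounds:
  fixes \<alpha> B D \<delta> :: real
  assumes \<alpha>: "0 < \<alpha>" "\<alpha> \<le> 1/8" and n: "n \<ge> 1" and J: "J \<subseteq> {..<n}" "real (card ({..<n} - J)) \<le> \<alpha> * real n"
    and B: "3 * \<alpha> \<le> B" "8 * B * \<alpha> \<le> \<delta>\<^sup>2" and D: "4 * D \<le> \<delta>\<^sup>2" and \<delta>: "2 * \<alpha> \<le> \<delta>"
    and quad: "\<And>J' v. J' \<subseteq> J \<Longrightarrow> real (card ({..<n} - J')) \<le> 3 * (\<alpha> * real n) \<Longrightarrow>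
       \<bar>(\<Sum>k\<in>J'. (inner_vec d (\<lambda>i. X k i - \<mu> i) v)\<^sup>2) - real n * inner_vec d v v\<bar> \<le> B * real n * inner_vec d v v"
    and lin: "\<And>J'. J' \<subseteq> J \<Longrightarrow> real (card ({..<n} - J')) \<le> 3 * (\<alpha> * real n) \<Longrightarrow>
       inner_vec d (\<lambda>i. \<Sum>k\<in>J'. X k i - \<mu> i) (\<lambda>i. \<Sum>k\<in>J'. X k i - \<mu> i) \<le> D * (real n)\<^sup>2"
  shows "\<exists>S'. S' \<subseteq># samples n X \<and> real (size S') \<ge> (1 - \<alpha>) * real n \<and> stable_multiset d (2 * \<alpha>) \<delta> S' \<mu> 1"
proof (intro exI conjI)
  have finJ: "finite J" using finite_subset[OF J(1)] by simp
  show "image_mset X (mset_set J) \<subseteq># samples n X" using J(1) samples_subset_iff by blast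
  have cJ: "real (card ({..<n} - K)) = real n - real (card K)" if "K \<subseteq> {..<n}" for K
    using that card_mono[of "{..<n}" K] by (simp add: card_Diff_subset finite_subset of_nat_diff)
  show "(1 - \<alpha>) * real n \<le> real (size (image_mset X (mset_set J)))"
    using J(2) cJ[OF J(1)] by (simp add: algebra_simps)
  show "stable_multiset d (2 * \<alpha>) \<delta> (image_mset X (mset_set J)) \<mu> 1"
    unfolding stable_image_iff[OF finJ]
  proof (intro conjI ballI impI)
    fix J' assume J': "J' \<in> Pow J" and big: "(1 - 2 * \<alpha>) * real (card J) \<le> real (card J')"
    define m where "m = real (card J')"
    have sub: "J' \<subseteq> J" "J' \<subseteq> {..<n}" using J' J by auto
    have small: "real (card ({..<n} - J')) \<le> 3 * (\<alpha> * real n)"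
    proof -
      have "real (card J) \<le> real n" using card_mono[OF _ J(1)] by simp
      then have "2 * \<alpha> * real (card J) \<le> 2 * \<alpha> * real n" using \<alpha> by (intro mult_left_mono) auto
      then show ?thesis using big J(2) unfolding cJ[OF J(1)] cJ[OF sub(2)] by (simp add: algebra_simps)
    qed
    have n0: "real n > 0" using n by simp
    have m: "real n - m \<le> 3 * (\<alpha> * real n)" "m \<le> real n" "real n \<le> 2 * m"
    proof -
      show 1: "real n - m \<le> 3 * (\<alpha> * real n)" using small unfolding cJ[OF sub(2)] m_def .
      show "m \<le> real n" using card_mono[OF _ sub(2)] by (simp add: m_def)
      have "\<alpha> * real n \<le> 1/8 * real n" using \<alpha> n0 by (intro mult_right_mono) auto
      then show "real n \<le> 2 * m" using 1 by linarith
    qed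
    have m0: "m > 0" using m n0 by linarith
    have B0: "0 \<le> B" using B \<alpha> by linarith
    show "L2_set (\<lambda>i. (\<Sum>k\<in>J'. X k i) / real (card J') - \<mu> i) {..<d} \<le> \<delta>"
    proof -
      let ?s = "\<lambda>i. \<Sum>k\<in>J'. X k i - \<mu> i"
      have eq: "(\<lambda>i. (\<Sum>k\<in>J'. X k i) / real (card J') - \<mu> i) = (\<lambda>i. (1 / m) * ?s i)"
        using m0 by (auto simp: m_def sum_subtractf field_simps)
      have "(L2_set (\<lambda>i. (\<Sum>k\<in>J'. X k i) / real (card J') - \<mu> i) {..<d})\<^sup>2 = inner_vec d (\<lambda>i. (1 / m) * ?s i) (\<lambda>i. (1 / m) * ?s i)"
        unfolding eq by (simp only: L2_set_inner_vec real_sqrt_pow2[OF inner_vec_self_nonneg])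
      also have "\<dots> = (1 / m)\<^sup>2 * inner_vec d ?s ?s"
        by (simp only: inner_vec_scale inner_vec_scale_right power2_eq_square mult.assoc)
      also have "\<dots> \<le> (1 / m)\<^sup>2 * (D * (real n)\<^sup>2)" using lin[OF sub(1) small] by (intro mult_left_mono) auto
      also have "\<dots> = D * (real n / m)\<^sup>2" by (simp add: power_divide)
      also have "\<dots> \<le> D * 2\<^sup>2"
      proof (intro mult_left_mono power_mono)
        show "real n / m \<le> 2" using m m0 by (simp add: divide_le_eq)
        have "0 \<le> D * (real n)\<^sup>2" using lin[OF sub(1) small] inner_vec_self_nonneg order_trans by blast
        then show "0 \<le> D" using n0 by (simp add: zero_le_mult_iff)
      qed (use m0 in simp)
      also have "\<dots> \<le> \<delta>\<^sup>2" using D by simp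
      finally show ?thesis by (rule power2_le_imp_le) (use \<delta> \<alpha> in linarith)
    qed
    have l2: "L2_set (mat_vec d (\<lambda>i j. (\<Sum>k\<in>J'. (X k i - \<mu> i) * (X k j - \<mu> j)) / real (card J') - id_mat i j) v) {..<d}
       \<le> (2 * B * real n) / m * L2_set v {..<d}" for v
    proof (rule L2_set_mat_vec_le_of_form[where J = J' and a = "\<lambda>k i. X k i - \<mu> i" and \<kappa> = m])
      fix v
      have v0: "0 \<le> inner_vec d v v" by simp
      have "(real n - m) * inner_vec d v v \<le> B * real n * inner_vec d v v"
      proof (rule mult_right_mono[OF _ v0])
        have "3 * \<alpha> * real n \<le> B * real n" using B by (intro mult_right_mono) auto
        then show "real n - m \<le> B * real n" using m by linarith
      qed
      moreover have "0 \<le> (real n - m) * inner_vec d v v" using m v0 by simp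
      ultimately show "\<bar>qform d J' (\<lambda>k i. X k i - \<mu> i) m v\<bar> \<le> 2 * B * real n * inner_vec d v v"
        using quad[OF sub(1) small, of v] unfolding qform_def by (simp add: algebra_simps)
    next
      fix v and i assume i: "i < d"
      have id: "(\<Sum>j<d. id_mat i j * v j) = v i"
      proof -
        have "(\<Sum>j<d. id_mat i j * v j) = (\<Sum>j<d. if i = j then v j else 0)"
          by (intro sum.cong) (auto simp: id_mat_def)
        then show ?thesis using i by simp
      qed
      have "(\<Sum>j<d. (\<Sum>k\<in>J'. (X k i - \<mu> i) * (X k j - \<mu> j)) / m * v j)
        = (\<Sum>j<d. \<Sum>k\<in>J'. (X k j - \<mu> j) * v j * (X k i - \<mu> i)) / m"
        by (simp add: sum_distrib_left sum_distrib_right sum_divide_distrib mult_ac)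
      also have "(\<Sum>j<d. \<Sum>k\<in>J'. (X k j - \<mu> j) * v j * (X k i - \<mu> i)) = (\<Sum>k\<in>J'. inner_vec d (\<lambda>i. X k i - \<mu> i) v * (X k i - \<mu> i))"
        by (subst sum.swap) (simp add: inner_vec_def sum_distrib_right)
      finally show "mat_vec d (\<lambda>i j. (\<Sum>k\<in>J'. (X k i - \<mu> i) * (X k j - \<mu> j)) / real (card J') - id_mat i j) v i
        = ((\<Sum>k\<in>J'. inner_vec d (\<lambda>i. X k i - \<mu> i) v * (X k i - \<mu> i)) - m * v i) / m"
        using m0 by (simp add: mat_vec_def left_diff_distrib sum_subtractf id m_def[symmetric] diff_divide_distrib)
    qed (use m0 B0 in auto)
    have coef: "(2 * B * real n) / m \<le> \<delta>\<^sup>2 / (2 * \<alpha>)"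
    proof -
      have "(2 * B * real n) / m = 2 * B * (real n / m)" by simp
      also have "\<dots> \<le> 2 * B * 2" using m m0 B0 by (intro mult_left_mono) (auto simp: divide_le_eq)
      also have "\<dots> \<le> \<delta>\<^sup>2 / (2 * \<alpha>)" using B \<alpha> by (simp add: field_simps)
      finally show ?thesis .
    qed
    have c0: "0 \<le> \<delta>\<^sup>2 / (2 * \<alpha>)" using \<alpha> by simp
    show "spectral_norm d (\<lambda>i j. (\<Sum>k\<in>J'. (X k i - \<mu> i) * (X k j - \<mu> j)) / real (card J') - id_mat i j) \<le> \<delta>\<^sup>2 / (2 * \<alpha>)"
      unfolding spectral_norm_le_iff[OF c0]
      by (intro allI order_trans[OF l2] mult_right_mono[OF coef] L2_set_nonneg)
  qed (use \<alpha> \<delta> in auto)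
qed

section \<open>Samples from an isotropic distribution\<close>

lemma (in truncated_sample) kept_event_sets:
  "{X \<in> space M. (\<forall>u\<in>net d. dev (psi u) X \<le> 460 * \<beta> * real n) \<and> (\<exists>J\<in>Pow {..<n}. kept X J)} \<in> sets M"
  by (intro sets.sets_Collect_finite_Ex sets.sets_Collect_conj sets.sets_Collect_finite_All
      finite_net dev_sets(1) psi_meas kept_sets) auto

text \<open>Cauchy-Schwarz, read off from a quadratic polynomial in \<open>t\<close> that is never
  negative.\<close>

lemma second_moment_product_bound:
  fixes A B C :: real
  assumes "\<And>t. 0 \<le> B - 2 * t * A + t\<^sup>2 * C" "0 \<le> C"
  shows "A\<^sup>2 \<le> B * C"
proof (cases "C = 0")
  case True
  have "A = 0"
  proof (rule ccontr)
    assume "A \<noteq> 0"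
    then show False using assms(1)[of "(B + 1) / (2 * A)"] True by (simp add: field_simps)
  qed
  then show ?thesis using True by simp
next
  case False
  then have "C > 0" using assms(2) by simp
  then show ?thesis using assms(1)[of "A / C"] by (simp add: power2_eq_square field_simps)
qed

locale centered_distribution =
  fixes d :: nat and P :: "(nat \<Rightarrow> real) measure" and \<mu> :: "nat \<Rightarrow> real"
  assumes d: "d \<ge> 1" and dist: "distribution_on_Rd d P" and mean: "has_mean d P \<mu>"
    and cov: "has_covariance d P \<mu> id_mat"
begin

sublocale P: prob_space P
  using dist by (simp add: distribution_on_Rd_def)

definition z :: "(nat \<Rightarrow> real) \<Rightarrow> (nat \<Rightarrow> real) \<Rightarrow> real" where
  "z v x = inner_vec d (\<lambda>i. x i - \<mu> i) v"

definition nrm :: "(nat \<Rightarrow> real) \<Rightarrow> real" where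
  "nrm x = inner_vec d (\<lambda>i. x i - \<mu> i) (\<lambda>i. x i - \<mu> i)"

lemma coord_meas: "i < d \<Longrightarrow> (\<lambda>x. x i) \<in> borel_measurable P"
  using mean by (auto simp: has_mean_def)

lemma z_meas: "z v \<in> borel_measurable P"
  unfolding z_def inner_vec_def
  by (intro borel_measurable_sum borel_measurable_times borel_measurable_diff coord_meas) auto

lemma nrm_meas: "nrm \<in> borel_measurable P"
  unfolding nrm_def inner_vec_def
  by (intro borel_measurable_sum borel_measurable_times borel_measurable_diff coord_meas) auto

lemma cov_int: "i < d \<Longrightarrow> j < d \<Longrightarrow> integrable P (\<lambda>x. (x i - \<mu> i) * (x j - \<mu> j))"
  "i < d \<Longrightarrow> j < d \<Longrightarrow> (\<integral>x. (x i - \<mu> i) * (x j - \<mu> j) \<partial>P) = id_mat i j"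
  using cov by (auto simp: has_covariance_def)

lemma z_second_moment: "integrable P (\<lambda>x. (z v x)\<^sup>2)" "(\<integral>x. (z v x)\<^sup>2 \<partial>P) = inner_vec d v v"
proof -
  have eq: "(z v x)\<^sup>2 = (\<Sum>i<d. \<Sum>j<d. (v i * v j) * ((x i - \<mu> i) * (x j - \<mu> j)))" for x
    by (simp add: z_def inner_vec_def power2_eq_square sum_product mult_ac)
  have int: "integrable P (\<lambda>x. (v i * v j) * ((x i - \<mu> i) * (x j - \<mu> j)))" if "i < d" "j < d" for i j
    using cov_int(1)[OF that] by simp
  show "integrable P (\<lambda>x. (z v x)\<^sup>2)"
    unfolding eq by (intro Bochner_Integration.integrable_sum int) auto
  have "(\<integral>x. (z v x)\<^sup>2 \<partial>P) = (\<Sum>i<d. \<integral>x. (\<Sum>j<d. (v i * v j) * ((x i - \<mu> i) * (x j - \<mu> j))) \<partial>P)"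
    unfolding eq by (rule Bochner_Integration.integral_sum) (intro Bochner_Integration.integrable_sum int; simp)
  also have "\<dots> = (\<Sum>i<d. \<Sum>j<d. \<integral>x. (v i * v j) * ((x i - \<mu> i) * (x j - \<mu> j)) \<partial>P)"
    by (intro sum.cong refl Bochner_Integration.integral_sum int) auto
  also have "\<dots> = (\<Sum>i<d. \<Sum>j<d. if i = j then v i * v j else 0)"
    by (intro sum.cong refl) (auto simp: cov_int(2) id_mat_def)
  also have "\<dots> = inner_vec d v v" by (simp add: inner_vec_def)
  finally show "(\<integral>x. (z v x)\<^sup>2 \<partial>P) = inner_vec d v v" .
qed

lemma z_first_moment: "integrable P (z v)" "(\<integral>x. z v x \<partial>P) = 0"
proof -
  show "integrable P (z v)" by (rule P.square_integrable_imp_integrable[OF z_meas z_second_moment(1)])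
  have int: "integrable P (\<lambda>x. (x i - \<mu> i) * v i)" "(\<integral>x. (x i - \<mu> i) * v i \<partial>P) = 0" if "i < d" for i
    using mean that by (auto simp: has_mean_def P.prob_space)
  have "(\<integral>x. z v x \<partial>P) = (\<Sum>i<d. \<integral>x. (x i - \<mu> i) * v i \<partial>P)"
    unfolding z_def inner_vec_def by (rule Bochner_Integration.integral_sum) (use int in simp)
  also have "\<dots> = 0" by (rule sum.neutral) (use int(2) in blast)
  finally show "(\<integral>x. z v x \<partial>P) = 0" .
qed

lemma nrm_eq: "nrm x = (\<Sum>j<d. (z (id_mat j) x)\<^sup>2)"
  unfolding nrm_def z_def by (subst inner_vec_parseval) (simp add: power2_eq_square)

lemma nrm_expectation: "integrable P nrm" "(\<integral>x. nrm x \<partial>P) = real d"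
proof -
  show "integrable P nrm" unfolding nrm_eq[abs_def] by (intro Bochner_Integration.integrable_sum z_second_moment(1))
  have "(\<integral>x. nrm x \<partial>P) = (\<Sum>j<d. \<integral>x. (z (id_mat j) x)\<^sup>2 \<partial>P)"
    unfolding nrm_eq by (rule Bochner_Integration.integral_sum) (rule z_second_moment(1))
  then show "(\<integral>x. nrm x \<partial>P) = real d" by (simp add: z_second_moment(2) inner_vec_id_mat)
qed

lemma nrm_nonneg: "0 \<le> nrm x"
  by (simp add: nrm_def)

lemma z_sq_le: "(z v x)\<^sup>2 \<le> nrm x * inner_vec d v v"
  unfolding z_def nrm_def by (rule inner_vec_Cauchy_Schwarz)

text \<open>The threshold scales with \<open>|v|^2\<close>, which makes the function homogeneous of
  degree two in \<open>v\<close>.\<close>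

definition tail :: "real \<Rightarrow> (nat \<Rightarrow> real) \<Rightarrow> (nat \<Rightarrow> real) \<Rightarrow> real" where
  "tail T v x = (if (z v x)\<^sup>2 > T * inner_vec d v v then (z v x)\<^sup>2 else 0)"

lemma tail_bounds: "0 \<le> tail T v x" "tail T v x \<le> (z v x)\<^sup>2" "(z v x)\<^sup>2 - tail T v x \<le> T * inner_vec d v v" if "0 \<le> T"
  using that by (auto simp: tail_def)

lemma tail_int: "integrable P (tail T v)"
proof (rule Bochner_Integration.integrable_bound[OF z_second_moment(1)])
  show "tail T v \<in> borel_measurable P" unfolding tail_def using z_meas by measurable
qed (auto simp: tail_def)

lemma tail_le_second: "(\<integral>x. tail T v x \<partial>P) \<le> inner_vec d v v"
proof -
  have "(\<integral>x. tail T v x \<partial>P) \<le> (\<integral>x. (z v x)\<^sup>2 \<partial>P)"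
    by (rule integral_mono[OF tail_int z_second_moment(1)]) (simp add: tail_def)
  then show ?thesis by (simp add: z_second_moment(2))
qed

text \<open>Long vectors are replaced by zero instead of being removed, so that the sample stays
  i.i.d. with \<open>n\<close> members; the predicate \<open>bad\<close> marks them for later
  deletion.\<close>

definition cut :: "real \<Rightarrow> (nat \<Rightarrow> real) \<Rightarrow> nat \<Rightarrow> real" where
  "cut R x = (\<lambda>j. if nrm x \<le> R then x j - \<mu> j else 0)"

lemma inner_cut: "inner_vec d (cut R x) v = (if nrm x \<le> R then z v x else 0)"
  by (auto simp: cut_def z_def inner_vec_def)

text \<open>One tail bound at level \<open>T\<close> supplies everything: the probability of long
  vectors, the mass lost by clipping and the bias of the truncated mean.\<close>

lemma truncation:
  fixes \<alpha> \<beta> L :: real and n :: nat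
  assumes n: "n \<ge> 1" and \<alpha>: "0 < \<alpha>" and \<beta>: "0 < \<beta>" and L: "0 \<le> L"
    and large1: "real d * max 1 (ln (real d)) + L \<le> \<alpha> * \<beta> * real n"
    and large2: "200 * (1 + L) \<le> \<alpha> * real n"
  defines "T \<equiv> min \<beta> 1 / \<alpha>"
  assumes tl: "\<And>v. (\<integral>x. tail T v x \<partial>P) \<le> min \<beta> 1 * inner_vec d v v"
  shows "truncated_sample P (cut (160 * real d * T)) (\<lambda>x. nrm x > 160 * real d * T) d n \<alpha> \<beta> (if \<beta> < 1 then T else 0) (160 * real d * T) L"
proof -
  define \<rho> where "\<rho> = min \<beta> 1"
  define R where "R = 160 * real d * T"
  have \<rho>: "0 < \<rho>" "\<rho> \<le> \<beta>" "\<rho> \<le> 1" and T: "T * \<alpha> = \<rho>" "0 < T" using \<alpha> \<beta> by (auto simp: \<rho>_def T_def)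
  have R0: "0 < R" using d T by (simp add: R_def)
  let ?b = "indicat_real {x \<in> space P. nrm x > R}"
  have bm: "{x \<in> space P. nrm x > R} \<in> sets P" using nrm_meas by measurable
  have bint: "integrable P ?b" "(\<integral>x. ?b x \<partial>P) = measure P {x \<in> space P. nrm x > R}"
    using bm by (simp_all add: P.integrable_const_bound[where B = 1])
  have bad: "measure P {x \<in> space P. nrm x > R} \<le> \<alpha> / 80"
  proof -
    \<comment> \<open>In each coordinate the part outside the tail is at most \<open>T\<close>, in
      total \<open>d T = R / 160\<close>. A vector of squared norm above \<open>R\<close> thus has
      more than half of it in the tails, and Markov gives
      \<open>2 d \<rho> / R = \<alpha> / 80\<close>.\<close>
    have "R * ?b x \<le> 2 * (\<Sum>j<d. tail T (id_mat j) x)" for x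
    proof (cases "x \<in> space P \<and> nrm x > R")
      case True
      have "nrm x - (\<Sum>j<d. tail T (id_mat j) x) = (\<Sum>j<d. (z (id_mat j) x)\<^sup>2 - tail T (id_mat j) x)"
        by (simp add: nrm_eq sum_subtractf)
      also have "\<dots> \<le> (\<Sum>j<d. T)"
      proof (rule sum_mono)
        fix j assume "j \<in> {..<d}"
        then show "(z (id_mat j) x)\<^sup>2 - tail T (id_mat j) x \<le> T"
          using tail_bounds(3)[of T "id_mat j" x] T(2) inner_vec_id_mat[of j d] by simp
      qed
      also have "\<dots> = R / 160" by (simp add: R_def)
      finally show ?thesis using True R0 by simp
    next
      case False
      then have "?b x = 0" by (auto simp: indicator_def)
      then show ?thesis using tail_bounds(1) T by (simp add: sum_nonneg)
    qed
    then have "(\<integral>x. R * ?b x \<partial>P) \<le> (\<integral>x. 2 * (\<Sum>j<d. tail T (id_mat j) x) \<partial>P)"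
      by (intro integral_mono) (use bint tail_int in auto)
    also have "\<dots> = 2 * (\<Sum>j<d. \<integral>x. tail T (id_mat j) x \<partial>P)"
      by (simp add: Bochner_Integration.integral_sum tail_int)
    also have "\<dots> \<le> 2 * (\<Sum>j<d. \<rho>)"
    proof (intro mult_left_mono sum_mono)
      fix j assume "j \<in> {..<d}"
      then show "(\<integral>x. tail T (id_mat j) x \<partial>P) \<le> \<rho>" using tl[of "id_mat j"] by (simp add: \<rho>_def inner_vec_id_mat)
    qed simp
    finally have "R * measure P {x \<in> space P. nrm x > R} \<le> 2 * real d * \<rho>" using bint by simp
    also have "\<dots> = R * (\<alpha> / 80)" by (simp add: R_def T(1)[symmetric])
    finally show ?thesis using R0 by simp
  qed
  have cut_sq: "(inner_vec d (cut R x) v)\<^sup>2 \<le> (z v x)\<^sup>2" for x v by (simp add: inner_cut)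
  have cut_meas: "(\<lambda>x. inner_vec d (cut R x) v) \<in> borel_measurable P" for v
    unfolding inner_cut using nrm_meas z_meas by measurable
  have cut_int: "integrable P (\<lambda>x. (inner_vec d (cut R x) v)\<^sup>2)" for v
    by (rule Bochner_Integration.integrable_bound[OF z_second_moment(1)[of v]])
       (use cut_sq borel_measurable_power[OF cut_meas] in auto)
  have "truncated_sample P (cut R) (\<lambda>x. nrm x > R) d n \<alpha> \<beta> (if \<beta> < 1 then T else 0) R L"
  proof
    show "(\<lambda>x. cut R x j) \<in> borel_measurable P" if "j < d" for j
      unfolding cut_def using nrm_meas coord_meas[OF that] by measurable
    show "{x \<in> space P. nrm x > R} \<in> sets P" by (rule bm)
    show "inner_vec d (cut R x) (cut R x) \<le> R" for x
    proof (cases "nrm x \<le> R")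
      case True
      then have "cut R x = (\<lambda>i. x i - \<mu> i)" by (simp add: cut_def)
      then show ?thesis using True by (simp add: nrm_def)
    next
      case False
      then show ?thesis using R0 by (simp add: cut_def inner_vec_def)
    qed
    show "R = 160 * real d * min \<beta> 1 / \<alpha>" by (simp add: R_def T_def)
    show "(\<integral>x. (inner_vec d (cut R x) v)\<^sup>2 \<partial>P) \<le> inner_vec d v v" for v
      using integral_mono[OF cut_int z_second_moment(1) cut_sq, of v] z_second_moment(2)[of v] by simp
    show "measure P {x \<in> space P. nrm x > R} \<le> \<alpha> / 80" by (rule bad)
    show "inner_vec d u u - 3 * \<beta> \<le> (\<integral>x. min ((inner_vec d (cut R x) u)\<^sup>2) (if \<beta> < 1 then T else 0) \<partial>P)"
      if u: "inner_vec d u u \<le> 1" for u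
    proof (cases "\<beta> < 1")
      \<comment> \<open>For \<open>\<beta> \<ge> 1\<close> the left side is negative, and the
        clipping level 0 is admissible.\<close>
      case False
      have "(\<integral>x. min ((inner_vec d (cut R x) u)\<^sup>2) (if \<beta> < 1 then T else 0) \<partial>P) = 0"
        using False by (simp add: min_absorb2)
      then show ?thesis using False u by simp
    next
      case True
      have mint: "integrable P (\<lambda>x. min ((inner_vec d (cut R x) u)\<^sup>2) T)"
        by (rule P.integrable_const_bound[where B = T])
           (use T borel_measurable_power[OF cut_meas] in \<open>auto simp: min_def\<close>)
      \<comment> \<open>Clipping and truncation together lose at most the tail and, at truncated
        points, another \<open>T\<close>.\<close>
      have "(z u x)\<^sup>2 - tail T u x - T * ?b x \<le> min ((inner_vec d (cut R x) u)\<^sup>2) T" if "x \<in> space P" for x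
      proof -
        have Tu: "T * inner_vec d u u \<le> T" using u T by (simp add: mult_left_le)
        show ?thesis
        proof (cases "nrm x \<le> R")
          case True
          then have "?b x = 0" by simp
          moreover have "(z u x)\<^sup>2 - tail T u x \<le> min ((z u x)\<^sup>2) T"
            using tail_bounds[of T u x] T(2) Tu by linarith
          ultimately show ?thesis using True by (simp add: inner_cut)
        next
          case False
          then have "?b x = 1" using that by simp
          moreover have "(z u x)\<^sup>2 - tail T u x \<le> T" using Tu T tail_bounds(3)[of T u x] by linarith
          ultimately show ?thesis using False T(2) by (simp add: inner_cut)
        qed
      qed
      then have "(\<integral>x. (z u x)\<^sup>2 - tail T u x - T * ?b x \<partial>P) \<le> (\<integral>x. min ((inner_vec d (cut R x) u)\<^sup>2) T \<partial>P)"
        by (intro integral_mono Bochner_Integration.integrable_diff z_second_moment tail_int mint)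
           (use bint in auto)
      moreover have "(\<integral>x. (z u x)\<^sup>2 - tail T u x - T * ?b x \<partial>P)
        = inner_vec d u u - (\<integral>x. tail T u x \<partial>P) - T * measure P {x \<in> space P. nrm x > R}"
        using bint by (simp add: z_second_moment tail_int)
      moreover have "(\<integral>x. tail T u x \<partial>P) \<le> \<beta>"
      proof -
        have "(\<integral>x. tail T u x \<partial>P) \<le> \<rho> * inner_vec d u u" using tl[of u] by (simp add: \<rho>_def)
        also have "\<dots> \<le> \<rho> * 1" using u \<rho> by (intro mult_left_mono) auto
        finally show ?thesis using \<rho> by simp
      qed
      moreover have "T * measure P {x \<in> space P. nrm x > R} \<le> \<beta>"
      proof -
        have "T * measure P {x \<in> space P. nrm x > R} \<le> T * (\<alpha> / 80)" using bad T by (intro mult_left_mono) auto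
        also have "\<dots> = \<rho> / 80" using T(1) by simp
        finally show ?thesis using \<rho> by simp
      qed
      ultimately show ?thesis using True \<beta> by simp
    qed
    show "(\<integral>x. inner_vec d (cut R x) v \<partial>P)\<^sup>2 \<le> 4 * \<alpha> * \<beta> * inner_vec d v v" for v
    proof -
      let ?N = "inner_vec d v v"
      define A B C where "A = (\<integral>x. z v x * ?b x \<partial>P)" and "B = (\<integral>x. (z v x)\<^sup>2 * ?b x \<partial>P)"
        and "C = measure P {x \<in> space P. nrm x > R}"
      have i1: "integrable P (\<lambda>x. z v x * ?b x)"
        by (rule Bochner_Integration.integrable_bound[OF z_first_moment(1)[of v]])
           (use z_meas[of v] bm in \<open>auto simp: indicator_def\<close>)
      have i2: "integrable P (\<lambda>x. (z v x)\<^sup>2 * ?b x)"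
        by (rule Bochner_Integration.integrable_bound[OF z_second_moment(1)[of v]])
           (use z_meas[of v] bm in \<open>auto simp: indicator_def\<close>)
      \<comment> \<open>Since \<open>z v\<close> has mean zero, the truncated mean is minus the mean
        over the bad event. Cauchy-Schwarz bounds its square by the probability of that event times
        the second moment on it, which is at most the tail plus \<open>T |v|^2\<close> times the
        probability.\<close>
      have "(\<integral>x. inner_vec d (cut R x) v \<partial>P) = (\<integral>x. z v x - z v x * ?b x \<partial>P)"
        by (rule Bochner_Integration.integral_cong) (auto simp: inner_cut indicator_def)
      also have "\<dots> = - A" using i1 z_first_moment[of v] by (simp add: A_def)
      finally have E: "(\<integral>x. inner_vec d (cut R x) v \<partial>P)\<^sup>2 = A\<^sup>2" by simp
      have "0 \<le> B - 2 * t * A + t\<^sup>2 * C" for t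
      proof -
        have "0 \<le> (\<integral>x. (z v x * ?b x - t * ?b x)\<^sup>2 \<partial>P)" by simp
        also have "\<dots> = (\<integral>x. (z v x)\<^sup>2 * ?b x - (2 * t) * (z v x * ?b x) + t\<^sup>2 * ?b x \<partial>P)"
          by (rule Bochner_Integration.integral_cong) (auto simp: indicator_def power2_eq_square algebra_simps)
        also have "\<dots> = B - 2 * t * A + t\<^sup>2 * C"
          using i1 i2 bint by (simp add: A_def B_def C_def)
        finally show ?thesis .
      qed
      then have "A\<^sup>2 \<le> B * C" by (rule second_moment_product_bound) (simp add: C_def)
      also have "\<dots> \<le> (2 * \<rho> * ?N) * (\<alpha> / 80)"
      proof (rule mult_mono)
        have "B \<le> (\<integral>x. tail T v x + T * ?N * ?b x \<partial>P)"
          unfolding B_def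
        proof (rule integral_mono[OF i2])
          show "integrable P (\<lambda>x. tail T v x + T * ?N * ?b x)" using tail_int bint by simp
          show "(z v x)\<^sup>2 * ?b x \<le> tail T v x + T * ?N * ?b x" for x
            using tail_bounds[of T v x] T by (auto simp: indicator_def)
        qed
        also have "\<dots> = (\<integral>x. tail T v x \<partial>P) + T * ?N * C" using tail_int bint by (simp add: C_def)
        also have "\<dots> \<le> \<rho> * ?N + T * ?N * (\<alpha> / 80)"
          using tl[of v] bad T by (intro add_mono mult_left_mono) (auto simp: \<rho>_def C_def)
        also have "T * ?N * (\<alpha> / 80) = \<rho> * ?N / 80" using T(1) by (simp add: mult_ac)
        also have "\<rho> * ?N + \<rho> * ?N / 80 \<le> 2 * \<rho> * ?N" using mult_nonneg_nonneg[of \<rho> ?N] \<rho> by simp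
        finally show "B \<le> 2 * \<rho> * ?N" .
      qed (use bad \<rho> in \<open>auto simp: C_def\<close>)
      also have "\<dots> = \<alpha> * \<rho> * ?N / 40" by simp
      also have "\<dots> \<le> 4 * \<alpha> * \<beta> * ?N"
      proof -
        have "\<alpha> * \<rho> * ?N \<le> \<alpha> * \<beta> * ?N" using \<rho> \<alpha> by (intro mult_right_mono mult_left_mono) auto
        moreover have "0 \<le> \<alpha> * \<rho> * ?N" using \<rho> \<alpha> by simp
        ultimately show ?thesis by linarith
      qed
      finally show ?thesis unfolding E .
    qed
    show "0 \<le> (if \<beta> < 1 then T else 0)" "(if \<beta> < 1 then T else 0) \<le> \<beta> / \<alpha>" "(if \<beta> < 1 then T else 0) = 0 \<or> \<beta> \<le> 1"
      using T \<alpha> \<beta> by (auto simp: T_def min_def divide_right_mono)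
  qed (use d n \<alpha> \<beta> L large1 large2 P.prob_space_axioms in auto)
  then show ?thesis by (simp only: R_def)
qed

end

context centered_distribution
begin

section \<open>Moments of one-dimensional projections\<close>

lemma bounded_central_moment_iff:
  "bounded_central_moment d P \<mu> k s \<longleftrightarrow> (\<forall>v. inner_vec d v v = 1 \<longrightarrow>
     integrable P (\<lambda>x. \<bar>z v x\<bar> powr k) \<and> (\<integral>x. \<bar>z v x\<bar> powr k \<partial>P) powr (1 / k) \<le> s)"
proof -
  have zi: "inner_vec d v (\<lambda>i. x i - \<mu> i) = z v x" for v x by (simp add: z_def inner_vec_commute)
  show ?thesis
    unfolding bounded_central_moment_def zi z_second_moment(2) by (simp add: L2_set_inner_vec)
qed

text \<open>Young's inequality with exponent \<open>k / 2\<close> compares the second moment, which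
  is 1, with the \<open>k\<close>-th; this forces the latter, and with it \<open>s\<close>, to be at
  least 1.\<close>

lemma central_moment_le:
  assumes bcm: "bounded_central_moment d P \<mu> k s" and k: "k \<ge> 2" and v: "inner_vec d v v = 1"
  shows "1 \<le> (\<integral>x. \<bar>z v x\<bar> powr k \<partial>P)" "1 \<le> s" "(\<integral>x. \<bar>z v x\<bar> powr k \<partial>P) \<le> s powr k"
proof -
  let ?m = "\<integral>x. \<bar>z v x\<bar> powr k \<partial>P"
  have int: "integrable P (\<lambda>x. \<bar>z v x\<bar> powr k)" and le: "?m powr (1 / k) \<le> s"
    using bcm v unfolding bounded_central_moment_iff by auto
  have young: "(z v x)\<^sup>2 \<le> 2 / k * \<bar>z v x\<bar> powr k + (1 - 2 / k)" for x
  proof (cases "z v x = 0")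
    case False
    have "(\<bar>z v x\<bar> powr k) powr (2 / k) * 1 powr (1 - 2 / k) \<le> 2 / k * \<bar>z v x\<bar> powr k + (1 - 2 / k) * 1"
      by (rule Youngs_inequality_0) (use False k in auto)
    moreover have "(\<bar>z v x\<bar> powr k) powr (2 / k) = (z v x)\<^sup>2"
      using False k by (simp add: powr_powr)
    ultimately show ?thesis by simp
  qed (use k in simp)
  have "1 = (\<integral>x. (z v x)\<^sup>2 \<partial>P)" using v by (simp add: z_second_moment)
  also have "\<dots> \<le> (\<integral>x. 2 / k * \<bar>z v x\<bar> powr k + (1 - 2 / k) \<partial>P)"
    by (rule integral_mono[OF z_second_moment(1) _ young]) (use int in simp)
  also have "\<dots> = 2 / k * ?m + (1 - 2 / k)" using int by (simp add: P.prob_space)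
  finally have "2 / k * 1 \<le> 2 / k * ?m" by simp
  then show m1: "1 \<le> ?m" using k by (simp add: field_simps)
  have "1 \<le> ?m powr (1 / k)" using m1 k by (intro ge_one_powr_ge_zero) auto
  then show s1: "1 \<le> s" using le by linarith
  have "?m = (?m powr (1 / k)) powr k" using m1 k by (simp add: powr_powr)
  also have "\<dots> \<le> s powr k" using le k by (intro powr_mono2) auto
  finally show "?m \<le> s powr k" .
qed

lemma unit_vector: "inner_vec d (id_mat 0) (id_mat 0) = 1"
  using d by (intro inner_vec_id_mat) simp

text \<open>For unit \<open>v\<close> one has \<open>z^2 = |z|^k |z|^(2-k)\<close>, and on the tail
  the second factor is at most \<open>T powr (1 - k / 2)\<close>. Homogeneity extends the bound to
  all \<open>v\<close>.\<close>

lemma tail_le_moment: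
  assumes bcm: "bounded_central_moment d P \<mu> k s" and k: "k \<ge> 2" and T: "T > 0"
  shows "(\<integral>x. tail T v x \<partial>P) \<le> s powr k * T powr (1 - k / 2) * inner_vec d v v"
proof -
  have unit: "(\<integral>x. tail T v x \<partial>P) \<le> s powr k * T powr (1 - k / 2)" if v: "inner_vec d v v = 1" for v
  proof -
    have int: "integrable P (\<lambda>x. \<bar>z v x\<bar> powr k)" using bcm v unfolding bounded_central_moment_iff by auto
    have "tail T v x \<le> \<bar>z v x\<bar> powr k * T powr (1 - k / 2)" for x
    proof (cases "(z v x)\<^sup>2 > T")
      case True
      then have z0: "z v x \<noteq> 0" using T by auto
      have "(z v x)\<^sup>2 = \<bar>z v x\<bar> powr 2" using z0 by simp
      also have "\<dots> = \<bar>z v x\<bar> powr k * \<bar>z v x\<bar> powr (2 * (1 - k / 2))"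
        by (simp add: powr_add[symmetric] right_diff_distrib)
      also have "\<bar>z v x\<bar> powr (2 * (1 - k / 2)) = ((z v x)\<^sup>2) powr (1 - k / 2)"
        by (subst powr_powr[symmetric]) (use z0 in simp)
      also have "\<bar>z v x\<bar> powr k * ((z v x)\<^sup>2) powr (1 - k / 2) \<le> \<bar>z v x\<bar> powr k * T powr (1 - k / 2)"
        using True T k by (intro mult_left_mono powr_mono2') auto
      finally show ?thesis using True v by (simp add: tail_def)
    next
      case False
      then show ?thesis using v by (simp add: tail_def)
    qed
    then have "(\<integral>x. tail T v x \<partial>P) \<le> (\<integral>x. \<bar>z v x\<bar> powr k * T powr (1 - k / 2) \<partial>P)"
      by (intro integral_mono tail_int) (use int in auto)
    also have "\<dots> = (\<integral>x. \<bar>z v x\<bar> powr k \<partial>P) * T powr (1 - k / 2)" by simp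
    also have "\<dots> \<le> s powr k * T powr (1 - k / 2)"
      using central_moment_le(3)[OF bcm k v] by (intro mult_right_mono) auto
    finally show ?thesis .
  qed
  show ?thesis
  proof (cases "inner_vec d v v = 0")
    case True
    then have "z v x = 0" for x using z_sq_le[of v x] by simp
    then show ?thesis using True by (simp add: tail_def)
  next
    case False
    define N where "N = sqrt (inner_vec d v v)"
    have N: "N > 0" "N\<^sup>2 = inner_vec d v v" using False inner_vec_self_nonneg[of d v] by (auto simp: N_def less_le)
    define u where "u = (\<lambda>i. (1 / N) * v i)"
    have uu: "inner_vec d u u = 1"
      unfolding u_def by (subst inner_vec_scale, subst inner_vec_scale_right, subst N(2)[symmetric])
         (use N(1) in \<open>simp add: power2_eq_square\<close>)
    have zz: "z v x = N * z u x" for x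
      unfolding z_def u_def inner_vec_scale_right using N(1) by simp
    have "tail T v x = N\<^sup>2 * tail T u x" for x
      using N(1) by (simp add: tail_def zz uu power_mult_distrib N(2)[symmetric] mult.commute)
    then have "(\<integral>x. tail T v x \<partial>P) = N\<^sup>2 * (\<integral>x. tail T u x \<partial>P)" by simp
    also have "\<dots> \<le> N\<^sup>2 * (s powr k * T powr (1 - k / 2))" using unit[OF uu] by (intro mult_left_mono) auto
    finally show ?thesis by (simp add: N(2) mult_ac)
  qed
qed

text \<open>\<open>LEAST\<close> on the reals is meaningful only if the minimum is attained: the
  admissible constants are those above a supremum, finite because
  \<open>|z|^4 \<le> 1 + |z|^k\<close>. The bound 1 lets the last term of \<delta> dominate
  \<open>sqrt (L / n)\<close>.\<close>

lemma least_fourth_moment_ge_1: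
  assumes bcm: "bounded_central_moment d P \<mu> k s" and k: "k \<ge> 4"
  shows "1 \<le> least_central_moment_bound d P \<mu> 4"
proof -
  define f where "f v = (\<integral>x. \<bar>z v x\<bar> powr 4 \<partial>P) powr (1 / 4)" for v
  have int4: "integrable P (\<lambda>x. \<bar>z v x\<bar> powr 4)" and f_le: "f v \<le> (1 + s powr k) powr (1 / 4)"
    if v: "inner_vec d v v = 1" for v
  proof -
    have int: "integrable P (\<lambda>x. \<bar>z v x\<bar> powr k)" using bcm v unfolding bounded_central_moment_iff by auto
    have le: "\<bar>z v x\<bar> powr 4 \<le> 1 + \<bar>z v x\<bar> powr k" for x
    proof (cases "\<bar>z v x\<bar> \<le> 1")
      case True
      then have "\<bar>z v x\<bar> powr 4 \<le> 1" by (intro powr_le1) auto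
      then show ?thesis by (smt (verit) powr_ge_zero)
    next
      case False
      then have "\<bar>z v x\<bar> powr 4 \<le> \<bar>z v x\<bar> powr k" using k by (intro powr_mono) auto
      then show ?thesis by simp
    qed
    have int1: "integrable P (\<lambda>x. 1 + \<bar>z v x\<bar> powr k)" using int by simp
    show int4: "integrable P (\<lambda>x. \<bar>z v x\<bar> powr 4)"
    proof (rule Bochner_Integration.integrable_bound[OF int1])
      show "(\<lambda>x. \<bar>z v x\<bar> powr 4) \<in> borel_measurable P" using z_meas[of v] by measurable
      show "AE x in P. norm (\<bar>z v x\<bar> powr 4) \<le> norm (1 + \<bar>z v x\<bar> powr k)"
        using le by (intro AE_I2) (simp add: abs_of_nonneg)
    qed
    have "(\<integral>x. \<bar>z v x\<bar> powr 4 \<partial>P) \<le> (\<integral>x. 1 + \<bar>z v x\<bar> powr k \<partial>P)" by (rule integral_mono[OF int4 int1 le])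
    also have "\<dots> = 1 + (\<integral>x. \<bar>z v x\<bar> powr k \<partial>P)" using int by (simp add: P.prob_space)
    also have "\<dots> \<le> 1 + s powr k" using central_moment_le(3)[OF bcm _ v] k by simp
    finally show "f v \<le> (1 + s powr k) powr (1 / 4)"
      unfolding f_def by (intro powr_mono2) auto
  qed
  define S where "S = f ` {v. inner_vec d v v = 1}"
  have bdd: "bdd_above S" unfolding S_def by (rule bdd_aboveI2) (use f_le in auto)
  have ne: "S \<noteq> {}" using unit_vector by (auto simp: S_def)
  have iff: "bounded_central_moment d P \<mu> 4 r \<longleftrightarrow> Sup S \<le> r" for r
  proof -
    have "bounded_central_moment d P \<mu> 4 r \<longleftrightarrow> (\<forall>y\<in>S. y \<le> r)"
      unfolding bounded_central_moment_iff S_def f_def using int4 by auto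
    then show ?thesis using cSup_le_iff[OF ne bdd] by simp
  qed
  have "least_central_moment_bound d P \<mu> 4 = Sup S"
    unfolding least_central_moment_bound_def by (rule Least_equality) (auto simp: iff)
  moreover have "bounded_central_moment d P \<mu> 4 (Sup S)" by (simp add: iff)
  ultimately show ?thesis using central_moment_le(2)[OF _ _ unit_vector, of 4 "Sup S"] by simp
qed

section \<open>The two regimes and the choice of \<beta>\<close>

abbreviation "stable_event n \<alpha> \<delta> \<equiv> {X \<in> space (Pi\<^sub>M {..<n} (\<lambda>_. P)). \<exists>S'. S' \<subseteq># samples n X \<and>
  real (size S') \<ge> (1 - \<alpha>) * real n \<and> stable_multiset d (2 * \<alpha>) \<delta> S' \<mu> 1}"

lemma stable_event_in_sets: "0 < \<alpha> \<Longrightarrow> stable_event n \<alpha> \<delta> \<in> sets (Pi\<^sub>M {..<n} (\<lambda>_. P))"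
  using dist by (intro stable_event_sets) (auto simp: distribution_on_Rd_def)

text \<open>On the event of \<open>kept_prob\<close> no kept point was truncated, so its image under
  \<open>cut\<close> is the centered sample point itself, and the bounds of
  \<open>kept_stable\<close> speak about the original data.\<close>

lemma main_regime:
  fixes \<alpha> \<beta> L \<delta> :: real and n :: nat
  assumes n1: "n \<ge> 1" and \<alpha>1: "0 < \<alpha>" "\<alpha> \<le> 1/8" and \<beta>: "0 < \<beta>" and L: "0 \<le> L"
    and large1: "real d * max 1 (ln (real d)) + L \<le> \<alpha> * \<beta> * real n"
    and large2: "200 * (1 + L) \<le> \<alpha> * real n"
    and tl: "\<And>v. (\<integral>x. tail (min \<beta> 1 / \<alpha>) v x \<partial>P) \<le> min \<beta> 1 * inner_vec d v v"
    and \<delta>: "2 * \<alpha> \<le> \<delta>" "\<alpha> \<le> \<beta>" "10 ^ 12 * (\<alpha> * \<beta>) \<le> \<delta>\<^sup>2"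
  shows "1 - exp (- L) \<le> measure (Pi\<^sub>M {..<n} (\<lambda>_. P)) (stable_event n \<alpha> \<delta>)"
proof -
  define R where "R = 160 * real d * (min \<beta> 1 / \<alpha>)"
  interpret truncated_sample P "cut R" "\<lambda>x. nrm x > R" d n \<alpha> \<beta> "if \<beta> < 1 then min \<beta> 1 / \<alpha> else 0" R L
    unfolding R_def by (rule truncation[OF n1 \<alpha>1(1) \<beta> L large1 large2 tl])
  let ?G = "{X \<in> space M. (\<forall>u\<in>net d. dev (psi u) X \<le> 460 * \<beta> * real n) \<and> (\<exists>J\<in>Pow {..<n}. kept X J)}"
  have "1 - exp (- L) \<le> measure M ?G"
  proof (rule prob_le_compl[OF kept_event_sets])
    have "{X \<in> space M. X \<notin> ?G} = {X \<in> space M. \<not> ((\<forall>u\<in>net d. dev (psi u) X \<le> 460 * \<beta> * real n) \<and> (\<exists>J\<in>Pow {..<n}. kept X J))}"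
      by auto
    then show "measure M {X \<in> space M. X \<notin> ?G} \<le> exp (- L)" using kept_prob by (simp only:)
  qed
  also have "\<dots> \<le> measure M (stable_event n \<alpha> \<delta>)"
  proof (rule M.finite_measure_mono[OF _ stable_event_in_sets[OF \<alpha>1(1)]], rule subsetI)
    fix X assume X: "X \<in> ?G"
    then obtain J where J: "J \<subseteq> {..<n}" "kept X J" by auto
    have dv: "\<And>u. u \<in> net d \<Longrightarrow> dev (psi u) X \<le> 460 * \<beta> * real n" using X by auto
    have cut: "cut R (X i) = (\<lambda>j. X i j - \<mu> j)" if "i \<in> J" for i
    proof -
      have "X i \<in> space P" using X J(1) that by (auto simp: space_PiM)
      moreover have "X i \<notin> Bad" using J(2) that by (auto simp: kept_def)
      ultimately have "nrm (X i) \<le> R" by (auto simp: Bad_def)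
      then show ?thesis by (simp add: cut_def)
    qed
    have "\<exists>S'. S' \<subseteq># samples n X \<and> real (size S') \<ge> (1 - \<alpha>) * real n \<and> stable_multiset d (2 * \<alpha>) \<delta> S' \<mu> 1"
    proof (rule stable_of_bounds[where B = "10 ^ 7 * \<beta>" and D = "10 ^ 11 * (\<alpha> * \<beta>)", OF \<alpha>1 n1 J(1)])
      show "real (card ({..<n} - J)) \<le> \<alpha> * real n" using J(2) by (simp add: kept_def)
      fix J' assume J': "J' \<subseteq> J" "real (card ({..<n} - J')) \<le> 3 * (\<alpha> * real n)"
      note st = kept_stable[OF dv J(2,1) J']
      show "\<bar>(\<Sum>k\<in>J'. (inner_vec d (\<lambda>i. X k i - \<mu> i) v)\<^sup>2) - real n * inner_vec d v v\<bar>
         \<le> 10 ^ 7 * \<beta> * real n * inner_vec d v v" for v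
      proof -
        have "(\<Sum>k\<in>J'. (inner_vec d (\<lambda>i. X k i - \<mu> i) v)\<^sup>2) = (\<Sum>k\<in>J'. energy v (X k))"
          by (rule sum.cong[OF refl]) (use cut J'(1) in auto)
        then show ?thesis using st(1)[of v] by simp
      qed
      have "ysum J' X = (\<lambda>i. \<Sum>k\<in>J'. X k i - \<mu> i)"
        unfolding ysum_def by (intro ext sum.cong refl) (use cut J'(1) in auto)
      then show "inner_vec d (\<lambda>i. \<Sum>k\<in>J'. X k i - \<mu> i) (\<lambda>i. \<Sum>k\<in>J'. X k i - \<mu> i) \<le> 10 ^ 11 * (\<alpha> * \<beta>) * (real n)\<^sup>2"
        using st(2) by (simp add: mult.assoc)
    next
      have "0 \<le> \<alpha> * \<beta>" using \<alpha>1 \<beta> by simp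
      then show "8 * (10 ^ 7 * \<beta>) * \<alpha> \<le> \<delta>\<^sup>2" "4 * (10 ^ 11 * (\<alpha> * \<beta>)) \<le> \<delta>\<^sup>2"
        using \<delta>(3) by (simp_all add: mult_ac)
      show "3 * \<alpha> \<le> 10 ^ 7 * \<beta>" using \<delta>(2) \<alpha>1 by simp
    qed (use \<delta> in auto)
    then show "X \<in> stable_event n \<alpha> \<delta>" using X by simp
  qed
  finally show ?thesis .
qed

text \<open>The whole sample serves as the stable set: at most 1200 missing points have to be
  handled, and the crude total \<open>8 n d\<close> of the squared norms controls them. A
  second-moment error as large as \<open>8 * d\<close> is affordable because \<alpha> is at most
  \<open>400 / n\<close>.\<close>

lemma easy_regime:
  fixes \<alpha> \<delta> :: real and n :: nat
  assumes n: "n \<ge> 1" and \<alpha>: "0 < \<alpha>" "\<alpha> \<le> 1/8" and small: "\<alpha> * real n \<le> 400"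
    and \<delta>: "2 * \<alpha> \<le> \<delta>" "80000 * (real d / real n) \<le> \<delta>\<^sup>2"
  shows "3/4 \<le> measure (Pi\<^sub>M {..<n} (\<lambda>_. P)) (stable_event n \<alpha> \<delta>)"
proof -
  let ?M = "Pi\<^sub>M {..<n} (\<lambda>_. P)"
  interpret M: prob_space ?M by (rule prob_space_PiM) (rule P.prob_space_axioms)
  have nd: "0 < real n * real d" using n d by simp
  define c where "c j x = x j - \<mu> j" for j and x :: "nat \<Rightarrow> real"
  let ?F = "\<lambda>X. \<Sum>j<d. (\<Sum>i<n. c j (X i))\<^sup>2"
  have F: "integrable ?M ?F" "(\<integral>X. ?F X \<partial>?M) = real n * real d"
  proof -
    have i: "integrable ?M (\<lambda>X. (\<Sum>i<n. c j (X i))\<^sup>2)" "(\<integral>X. (\<Sum>i<n. c j (X i))\<^sup>2 \<partial>?M) = real n" if j: "j < d" for j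
    proof -
      have "integrable P (c j)" "integrable P (\<lambda>x. (c j x)\<^sup>2)" "(\<integral>x. c j x \<partial>P) = 0" "(\<integral>x. (c j x)\<^sup>2 \<partial>P) = 1"
        using mean cov_int[OF j j] j unfolding c_def[abs_def]
        by (auto simp: has_mean_def P.prob_space power2_eq_square id_mat_def)
      then show "integrable ?M (\<lambda>X. (\<Sum>i<n. c j (X i))\<^sup>2)" "(\<integral>X. (\<Sum>i<n. c j (X i))\<^sup>2 \<partial>?M) = real n"
        using iid_sum_second_moment[OF P.prob_space_axioms, of "c j" n] by auto
    qed
    show "integrable ?M ?F" by (intro Bochner_Integration.integrable_sum i) auto
    have "(\<integral>X. ?F X \<partial>?M) = (\<Sum>j<d. \<integral>X. (\<Sum>i<n. c j (X i))\<^sup>2 \<partial>?M)"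
      by (rule Bochner_Integration.integral_sum) (use i in auto)
    also have "\<dots> = (\<Sum>j<d. real n)" by (intro sum.cong i refl) auto
    finally show "(\<integral>X. ?F X \<partial>?M) = real n * real d" by (simp add: mult.commute)
  qed
  have nsum: "(\<lambda>X. \<Sum>i<n. nrm (X i)) \<in> borel_measurable ?M"
  proof (rule borel_measurable_sum)
    fix i assume "i \<in> {..<n}"
    then have "(\<lambda>X. X i) \<in> ?M \<rightarrow>\<^sub>M P" by (intro measurable_component_singleton)
    then show "(\<lambda>X. nrm (X i)) \<in> borel_measurable ?M" by (rule measurable_compose[OF _ nrm_meas])
  qed
  let ?A = "{X \<in> space ?M. (\<Sum>i<n. nrm (X i)) > 8 * (real n * real d)}"
  let ?B = "{X \<in> space ?M. 8 * (real n * real d) \<le> ?F X}"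
  have AB: "?A \<in> sets ?M" "?B \<in> sets ?M"
    using nsum borel_measurable_integrable[OF F(1)] by measurable
  have "measure ?M ?A \<le> real n * (\<integral>x. nrm x \<partial>P) / (8 * (real n * real d))"
    by (rule iid_markov[OF P.prob_space_axioms nrm_expectation(1) nrm_nonneg]) (use nd in simp)
  also have "\<dots> = 1/8" using n d by (simp add: nrm_expectation)
  finally have A: "measure ?M ?A \<le> 1/8" .
  have "measure ?M ?B \<le> (\<integral>X. ?F X \<partial>?M) / (8 * (real n * real d))"
    by (rule integral_Markov_inequality_measure[where A = "{}"]) (use F(1) nd in \<open>auto intro!: sum_nonneg\<close>)
  also have "\<dots> = 1/8" using n d by (simp add: F(2))
  finally have B: "measure ?M ?B \<le> 1/8" .
  have "1 - (1/8 + 1/8) \<le> measure ?M (space ?M - (?A \<union> ?B))"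
  proof -
    have "measure ?M (?A \<union> ?B) \<le> measure ?M ?A + measure ?M ?B" by (rule measure_Un_le[OF AB])
    then show ?thesis using A B AB M.prob_compl[of "?A \<union> ?B"] by simp
  qed
  also have "\<dots> \<le> measure ?M (stable_event n \<alpha> \<delta>)"
  proof (rule M.finite_measure_mono[OF _ stable_event_in_sets[OF \<alpha>(1)]], rule subsetI)
    fix X assume X: "X \<in> space ?M - (?A \<union> ?B)"
    then have XA: "(\<Sum>i<n. nrm (X i)) \<le> 8 * (real n * real d)" and XB: "?F X \<le> 8 * (real n * real d)" by auto
    define s where "s J = (\<lambda>i. \<Sum>k\<in>J. X k i - \<mu> i)" for J
    have "\<exists>S'. S' \<subseteq># samples n X \<and> real (size S') \<ge> (1 - \<alpha>) * real n \<and> stable_multiset d (2 * \<alpha>) \<delta> S' \<mu> 1"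
    proof (rule stable_of_bounds[where J = "{..<n}" and B = "8 * real d" and D = "20000 * (real d / real n)", OF \<alpha> n])
      fix J' assume J': "J' \<subseteq> {..<n}" "real (card ({..<n} - J')) \<le> 3 * (\<alpha> * real n)"
      have sub: "(\<Sum>k\<in>K. (inner_vec d (\<lambda>i. X k i - \<mu> i) v)\<^sup>2) \<le> 8 * (real n * real d) * inner_vec d v v"
        if "K \<subseteq> {..<n}" for K v
      proof -
        have "(\<Sum>k\<in>K. (inner_vec d (\<lambda>i. X k i - \<mu> i) v)\<^sup>2) \<le> (\<Sum>k<n. (z v (X k))\<^sup>2)"
          unfolding z_def using that by (intro sum_mono2) auto
        also have "\<dots> \<le> (\<Sum>k<n. nrm (X k)) * inner_vec d v v"
          unfolding sum_distrib_right by (intro sum_mono z_sq_le)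
        also have "\<dots> \<le> 8 * (real n * real d) * inner_vec d v v" using XA by (intro mult_right_mono) auto
        finally show ?thesis .
      qed
      show "\<bar>(\<Sum>k\<in>J'. (inner_vec d (\<lambda>i. X k i - \<mu> i) v)\<^sup>2) - real n * inner_vec d v v\<bar>
         \<le> 8 * real d * real n * inner_vec d v v" for v
      proof -
        have "0 \<le> (\<Sum>k\<in>J'. (inner_vec d (\<lambda>i. X k i - \<mu> i) v)\<^sup>2)" by (intro sum_nonneg) auto
        moreover have "1 * (real n * inner_vec d v v) \<le> (8 * real d) * (real n * inner_vec d v v)"
          using d by (intro mult_right_mono) auto
        moreover have "0 \<le> real n * inner_vec d v v" by simp
        moreover have "8 * (real n * real d) * inner_vec d v v = 8 * real d * real n * inner_vec d v v"
          "(8 * real d) * (real n * inner_vec d v v) = 8 * real d * real n * inner_vec d v v" by simp_all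
        ultimately show ?thesis using sub[OF J'(1), of v] unfolding abs_le_iff by linarith
      qed
      have rem: "inner_vec d (s ({..<n} - J')) (s ({..<n} - J')) \<le> 9600 * (real n * real d)"
      proof -
        have "inner_vec d (s ({..<n} - J')) (s ({..<n} - J')) \<le> real (card ({..<n} - J')) * (8 * (real n * real d))"
          unfolding s_def by (rule inner_vec_sum_le_card) (use sub in auto)
        also have "\<dots> \<le> 1200 * (8 * (real n * real d))" using J'(2) small nd by (intro mult_right_mono) auto
        finally show ?thesis by simp
      qed
      have "s J' = (\<lambda>i. s {..<n} i - s ({..<n} - J') i)"
        unfolding s_def using J'(1) by (auto simp: fun_eq_iff sum_diff)
      then have "inner_vec d (s J') (s J') \<le> 2 * inner_vec d (s {..<n}) (s {..<n}) + 2 * inner_vec d (s ({..<n} - J')) (s ({..<n} - J'))"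
        by (simp only: inner_vec_diff_le)
      moreover have "inner_vec d (s {..<n}) (s {..<n}) = ?F X"
        by (simp add: inner_vec_def s_def c_def power2_eq_square)
      ultimately have "inner_vec d (s J') (s J') \<le> 20000 * (real n * real d)" using rem XB nd by simp
      also have "\<dots> = 20000 * (real d / real n) * (real n)\<^sup>2" using n by (simp add: power2_eq_square)
      finally show "inner_vec d (\<lambda>i. \<Sum>k\<in>J'. X k i - \<mu> i) (\<lambda>i. \<Sum>k\<in>J'. X k i - \<mu> i) \<le> 20000 * (real d / real n) * (real n)\<^sup>2"
        unfolding s_def .
    next
      have "\<alpha> \<le> 400 / real n" using small n by (simp add: field_simps)
      then have "64 * real d * \<alpha> \<le> 64 * real d * (400 / real n)" by (intro mult_left_mono) auto
      also have "\<dots> = 25600 * (real d / real n)" by simp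
      also have "\<dots> \<le> 80000 * (real d / real n)" by (intro mult_right_mono) auto
      finally show "8 * (8 * real d) * \<alpha> \<le> \<delta>\<^sup>2" using \<delta>(2) by simp
      show "3 * \<alpha> \<le> 8 * real d" using d \<alpha> by simp
    qed (use \<delta> \<alpha> in auto)
    then show "X \<in> stable_event n \<alpha> \<delta>" using X by simp
  qed
  finally show ?thesis by simp
qed

end

lemma (in centered_distribution) stable_event_prob:
  fixes n :: nat and \<epsilon> \<tau> k s :: real
  assumes n: "n \<ge> 1" and \<epsilon>: "0 < \<epsilon>" "\<epsilon> < 1/2" and \<tau>: "0 < \<tau>" "\<tau> < 1" and k: "k \<ge> 4"
    and bcm: "bounded_central_moment d P \<mu> k s"
  defines "\<alpha> \<equiv> 800 * (ln (1 / \<tau>) / real n + \<epsilon>)"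
  defines "\<delta> \<equiv> 10 ^ 10 * (sqrt (real d * max 1 (ln (real d)) / real n) + s * \<epsilon> powr (1 - 1 / k)
      + least_central_moment_bound d P \<mu> 4 * sqrt (ln (1 / \<tau>) / real n))"
  assumes small: "\<alpha> \<le> 1/8"
  shows "1 - \<tau> \<le> measure (Pi\<^sub>M {..<n} (\<lambda>_. P)) (stable_event n \<alpha> \<delta>)"
proof -
  define L where "L = ln (1 / \<tau>)"
  define l where "l = L / real n"
  define D where "D = real d * max 1 (ln (real d))"
  define s4 where "s4 = least_central_moment_bound d P \<mu> 4"
  define a b c where "a = sqrt (D / real n)" and "b = s * \<epsilon> powr (1 - 1 / k)" and "c = s4 * sqrt l"
  define \<Delta> where "\<Delta> = a + b + c"
  have \<delta>: "\<delta> = 10 ^ 10 * \<Delta>" by (simp add: \<delta>_def \<Delta>_def a_def b_def c_def D_def l_def L_def s4_def)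
  have \<alpha>: "\<alpha> = 800 * (l + \<epsilon>)" by (simp add: \<alpha>_def l_def L_def)
  have n0: "real n > 0" using n by simp
  have L0: "0 \<le> L" and expL: "exp (- L) = \<tau>" using \<tau> by (simp_all add: L_def ln_div)
  have l0: "0 \<le> l" using L0 n0 by (simp add: l_def)
  have l1: "l \<le> 1" using small \<epsilon> unfolding \<alpha> distrib_left by linarith
  have \<alpha>0: "0 < \<alpha>" using l0 \<epsilon> by (simp add: \<alpha>)
  have D1: "real d \<le> D"
    using mult_left_mono[of 1 "max 1 (ln (real d))" "real d"] by (simp add: D_def)
  have D0: "0 < D" using D1 d by simp
  have s1: "1 \<le> s" by (rule central_moment_le(2)[OF bcm _ unit_vector]) (use k in simp)
  have s41: "1 \<le> s4" unfolding s4_def by (rule least_fourth_moment_ge_1[OF bcm k])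
  have a2: "0 \<le> a" "a\<^sup>2 = D / real n" using D0 n0 by (simp_all add: a_def)
  have bge: "\<epsilon> \<le> b"
  proof -
    have "\<epsilon> powr 1 \<le> \<epsilon> powr (1 - 1 / k)" using \<epsilon> k by (intro powr_mono') auto
    moreover have "1 * \<epsilon> powr (1 - 1 / k) \<le> b" unfolding b_def using s1 by (intro mult_right_mono) auto
    ultimately show ?thesis using \<epsilon> by simp
  qed
  have cge: "sqrt l \<le> c" using mult_right_mono[OF s41, of "sqrt l"] l0 by (simp add: c_def)
  have c2: "0 \<le> c" "l \<le> c\<^sup>2" "l \<le> c"
  proof -
    show "0 \<le> c" using cge l0 real_sqrt_ge_zero order_trans by blast
    have "(sqrt l)\<^sup>2 \<le> c\<^sup>2" using cge l0 by (intro power_mono) auto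
    then show "l \<le> c\<^sup>2" using l0 by simp
    have "l = sqrt l * sqrt l" using l0 by simp
    also have "\<dots> \<le> sqrt l * 1" using l0 l1 by (intro mult_left_mono) auto
    finally show "l \<le> c" using cge by simp
  qed
  have b0: "0 \<le> b" using bge \<epsilon> by linarith
  have \<Delta>2: "a\<^sup>2 + b\<^sup>2 + c\<^sup>2 \<le> \<Delta>\<^sup>2"
  proof -
    have "\<Delta>\<^sup>2 = a\<^sup>2 + b\<^sup>2 + c\<^sup>2 + 2 * (a * b + a * c + b * c)" by (simp add: \<Delta>_def power2_eq_square algebra_simps)
    moreover have "0 \<le> a * b + a * c + b * c" using a2 b0 c2 by simp
    ultimately show ?thesis by simp
  qed
  have \<delta>2: "\<delta>\<^sup>2 = 10 ^ 20 * \<Delta>\<^sup>2" by (simp add: \<delta> power_mult_distrib)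
  have \<delta>\<alpha>: "2 * \<alpha> \<le> \<delta>" using bge c2 a2 b0 by (simp add: \<alpha> \<delta> \<Delta>_def)
  show ?thesis
  proof (cases "\<alpha> * real n \<le> 400")
    case True
    have "800 * L \<le> \<alpha> * real n"
    proof -
      have "\<alpha> * real n = 800 * L + 800 * (\<epsilon> * real n)" using n0 by (simp add: \<alpha> l_def field_simps)
      then show ?thesis using \<epsilon> n0 by simp
    qed
    \<comment> \<open>Here \<open>L \<le> 1/2\<close> and
      \<open>\<tau> = exp (- L) \<ge> 1 - L\<close>, so that the required probability
      \<open>1 - \<tau>\<close> is below 3/4.\<close>
    then have "1/2 \<le> \<tau>" using True exp_ge_add_one_self[of "- L"] expL by simp
    moreover have "3/4 \<le> measure (Pi\<^sub>M {..<n} (\<lambda>_. P)) (stable_event n \<alpha> \<delta>)"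
    proof (rule easy_regime[OF n \<alpha>0 small True \<delta>\<alpha>])
      have "real d / real n \<le> D / real n" using D1 n0 by (intro divide_right_mono) auto
      also have "\<dots> = a\<^sup>2" using a2 by simp
      also have "\<dots> \<le> \<Delta>\<^sup>2" using \<Delta>2 zero_le_power2[of b] zero_le_power2[of c] by linarith
      finally have "real d / real n \<le> \<Delta>\<^sup>2" .
      then have "80000 * (real d / real n) \<le> 10 ^ 20 * \<Delta>\<^sup>2" by (intro mult_mono) auto
      then show "80000 * (real d / real n) \<le> \<delta>\<^sup>2" by (simp only: \<delta>2)
    qed
    ultimately show ?thesis by linarith
  next
    case False
    have an: "\<alpha> * real n = 800 * L + 800 * (\<epsilon> * real n)" using n0 by (simp add: \<alpha> l_def field_simps)
    \<comment> \<open>The mean of the two lower bounds 400 and \<open>800 * L\<close> for \<alpha>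
      n.\<close>
    have large2: "200 * (1 + L) \<le> \<alpha> * real n"
    proof -
      have "800 * L \<le> \<alpha> * real n" using an \<epsilon> n0 by simp
      then show ?thesis using False by simp
    qed
    have an0: "0 < \<alpha> * real n" using \<alpha>0 n0 by simp
    \<comment> \<open>For \<open>l \<le> \<epsilon>\<close> this is the least level with \<open>s
      powr k * (\<beta>0 / \<alpha>) powr (1 - k / 2) \<le> \<beta>0\<close>, and
      \<open>\<alpha> * \<beta>0\<close> is the square of
      \<open>s * \<alpha> powr (1 - 1 / k)\<close>. For \<open>l > \<epsilon>\<close> level 1 is
      affordable, since then \<alpha> is at most \<open>1600 * l\<close>.\<close>
    define \<beta>0 where "\<beta>0 = (if l \<le> \<epsilon> then s\<^sup>2 * \<alpha> powr (1 - 2 / k) else 1)"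
    define \<beta> where "\<beta> = max \<beta>0 ((D + L) / (\<alpha> * real n))"
    have \<alpha>\<beta>0: "\<alpha> \<le> \<beta>0"
    proof (cases "l \<le> \<epsilon>")
      case True
      have "\<alpha> powr 1 \<le> \<alpha> powr (1 - 2 / k)" using \<alpha>0 small k by (intro powr_mono') auto
      moreover have "1 * \<alpha> powr (1 - 2 / k) \<le> s\<^sup>2 * \<alpha> powr (1 - 2 / k)" using s1 by (intro mult_right_mono) auto
      ultimately have "\<alpha> powr 1 \<le> s\<^sup>2 * \<alpha> powr (1 - 2 / k)" by linarith
      then show ?thesis using True \<alpha>0 by (simp add: \<beta>0_def)
    qed (use small in \<open>simp add: \<beta>0_def\<close>)
    have \<beta>: "0 < \<beta>" "\<alpha> \<le> \<beta>" "\<beta>0 \<le> \<beta>" using \<alpha>\<beta>0 \<alpha>0 by (auto simp: \<beta>_def)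
    have large1: "D + L \<le> \<alpha> * \<beta> * real n"
    proof -
      have "(D + L) / (\<alpha> * real n) \<le> \<beta>" by (simp add: \<beta>_def)
      then show ?thesis using an0 by (simp add: divide_le_eq mult_ac)
    qed
    have tl: "(\<integral>x. tail (min \<beta> 1 / \<alpha>) v x \<partial>P) \<le> min \<beta> 1 * inner_vec d v v" for v
    proof (cases "\<beta> < 1")
      case False
      then show ?thesis using tail_le_second[of "min \<beta> 1 / \<alpha>" v] by simp
    next
      case True
      then have \<beta>0: "\<beta>0 = s\<^sup>2 * \<alpha> powr (1 - 2 / k)" using \<beta>(3) by (auto simp: \<beta>0_def split: if_splits)
      have "s powr k * \<alpha> powr (k / 2 - 1) = \<beta>0 powr (k / 2)"
      proof -
        have "\<beta>0 powr (k / 2) = (s powr 2) powr (k / 2) * (\<alpha> powr (1 - 2 / k)) powr (k / 2)"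
          unfolding \<beta>0 using s1 by (simp add: powr_mult)
        also have "(s powr 2) powr (k / 2) = s powr k" by (subst powr_powr) simp
        also have "(\<alpha> powr (1 - 2 / k)) powr (k / 2) = \<alpha> powr (k / 2 - 1)"
        proof -
          have "(1 - 2 / k) * (k / 2) = k / 2 - 1" using k by (simp add: left_diff_distrib)
          then show ?thesis by (simp only: powr_powr)
        qed
        finally show ?thesis by simp
      qed
      also have "\<dots> \<le> \<beta> powr (k / 2)" using \<beta> \<alpha>\<beta>0 \<alpha>0 k by (intro powr_mono2) auto
      finally have 1: "s powr k * \<alpha> powr (k / 2 - 1) \<le> \<beta> powr (k / 2)" .
      have "s powr k * (\<beta> / \<alpha>) powr (1 - k / 2) = (s powr k * \<alpha> powr (k / 2 - 1)) * \<beta> powr (1 - k / 2)"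
      proof -
        have "(\<beta> / \<alpha>) powr (1 - k / 2) = \<beta> powr (1 - k / 2) / \<alpha> powr (1 - k / 2)"
          using \<beta> \<alpha>0 by (simp add: powr_divide)
        also have "\<dots> = \<beta> powr (1 - k / 2) * \<alpha> powr (k / 2 - 1)"
        proof -
          have neg: "k / 2 - 1 = - (1 - k / 2)" by simp
          show ?thesis unfolding neg powr_minus_divide by simp
        qed
        finally show ?thesis by simp
      qed
      also have "\<dots> \<le> \<beta> powr (k / 2) * \<beta> powr (1 - k / 2)" using 1 by (intro mult_right_mono) auto
      also have "\<dots> = \<beta>" using \<beta> by (simp flip: powr_add)
      finally have 2: "s powr k * (\<beta> / \<alpha>) powr (1 - k / 2) \<le> \<beta>" .
      have "(\<integral>x. tail (\<beta> / \<alpha>) v x \<partial>P) \<le> s powr k * (\<beta> / \<alpha>) powr (1 - k / 2) * inner_vec d v v"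
        by (rule tail_le_moment[OF bcm]) (use k \<beta> \<alpha>0 in auto)
      also have "\<dots> \<le> \<beta> * inner_vec d v v" using 2 by (intro mult_right_mono) auto
      finally show ?thesis using True by simp
    qed
    have ab: "\<alpha> * \<beta> \<le> 2560000 * \<Delta>\<^sup>2"
    proof -
      have 1: "\<alpha> * ((D + L) / (\<alpha> * real n)) \<le> 2560000 * \<Delta>\<^sup>2"
      proof -
        have "\<alpha> * ((D + L) / (\<alpha> * real n)) = (D + L) / real n" using \<alpha>0 by simp
        also have "\<dots> = a\<^sup>2 + l" by (simp add: a2 l_def add_divide_distrib)
        also have "\<dots> \<le> \<Delta>\<^sup>2" using \<Delta>2 c2 zero_le_power2[of b] by linarith
        finally show ?thesis using zero_le_power2[of \<Delta>] by linarith
      qed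
      have 2: "\<alpha> * \<beta>0 \<le> 2560000 * \<Delta>\<^sup>2"
      proof (cases "l \<le> \<epsilon>")
        case True
        have "\<alpha> * \<beta>0 = s\<^sup>2 * (\<alpha> powr (1 - 1 / k))\<^sup>2"
        proof -
          have "\<alpha> * \<alpha> powr (1 - 2 / k) = \<alpha> powr (1 + (1 - 2 / k))" using \<alpha>0 by (subst powr_add) simp
          also have "1 + (1 - 2 / k) = (1 - 1 / k) + (1 - 1 / k)" by simp
          also have "\<alpha> powr \<dots> = (\<alpha> powr (1 - 1 / k))\<^sup>2" by (simp only: powr_add power2_eq_square)
          finally show ?thesis using True by (simp add: \<beta>0_def)
        qed
        also have "\<dots> \<le> s\<^sup>2 * (1600 * \<epsilon> powr (1 - 1 / k))\<^sup>2"
        proof (intro mult_left_mono power_mono)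
          \<comment> \<open>From \<open>l \<le> \<epsilon>\<close> comes
            \<open>\<alpha> \<le> 1600 * \<epsilon>\<close>. The exponent is at most 1, so the
            constant leaves the power as at most 1600, whose square is 2560000.\<close>
          have "\<alpha> powr (1 - 1 / k) \<le> (1600 * \<epsilon>) powr (1 - 1 / k)"
            using True \<alpha>0 k \<epsilon> by (intro powr_mono2) (auto simp: \<alpha>)
          also have "\<dots> = 1600 powr (1 - 1 / k) * \<epsilon> powr (1 - 1 / k)" using \<epsilon> by (simp add: powr_mult)
          also have "1600 powr (1 - 1 / k) \<le> 1600 powr (1::real)" using k by (intro powr_mono) auto
          finally show "\<alpha> powr (1 - 1 / k) \<le> 1600 * \<epsilon> powr (1 - 1 / k)" by (simp add: mult_right_mono)
        qed auto
        also have "\<dots> = 2560000 * b\<^sup>2" by (simp add: b_def power_mult_distrib)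
        also have "\<dots> \<le> 2560000 * \<Delta>\<^sup>2" using \<Delta>2 zero_le_power2[of a] zero_le_power2[of c] by linarith
        finally show ?thesis .
      next
        case False
        then have "\<alpha> * \<beta>0 \<le> 1600 * l" by (simp add: \<beta>0_def \<alpha>)
        also have "\<dots> \<le> 2560000 * \<Delta>\<^sup>2"
          using \<Delta>2 c2 l0 zero_le_power2[of a] zero_le_power2[of b] by linarith
        finally show ?thesis .
      qed
      show ?thesis using 1 2 by (simp add: \<beta>_def max_def)
    qed
    have "1 - exp (- L) \<le> measure (Pi\<^sub>M {..<n} (\<lambda>_. P)) (stable_event n \<alpha> \<delta>)"
    proof (rule main_regime[OF n \<alpha>0 small \<beta>(1) L0 _ large2 tl \<delta>\<alpha> \<beta>(2)])
      show "real d * max 1 (ln (real d)) + L \<le> \<alpha> * \<beta> * real n" using large1 by (simp add: D_def)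
      show "10 ^ 12 * (\<alpha> * \<beta>) \<le> \<delta>\<^sup>2" 
      proof -
        have "10 ^ 12 * (\<alpha> * \<beta>) \<le> 10 ^ 12 * (2560000 * \<Delta>\<^sup>2)" using ab by (intro mult_left_mono) auto
        also have "\<dots> \<le> 10 ^ 20 * \<Delta>\<^sup>2" by simp
        finally show ?thesis by (simp only: \<delta>2)
      qed
    qed
    then show ?thesis by (simp add: expL)
  qed
qed

theorem theorem1p8:
  "\<exists>C1 C2 c :: real. C1 > 0 \<and> C2 > 0 \<and> c > 0 \<and>
     (\<forall>(d::nat) (n::nat) (\<epsilon>::real) (\<tau>::real) (k::real)
        (P :: (nat \<Rightarrow> real) measure) (\<mu> :: nat \<Rightarrow> real) (\<sigma>k::real).
        d \<ge> 1 \<and> n \<ge> 1 \<and> 0 < \<epsilon> \<and> \<epsilon> < 1/2 \<and> 0 < \<tau> \<and> \<tau> < 1 \<and> k \<ge> 4 \<and>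
        distribution_on_Rd d P \<and> has_mean d P \<mu> \<and> has_covariance d P \<mu> id_mat \<and>
        bounded_central_moment d P \<mu> k \<sigma>k \<longrightarrow>
        (let \<epsilon>' = C1 * (ln (1 / \<tau>) / real n + \<epsilon>);
             \<sigma>4 = least_central_moment_bound d P \<mu> 4;
             \<delta> = C2 * (sqrt (real d * max 1 (ln (real d)) / real n)
                        + \<sigma>k * \<epsilon> powr (1 - 1 / k)
                        + \<sigma>4 * sqrt (ln (1 / \<tau>) / real n))
         in \<epsilon>' \<le> c \<longrightarrow>
            \<P>(X in Pi\<^sub>M {..<n} (\<lambda>_. P).
               \<exists>S'. S' \<subseteq># samples n X \<and>
                    real (size S') \<ge> (1 - \<epsilon>') * real n \<and>
                    stable_multiset d (2 * \<epsilon>') \<delta> S' \<mu> 1)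
              \<ge> 1 - \<tau>))"
\<comment> \<open>The 800 makes \<open>\<alpha> n > 400\<close> imply \<open>large2\<close>. The
  bound 1/8 keeps both \<open>3 * \<alpha>\<close> and the stability parameter
  \<open>2 * \<alpha>\<close> below 1/2. The square of \<open>10 ^ 10\<close> exceeds
  \<open>10 ^ 12 * 1600^2\<close>, the loss of \<open>main_regime\<close> times that of passing from
  \<alpha> to \<epsilon> or \<open>l\<close>.\<close>
proof (rule exI[of _ 800], rule exI[of _ "10 ^ 10"], rule exI[of _ "1/8"], intro conjI allI impI)
  fix d n :: nat and \<epsilon> \<tau> k \<sigma>k :: real and P :: "(nat \<Rightarrow> real) measure" and \<mu> :: "nat \<Rightarrow> real"
  assume asm: "d \<ge> 1 \<and> n \<ge> 1 \<and> 0 < \<epsilon> \<and> \<epsilon> < 1/2 \<and> 0 < \<tau> \<and> \<tau> < 1 \<and> k \<ge> 4 \<and>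
        distribution_on_Rd d P \<and> has_mean d P \<mu> \<and> has_covariance d P \<mu> id_mat \<and>
        bounded_central_moment d P \<mu> k \<sigma>k"
  then interpret centered_distribution d P \<mu> by unfold_locales auto
  show "let \<epsilon>' = 800 * (ln (1 / \<tau>) / real n + \<epsilon>);
             \<sigma>4 = least_central_moment_bound d P \<mu> 4;
             \<delta> = 10 ^ 10 * (sqrt (real d * max 1 (ln (real d)) / real n)
                        + \<sigma>k * \<epsilon> powr (1 - 1 / k)
                        + \<sigma>4 * sqrt (ln (1 / \<tau>) / real n))
         in \<epsilon>' \<le> 1/8 \<longrightarrow>
            \<P>(X in Pi\<^sub>M {..<n} (\<lambda>_. P).
               \<exists>S'. S' \<subseteq># samples n X \<and>
                    real (size S') \<ge> (1 - \<epsilon>') * real n \<and>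
                    stable_multiset d (2 * \<epsilon>') \<delta> S' \<mu> 1)
              \<ge> 1 - \<tau>"
    unfolding Let_def by (intro impI stable_event_prob) (use asm in auto)
qed simp_all

end
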